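(* Let $a,b,c\in UC_b(\mathbb{R})$ with $\inf_{x\in\mathbb{R}}a(x)>0$. Let the operator $H$ in $UC_b(\mathbb{R})$ with domain $D(H)=HC_b^2(\mathbb{R})$ be defined by $(H\varphi)(x)=a(x)\varphi''(x)+b(x)\varphi'(x)+c(x)\varphi(x)$. For $t\ge 0$, $f\in UC_b(\mathbb{R})$ and $x\in\mathbb{R}$ put $$(S(t)f)(x)=\int_{-1}^{1}\frac12\bigl(1+c(x)t\bigr)\,f\Bigl(x+(6a(x)t)^{1/2}y+b(x)t\Bigr)\,dy .$$ Then: 1. $H$ is closable, its closure $\overline{H}$ in $UC_b(\mathbb{R})$ is the generator of a $C_0$-semigroup $(e^{t\overline{H}})_{t\ge0}$ in $UC_b(\mathbb{R})$, and $\|e^{t\overline{H}}\|\le e^{\gamma t}$ for all $t\ge 0$, where $\gamma=\sup_{x\in\mathbb{R}}c(x)$. 2. For every $t\ge0$, $S(t)$ is a bounded linear operator in $UC_b(\mathbb{R})$. 3. For each $f\in C_b^\infty(\mathbb{R})$, $\displaystyle\lim_{t\to+0}\frac1t\,\|S(t)f-f-tHf\|=0$. 4. $S$ and $\overline{H}$ satisfy all the conditions of Chernoff's theorem (listed in the context, with $\mathcal{F}=UC_b(\mathbb{R})$, $G=S$, $L=\overline{H}$); in other words, $S$ is a Chernoff function for $\overline{H}$. 5. If $a,b,c\in HC_b^2(\mathbb{R})$, then there exist non-negative constants $w, C_0,C_1,\dots,C_4$, depending on $a,b,c$ only (independent of $f$, $t$, $n$), such that for all $f\in UC_b^4(\mathbb{R})$,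 all $t>0$ and all positive integers $n\ge t$, $$\bigl\|S(t/n)^nf-e^{t\overline{H}}f\bigr\|\le e^{wt}\,\frac{t^2}{n}\sum_{j=0}^{4}C_j\|f^{(j)}\| .$$ 6. For all $\mathcal{T}>0$ and all $g\in UC_b(\mathbb{R})$, $$\lim_{\mathcal{T}\le n\to\infty}\ \sup_{t\in(0,\mathcal{T}]}\bigl\|S(t/n)^ng-e^{t\overline{H}}g\bigr\|=0 .$$
   Context: $UC_b(\mathbb{R})$ is the Banach space of all bounded uniformly continuous functions $\mathbb{R}\to\mathbb{R}$ with the uniform norm $\|f\|=\sup_{x\in\mathbb{R}}|f(x)|$; operator norms are taken with respect to it. For $n\ge1$, $UC_b^n(\mathbb{R})=\{f\in UC_b(\mathbb{R}): f',f'',\dots,f^{(n)}\in UC_b(\mathbb{R})\}$, and $C_b^\infty(\mathbb{R})=\bigcap_{n\ge1}UC_b^n(\mathbb{R})$. $HC_b^k(\mathbb{R})$ is the set of $k$ times differentiable functions $f:\mathbb{R}\to\mathbb{R}$ such that $f,f',\dots,f^{(k)}$ are all bounded and Hölder continuous on $\mathbb{R}$ (a function $g$ is Hölder continuous if there are $K\ge0$ and $\theta\in(0,1]$ with $|g(x)-g(y)|\le K|x-y|^\theta$ for all $x,y$; the exponent may depend on the function). For a bounded operator $B$, $B^n$ is the composition of $n$ copies of $B$. For a generator $L$ of a $C_0$-semigroup, $(e^{tL})_{t\ge0}$ denotes the semigroup it generates. Conditions of Chernoff's theorem for a function $G:[0,\infty)\to\mathscr{L}(\mathcal{F})$ (bounded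 linear operators on a Banach space $\mathcal{F}$) and a closed densely defined linear operator $(L,D(L))$ in $\mathcal{F}$: (E) $L$ is the generator of a $C_0$-semigroup $(e^{tL})_{t\ge0}$ in $\mathcal{F}$; (CT) $G$ is Chernoff-tangent to $L$, i.e.: $\lim_{t\to0}\|G(t)f-G(0)f\|=0$ for each $f\in\mathcal{F}$; $G(0)=I$; there is a dense linear subspace $\mathcal{D}\subset\mathcal{F}$ such that for each $f\in\mathcal{D}$ the limit $G'(0)f:=\lim_{t\to0}(G(t)f-f)/t$ exists in $\mathcal{F}$; and the operator $(G'(0),\mathcal{D})$ is closable with closure equal to $(L,D(L))$; (N) there is $\omega\in\mathbb{R}$ with $\|G(t)\|\le e^{\omega t}$ for all $t\ge0$. A function $G$ that is Chernoff-tangent to $L$ and satisfies $\lim_{n\to\infty}\sup_{t\in[0,t_0]}\|G(t/n)^nf-e^{tL}f\|=0$ for every $f\in\mathcal{F}$ and $t_0>0$ is called a Chernoff function for $L$. *)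

theory Defs
  imports "HOL-Analysis.Analysis"
begin

section \<open>The Banach space of bounded uniformly continuous functions\<close>

definition UCb :: "(real \<Rightarrow> real) set" where
  "UCb = {f. bounded (range f) \<and> uniformly_continuous_on UNIV f}"

lemma UCbI:
  "(\<And>x. \<bar>f x\<bar> \<le> B) \<Longrightarrow> uniformly_continuous_on UNIV f \<Longrightarrow> f \<in> UCb"
  by (auto simp: UCb_def bounded_iff)

lemma UCb_bound:
  assumes "f \<in> UCb" obtains B where "B > 0" "\<And>x. \<bar>f x\<bar> \<le> B"
proof -
  from assms obtain B where B: "\<And>x. \<bar>f x\<bar> \<le> B"
    by (auto simp: UCb_def bounded_iff)
  have "\<bar>f x\<bar> \<le> \<bar>B\<bar> + 1" for x using B[of x] by linarith
  then show thesis using that[of "\<bar>B\<bar> + 1"] by auto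
qed

lemma UCb_const: "(\<lambda>x. r) \<in> UCb"
  by (rule UCbI[of _ "\<bar>r\<bar>"]) (auto intro: uniformly_continuous_on_const)

lemma UCb_add: "f \<in> UCb \<Longrightarrow> g \<in> UCb \<Longrightarrow> (\<lambda>x. f x + g x) \<in> UCb"
  by (auto simp: UCb_def bounded_plus_comp intro: uniformly_continuous_on_add)

lemma UCb_mult:
  assumes f: "f \<in> UCb" and g: "g \<in> UCb" shows "(\<lambda>x. f x * g x) \<in> UCb"
proof -
  obtain A where A: "A > 0" "\<And>x. \<bar>f x\<bar> \<le> A" by (rule UCb_bound[OF f]) blast
  obtain B where B: "B > 0" "\<And>x. \<bar>g x\<bar> \<le> B" by (rule UCb_bound[OF g]) blast
  show ?thesis
  proof (rule UCbI)
    show "\<bar>f x * g x\<bar> \<le> A * B" for x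
      by (simp add: abs_mult A B mult_mono less_imp_le)
    show "uniformly_continuous_on UNIV (\<lambda>x. f x * g x)"
      unfolding uniformly_continuous_on_def
    proof (intro allI impI)
      fix e :: real assume e: "e > 0"
      from f e B(1) have "e / (2 * B) > 0" by simp
      with f obtain d1 where d1: "d1 > 0" "\<And>x y. dist y x < d1 \<Longrightarrow> dist (f y) (f x) < e / (2 * B)"
        unfolding UCb_def uniformly_continuous_on_def by fastforce
      from g e A(1) have "e / (2 * A) > 0" by simp
      with g obtain d2 where d2: "d2 > 0" "\<And>x y. dist y x < d2 \<Longrightarrow> dist (g y) (g x) < e / (2 * A)"
        unfolding UCb_def uniformly_continuous_on_def by fastforce
      have "dist (f y * g y) (f x * g x) < e" if "dist y x < min d1 d2" for x y
      proof -
        have 1: "\<bar>f y - f x\<bar> < e / (2 * B)" and 2: "\<bar>g y - g x\<bar> < e / (2 * A)"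
          using d1(2)[of y x] d2(2)[of y x] that by (auto simp: dist_real_def)
        have "f y * g y - f x * g x = (f y - f x) * g y + f x * (g y - g x)"
          by (simp add: algebra_simps)
        then have "\<bar>f y * g y - f x * g x\<bar> \<le> \<bar>f y - f x\<bar> * \<bar>g y\<bar> + \<bar>f x\<bar> * \<bar>g y - g x\<bar>"
          by (metis abs_mult abs_triangle_ineq)
        also have "\<dots> \<le> \<bar>f y - f x\<bar> * B + A * \<bar>g y - g x\<bar>"
          by (intro add_mono mult_mono) (use A B in \<open>auto simp: less_imp_le\<close>)
        also have "\<dots> < e / (2 * B) * B + A * (e / (2 * A))"
          by (intro add_strict_mono mult_strict_right_mono mult_strict_left_mono 1 2 A B)
        also have "\<dots> = e" using A B by simp
        finally show ?thesis by (simp add: dist_real_def)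
      qed
      then show "\<exists>d>0. \<forall>x\<in>UNIV. \<forall>x'\<in>UNIV. dist x' x < d \<longrightarrow> dist (f x' * g x') (f x * g x) < e"
        using d1(1) d2(1) by (intro exI[of _ "min d1 d2"]) auto
    qed
  qed
qed

typedef ucb = UCb morphisms ucb_apply Abs_ucb
  using UCb_const by blast

setup_lifting type_definition_ucb

declare [[coercion "ucb_apply :: ucb \<Rightarrow> real \<Rightarrow> real"]]

lemma ucb_eqI: "(\<And>x. ucb_apply f x = ucb_apply g x) \<Longrightarrow> f = g"
  by transfer auto

definition sup_norm :: "(real \<Rightarrow> real) \<Rightarrow> real" where
  "sup_norm g = (SUP x. \<bar>g x\<bar>)"

instantiation ucb :: real_normed_vector
begin

lift_definition zero_ucb :: ucb is "\<lambda>x. 0" by (rule UCb_const)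
lift_definition plus_ucb :: "ucb \<Rightarrow> ucb \<Rightarrow> ucb" is "\<lambda>f g x. f x + g x" by (rule UCb_add)
lift_definition scaleR_ucb :: "real \<Rightarrow> ucb \<Rightarrow> ucb" is "\<lambda>r f x. r * f x"
  by (rule UCb_mult[OF UCb_const])
lift_definition uminus_ucb :: "ucb \<Rightarrow> ucb" is "\<lambda>f x. - f x"
  using UCb_mult[OF UCb_const[of "-1"]] by simp
lift_definition minus_ucb :: "ucb \<Rightarrow> ucb \<Rightarrow> ucb" is "\<lambda>f g x. f x - g x"
  using UCb_add[OF _ UCb_mult[OF UCb_const[of "-1"]]] by simp

definition norm_ucb :: "ucb \<Rightarrow> real" where "norm_ucb f = sup_norm (ucb_apply f)"
definition dist_ucb :: "ucb \<Rightarrow> ucb \<Rightarrow> real" where "dist_ucb f g = norm (f - g)"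
definition sgn_ucb :: "ucb \<Rightarrow> ucb" where "sgn_ucb f = inverse (norm f) *\<^sub>R f"
definition uniformity_ucb :: "(ucb \<times> ucb) filter"
  where "uniformity_ucb = (INF e\<in>{0 <..}. principal {(x, y). dist x y < e})"
definition open_ucb :: "ucb set \<Rightarrow> bool"
  where "open_ucb S = (\<forall>x\<in>S. \<forall>\<^sub>F (x', y) in uniformity. x' = x \<longrightarrow> y \<in> S)"

lemma ucb_bdd: "bdd_above (range (\<lambda>x. \<bar>ucb_apply f x\<bar>))"
  using ucb_apply[of f] UCb_bound by (metis bdd_above.I2)

lemma ucb_apply_le_norm: "\<bar>ucb_apply f x\<bar> \<le> norm f"
  unfolding norm_ucb_def sup_norm_def by (rule cSUP_upper[OF UNIV_I ucb_bdd])

lemma ucb_norm_le: "(\<And>x. \<bar>ucb_apply f x\<bar> \<le> B) \<Longrightarrow> norm f \<le> B"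
  unfolding norm_ucb_def sup_norm_def by (rule cSUP_least) auto

instance
proof
  fix f g h :: ucb and r s :: real
  show "dist f g = norm (f - g)" by (rule dist_ucb_def)
  show "f + g + h = f + (g + h)" by transfer (simp add: add.assoc)
  show "f + g = g + f" by transfer (simp add: add.commute)
  show "0 + f = f" by transfer simp
  show "- f + f = 0" by transfer simp
  show "f - g = f + - g" by transfer simp
  show "r *\<^sub>R (f + g) = r *\<^sub>R f + r *\<^sub>R g" by transfer (simp add: algebra_simps)
  show "(r + s) *\<^sub>R f = r *\<^sub>R f + s *\<^sub>R f" by transfer (simp add: algebra_simps)
  show "r *\<^sub>R s *\<^sub>R f = (r * s) *\<^sub>R f" by transfer (simp add: algebra_simps)
  show "1 *\<^sub>R f = f" by transfer simp
  show "sgn f = inverse (norm f) *\<^sub>R f" by (rule sgn_ucb_def)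
  show "norm f = 0 \<longleftrightarrow> f = 0"
  proof
    assume "norm f = 0"
    then have "ucb_apply f x = 0" for x using ucb_apply_le_norm[of f x] by simp
    then show "f = 0" by (intro ucb_eqI) (simp add: zero_ucb.rep_eq)
  qed (simp add: norm_ucb_def sup_norm_def zero_ucb.rep_eq)
  show "norm (f + g) \<le> norm f + norm g"
  proof (rule ucb_norm_le)
    fix x show "\<bar>ucb_apply (f + g) x\<bar> \<le> norm f + norm g"
      using ucb_apply_le_norm[of f x] ucb_apply_le_norm[of g x] by (simp add: plus_ucb.rep_eq)
  qed
  have le: "norm (r *\<^sub>R f) \<le> \<bar>r\<bar> * norm f" for r :: real and f :: ucb
    by (rule ucb_norm_le) (simp add: scaleR_ucb.rep_eq abs_mult ucb_apply_le_norm mult_left_mono)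
  show "norm (r *\<^sub>R f) = \<bar>r\<bar> * norm f"
  proof (cases "r = 0")
    case True
    have "norm (r *\<^sub>R f) \<ge> 0" using ucb_apply_le_norm[of "r *\<^sub>R f" 0] by linarith
    with le[of r f] True show ?thesis by simp
  next
    case False
    have "inverse r *\<^sub>R (r *\<^sub>R f) = f" by (rule ucb_eqI) (simp add: scaleR_ucb.rep_eq False)
    with le[of "inverse r" "r *\<^sub>R f"] have "norm f \<le> norm (r *\<^sub>R f) / \<bar>r\<bar>"
      by (simp add: divide_inverse mult.commute)
    with False have "\<bar>r\<bar> * norm f \<le> norm (r *\<^sub>R f)" by (simp add: field_simps)
    with le[of r f] show ?thesis by simp
  qed
qed (rule uniformity_ucb_def open_ucb_def)+

end

instance ucb :: banach
proof
  fix X :: "nat \<Rightarrow> ucb" assume X: "Cauchy X"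
  have near: "\<bar>ucb_apply (X m) x - ucb_apply (X n) x\<bar> \<le> norm (X m - X n)" for m n x
    using ucb_apply_le_norm[of "X m - X n" x] by (simp add: minus_ucb.rep_eq)
  have "Cauchy (\<lambda>n. ucb_apply (X n) x)" for x
  proof (rule metric_CauchyI)
    fix e :: real assume "e > 0"
    from metric_CauchyD[OF X this] obtain M where "\<forall>m\<ge>M. \<forall>n\<ge>M. dist (X m) (X n) < e" by blast
    then show "\<exists>M. \<forall>m\<ge>M. \<forall>n\<ge>M. dist (ucb_apply (X m) x) (ucb_apply (X n) x) < e"
      using near by (metis dist_norm dist_real_def le_less_trans)
  qed
  then have lim: "(\<lambda>n. ucb_apply (X n) x) \<longlonglongrightarrow> lim (\<lambda>n. ucb_apply (X n) x)" for x
    by (simp add: Cauchy_convergent_iff convergent_LIMSEQ_iff)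
  define g where "g x = lim (\<lambda>n. ucb_apply (X n) x)" for x
  have unif: "\<exists>M. \<forall>n\<ge>M. \<forall>x. \<bar>ucb_apply (X n) x - g x\<bar> \<le> e" if "e > 0" for e
  proof -
    from metric_CauchyD[OF X that] obtain M where M: "\<forall>m\<ge>M. \<forall>n\<ge>M. dist (X m) (X n) < e" by blast
    have "\<bar>ucb_apply (X n) x - g x\<bar> \<le> e" if n: "n \<ge> M" for n x
    proof (rule LIMSEQ_le_const2)
      show "(\<lambda>m. \<bar>ucb_apply (X n) x - ucb_apply (X m) x\<bar>) \<longlonglongrightarrow> \<bar>ucb_apply (X n) x - g x\<bar>"
        unfolding g_def by (intro tendsto_intros lim)
      show "\<exists>N. \<forall>m\<ge>N. \<bar>ucb_apply (X n) x - ucb_apply (X m) x\<bar> \<le> e"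
        using M n near[of n x] by (intro exI[of _ M]) (smt (verit) dist_norm)
    qed
    then show ?thesis by blast
  qed
  have "g \<in> UCb"
  proof -
    from unif[of 1] obtain M where "\<forall>x. \<bar>ucb_apply (X M) x - g x\<bar> \<le> 1" by auto
    then have b: "\<bar>g x\<bar> \<le> norm (X M) + 1" for x
      using ucb_apply_le_norm[of "X M" x] by (smt (verit))
    have "uniformly_continuous_on UNIV g"
      unfolding uniformly_continuous_on_def
    proof (intro allI impI)
      fix e :: real assume e: "e > 0"
      from unif[of "e / 3"] e obtain M where M: "\<And>x. \<bar>ucb_apply (X M) x - g x\<bar> \<le> e / 3" by auto
      have "uniformly_continuous_on UNIV (ucb_apply (X M))"
        using ucb_apply[of "X M"] by (simp add: UCb_def)
      then obtain d where d: "d > 0"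
        "\<And>x y. dist y x < d \<Longrightarrow> dist (ucb_apply (X M) y) (ucb_apply (X M) x) < e / 3"
        using e unfolding uniformly_continuous_on_def by (metis UNIV_I divide_pos_pos zero_less_numeral)
      have "dist (g y) (g x) < e" if "dist y x < d" for x y
        using d(2)[OF that] M[of x] M[of y] unfolding dist_real_def by linarith
      with d(1) show "\<exists>d>0. \<forall>x\<in>UNIV. \<forall>x'\<in>UNIV. dist x' x < d \<longrightarrow> dist (g x') (g x) < e" by auto
    qed
    with b show ?thesis by (rule UCbI)
  qed
  then have app: "ucb_apply (Abs_ucb g) = g" by (rule Abs_ucb_inverse)
  have "X \<longlonglongrightarrow> Abs_ucb g"
  proof (rule metric_LIMSEQ_I)
    fix e :: real assume e: "e > 0"
    from unif[of "e / 2"] e obtain M where M: "\<forall>n\<ge>M. \<forall>x. \<bar>ucb_apply (X n) x - g x\<bar> \<le> e / 2" by auto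
    have "dist (X n) (Abs_ucb g) < e" if "n \<ge> M" for n
    proof -
      have "norm (X n - Abs_ucb g) \<le> e / 2"
        by (rule ucb_norm_le) (use M that in \<open>simp add: minus_ucb.rep_eq app\<close>)
      with e show ?thesis by (simp add: dist_norm)
    qed
    then show "\<exists>M. \<forall>n\<ge>M. dist (X n) (Abs_ucb g) < e" by blast
  qed
  then show "convergent X" by (rule convergentI)
qed


section \<open>Spaces of differentiable functions\<close>

definition times_differentiable :: "nat \<Rightarrow> (real \<Rightarrow> real) \<Rightarrow> bool" where
  "times_differentiable k f \<longleftrightarrow> (\<forall>j<k. \<forall>x. (deriv ^^ j) f field_differentiable at x)"

definition UCb_n :: "nat \<Rightarrow> (real \<Rightarrow> real) set" where
  "UCb_n n = {f \<in> UCb. times_differentiable n f \<and> (\<forall>j\<in>{1..n}. (deriv ^^ j) f \<in> UCb)}"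

definition Cb_infty :: "(real \<Rightarrow> real) set" where
  "Cb_infty = (\<Inter>n\<in>{1..}. UCb_n n)"

definition Hoelder_continuous :: "(real \<Rightarrow> real) \<Rightarrow> bool" where
  "Hoelder_continuous g \<longleftrightarrow>
    (\<exists>K\<ge>0. \<exists>\<theta>\<in>{0<..1}. \<forall>x y. \<bar>g x - g y\<bar> \<le> K * \<bar>x - y\<bar> powr \<theta>)"

definition HCb :: "nat \<Rightarrow> (real \<Rightarrow> real) set" where
  "HCb k = {f. times_differentiable k f \<and>
    (\<forall>j\<le>k. bounded (range ((deriv ^^ j) f)) \<and> Hoelder_continuous ((deriv ^^ j) f))}"


section \<open>Unbounded operators and \<open>C\<^sub>0\<close>-semigroups\<close>

text \<open>An operator \<open>(A, D(A))\<close> in a Banach space is represented by its graph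
  \<open>{(f, A f) | f \<in> D(A)}\<close>, so that its domain is \<^const>\<open>Domain\<close> of that set, and its closure
  is the topological closure of the graph in the product space.\<close>

definition linear_operator :: "('a::real_normed_vector \<times> 'a) set \<Rightarrow> bool" where
  "linear_operator A \<longleftrightarrow> subspace A \<and> single_valued A"

definition closable :: "('a::real_normed_vector \<times> 'a) set \<Rightarrow> bool" where
  "closable A \<longleftrightarrow> linear_operator A \<and> linear_operator (closure A)"

definition closed_densely_defined :: "('a::real_normed_vector \<times> 'a) set \<Rightarrow> bool" where
  "closed_densely_defined A \<longleftrightarrow> linear_operator A \<and> closed A \<and> closure (Domain A) = UNIV"

text \<open>Operator families indexed by \<open>t \<ge> 0\<close> are functions on all of \<^typ>\<open>real\<close>; values at negative
  times are irrelevant.\<close>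

definition C0_semigroup :: "(real \<Rightarrow> 'a::banach \<Rightarrow>\<^sub>L 'a) \<Rightarrow> bool" where
  "C0_semigroup T \<longleftrightarrow> T 0 = id_blinfun \<and>
    (\<forall>s\<ge>0. \<forall>t\<ge>0. T (s + t) = T s o\<^sub>L T t) \<and>
    (\<forall>f. continuous_on {0..} (\<lambda>t. T t f))"

definition generator :: "(real \<Rightarrow> 'a::banach \<Rightarrow>\<^sub>L 'a) \<Rightarrow> ('a \<times> 'a) set" where
  "generator T = {(f, g). ((\<lambda>t. (T t f - f) /\<^sub>R t) \<longlongrightarrow> g) (at_right 0)}"

definition generates :: "('a::banach \<times> 'a) set \<Rightarrow> (real \<Rightarrow> 'a \<Rightarrow>\<^sub>L 'a) \<Rightarrow> bool" where
  "generates L T \<longleftrightarrow> C0_semigroup T \<and> generator T = L"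

definition is_generator :: "('a::banach \<times> 'a) set \<Rightarrow> bool" where
  "is_generator L \<longleftrightarrow> (\<exists>T. generates L T)"

text \<open>A \<open>C\<^sub>0\<close>-semigroup is determined on \<open>t \<ge> 0\<close> by its generator, so for \<open>t \<ge> 0\<close> the choice below
  is unambiguous.\<close>

definition semigroup_of :: "('a::banach \<times> 'a) set \<Rightarrow> real \<Rightarrow> 'a \<Rightarrow>\<^sub>L 'a" where
  "semigroup_of L = (SOME T. generates L T)"


section \<open>Chernoff's theorem\<close>

definition deriv_at_0 :: "(real \<Rightarrow> 'a::banach \<Rightarrow>\<^sub>L 'a) \<Rightarrow> 'a \<Rightarrow> 'a" where
  "deriv_at_0 G f = Lim (at_right 0) (\<lambda>t. (G t f - f) /\<^sub>R t)"

definition Chernoff_tangent :: "(real \<Rightarrow> 'a::banach \<Rightarrow>\<^sub>L 'a) \<Rightarrow> ('a \<times> 'a) set \<Rightarrow> bool" where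
  "Chernoff_tangent G L \<longleftrightarrow>
    (\<forall>f. ((\<lambda>t. norm (G t f - G 0 f)) \<longlongrightarrow> 0) (at_right 0)) \<and>
    G 0 = id_blinfun \<and>
    (\<exists>D. subspace D \<and> closure D = UNIV \<and>
      (\<forall>f\<in>D. \<exists>g. ((\<lambda>t. (G t f - f) /\<^sub>R t) \<longlongrightarrow> g) (at_right 0)) \<and>
      closable ((\<lambda>f. (f, deriv_at_0 G f)) ` D) \<and>
      closure ((\<lambda>f. (f, deriv_at_0 G f)) ` D) = L)"

definition Chernoff_conditions :: "(real \<Rightarrow> 'a::banach \<Rightarrow>\<^sub>L 'a) \<Rightarrow> ('a \<times> 'a) set \<Rightarrow> bool" where
  "Chernoff_conditions G L \<longleftrightarrow>
    closed_densely_defined L \<and>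
    is_generator L \<and>
    Chernoff_tangent G L \<and>
    (\<exists>\<omega>. \<forall>t\<ge>0. norm (G t) \<le> exp (\<omega> * t))"

text \<open>The supremum over \<open>t\<close> is taken in \<^typ>\<open>ereal\<close>, where it is meaningful without any
  boundedness assumption.\<close>

definition Chernoff_function :: "(real \<Rightarrow> 'a::banach \<Rightarrow>\<^sub>L 'a) \<Rightarrow> ('a \<times> 'a) set \<Rightarrow> bool" where
  "Chernoff_function G L \<longleftrightarrow> Chernoff_tangent G L \<and>
    (\<forall>f. \<forall>t\<^sub>0>0.
      (\<lambda>n. SUP t\<in>{0..t\<^sub>0}.
        ereal (norm ((blinfun_apply (G (t / real n)) ^^ n) f - semigroup_of L t f)))
      \<longlonglongrightarrow> 0)"


section \<open>The differential operator and the Chernoff function\<close>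

definition H_fun :: "ucb \<Rightarrow> ucb \<Rightarrow> ucb \<Rightarrow> (real \<Rightarrow> real) \<Rightarrow> real \<Rightarrow> real" where
  "H_fun a b c \<phi> x = a x * (deriv ^^ 2) \<phi> x + b x * deriv \<phi> x + c x * \<phi> x"

text \<open>\<open>H_op\<close> is meaningful only if \<^const>\<open>H_fun\<close> yields an element of \<^const>\<open>UCb\<close>; the lemmas
  below show this on \<open>D(H)\<close> and on \<^const>\<open>Cb_infty\<close>.\<close>

definition H_op :: "ucb \<Rightarrow> ucb \<Rightarrow> ucb \<Rightarrow> ucb \<Rightarrow> ucb" where
  "H_op a b c \<phi> = Abs_ucb (H_fun a b c \<phi>)"

definition H_graph :: "ucb \<Rightarrow> ucb \<Rightarrow> ucb \<Rightarrow> (ucb \<times> ucb) set" where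
  "H_graph a b c = {(\<phi>, H_op a b c \<phi>) | \<phi>. ucb_apply \<phi> \<in> HCb 2}"

definition S_fun :: "ucb \<Rightarrow> ucb \<Rightarrow> ucb \<Rightarrow> real \<Rightarrow> (real \<Rightarrow> real) \<Rightarrow> real \<Rightarrow> real" where
  "S_fun a b c t f x =
    integral {-1..1} (\<lambda>y. 1/2 * (1 + c x * t) * f (x + sqrt (6 * a x * t) * y + b x * t))"

definition S_map :: "ucb \<Rightarrow> ucb \<Rightarrow> ucb \<Rightarrow> real \<Rightarrow> ucb \<Rightarrow> ucb" where
  "S_map a b c t f = Abs_ucb (S_fun a b c t f)"

definition S_op :: "ucb \<Rightarrow> ucb \<Rightarrow> ucb \<Rightarrow> real \<Rightarrow> ucb \<Rightarrow>\<^sub>L ucb" where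
  "S_op a b c t = Blinfun (S_map a b c t)"

lemma Hoelder_UCb:
  assumes "bounded (range g)" "Hoelder_continuous g" shows "g \<in> UCb"
proof -
  obtain K \<theta> where K: "K \<ge> 0" and \<theta>: "\<theta> > 0"
    and H: "\<And>x y. \<bar>g x - g y\<bar> \<le> K * \<bar>x - y\<bar> powr \<theta>"
    using assms(2) unfolding Hoelder_continuous_def by auto
  have "uniformly_continuous_on UNIV g"
    unfolding uniformly_continuous_on_def
  proof (intro allI impI)
    fix e :: real assume e: "e > 0"
    define d where "d = (e / (K + 1)) powr (1 / \<theta>)"
    have d: "d > 0" using e K by (simp add: d_def)
    have "dist (g y) (g x) < e" if "dist y x < d" for x y
    proof -
      have "\<bar>y - x\<bar> powr \<theta> \<le> d powr \<theta>"
        using that \<theta> by (intro powr_mono2) (auto simp: dist_real_def)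
      also have "\<dots> = e / (K + 1)" using e K \<theta> by (simp add: d_def powr_powr)
      finally have "K * \<bar>y - x\<bar> powr \<theta> \<le> K * (e / (K + 1))" using K by (rule mult_left_mono)
      also have "\<dots> < e" using e K by (simp add: field_simps)
      finally show ?thesis using H[of y x] by (simp add: dist_real_def)
    qed
    with d show "\<exists>d>0. \<forall>x\<in>UNIV. \<forall>x'\<in>UNIV. dist x' x < d \<longrightarrow> dist (g x') (g x) < e" by auto
  qed
  with assms(1) show ?thesis by (simp add: UCb_def)
qed

lemma HCb_UCb_n:
  assumes "f \<in> HCb k" shows "f \<in> UCb_n k"
proof -
  have *: "(deriv ^^ j) f \<in> UCb" if "j \<le> k" for j
    using assms that by (auto simp: HCb_def intro: Hoelder_UCb)
  from *[of 0] have "f \<in> UCb" by simp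
  with * assms show ?thesis by (auto simp: UCb_n_def HCb_def)
qed

lemma H_op_apply:
  assumes "ucb_apply \<phi> \<in> UCb_n 2" shows "ucb_apply (H_op a b c \<phi>) = H_fun a b c \<phi>"
proof -
  have d: "(deriv ^^ j) (ucb_apply \<phi>) \<in> UCb" if "j \<in> {1, 2}" for j
    using assms that by (auto simp: UCb_n_def)
  from d[of 1] d[of 2] have "deriv (ucb_apply \<phi>) \<in> UCb" "(deriv ^^ 2) (ucb_apply \<phi>) \<in> UCb" by simp_all
  then have "H_fun a b c \<phi> \<in> UCb"
    unfolding H_fun_def[abs_def] by (intro UCb_add UCb_mult ucb_apply)
  then show ?thesis by (simp add: H_op_def Abs_ucb_inverse)
qed

lemma H_op_apply_HCb:
  "ucb_apply \<phi> \<in> HCb 2 \<Longrightarrow> ucb_apply (H_op a b c \<phi>) = H_fun a b c \<phi>"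
  by (intro H_op_apply HCb_UCb_n)

lemma H_op_apply_Cb_infty:
  "ucb_apply \<phi> \<in> Cb_infty \<Longrightarrow> ucb_apply (H_op a b c \<phi>) = H_fun a b c \<phi>"
  by (intro H_op_apply) (auto simp: Cb_infty_def)

end

theory Submission
  imports Defs "HOL-Real_Asymp.Real_Asymp"
begin

text \<open>The proof rests on the fact that in one dimension the closure of \<open>H\<close> can be identified completely:
it is the same differential expression on the space \<open>UCb_n 2\<close> of functions with two bounded
uniformly continuous derivatives, because \<open>u'' = (H u - b u' - c u) / a\<close> and the first derivative can
be interpolated between \<open>u\<close> and \<open>u''\<close> (\<open>elliptic_estimate\<close>). Moving averages show that \<open>HCb 2\<close> is a
core (\<open>closure_H_graph\<close>).

The operators \<open>S(t)\<close> themselves provide the maximum principle. If \<open>Y\<close> is uniform on \<open>[-1,1]\<close>, then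
\<open>S(t) f x = (1 + c t) E f(x + (6 a t)\<^sup>1\<^sup>/\<^sup>2 Y + b t)\<close>, so \<open>S(t)\<close> is bounded by \<open>1 + \<gamma> t\<close> for small \<open>t\<close>,
while the moments of \<open>Y\<close> and Taylor's formula give \<open>S(t) u = u + t H u + o(t)\<close>
(\<open>S_taylor2\<close>). Together these two facts say that \<open>H - \<gamma>\<close> is dissipative
(\<open>dissipative\<close>). With the a priori estimate, the method of continuity deforms the explicitly solvable
equation \<open>l u - u'' = g\<close> into \<open>l u - H u = g\<close> (\<open>resolvent_exists\<close>), and the implicit Euler scheme with
halved steps produces the semigroup (\<open>generates_euler_limit\<close>).

For the convergence of \<open>S(t/n)^n\<close>, the difference \<open>S(t/n)^n f - T(t) f\<close> telescopes into \<open>n\<close> local errors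
\<open>S(h) u - T(h) u\<close> with \<open>h = t/n\<close> and \<open>u = T(s) f\<close>. If \<open>f\<close> is in the domain of the square of the
generator, then so is every \<open>u\<close>, with bounds uniform in \<open>s\<close>, and \<open>second_derivative_modulus\<close> turns these
bounds into a common modulus of continuity of the functions \<open>u''\<close>; the local errors are then \<open>o(h)\<close>
uniformly in \<open>s\<close>. Density gives the convergence for all \<open>f\<close> (\<open>chernoff_convergence\<close>), and with it the bound
\<open>exp (\<gamma> t)\<close> for the semigroup. If the coefficients are in \<open>UCb_n 2\<close>, the domain of the
square of the generator is exactly \<open>UCb_n 4\<close>, with equivalent norms (\<open>cn4_equivalent\<close>). Then a
fourth order Taylor expansion makes the local error \<open>O(h\<^sup>2)\<close>, and \<open>n\<close> such errors add up to
\<open>O(t\<^sup>2/n)\<close> (\<open>chernoff_rate\<close>).\<close>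

section \<open>Iterates of bounded operators\<close>

lemma norm_triangle_add3:
  fixes x y z :: "'a::real_normed_vector"
  shows "norm (x + y + z) \<le> norm x + norm y + norm z"
  using norm_triangle_ineq[of "x + y" z] norm_triangle_ineq[of x y] by linarith

lemma linear_funpow_blinfun:
  fixes U :: "'a::real_normed_vector \<Rightarrow>\<^sub>L 'a"
  shows "linear (blinfun_apply U ^^ n)"
proof (induction n)
  case 0
  then show ?case by (auto simp: linear_iff)
next
  case (Suc n)
  have "linear (blinfun_apply U \<circ> (blinfun_apply U ^^ n))"
    by (intro linear_compose Suc bounded_linear.linear blinfun.bounded_linear_right)
  then show ?case by (simp add: comp_def)
qed

lemma norm_funpow_le:
  fixes U :: "'a::real_normed_vector \<Rightarrow>\<^sub>L 'a"
  assumes "norm U \<le> K"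
  shows "norm ((blinfun_apply U ^^ n) v) \<le> K ^ n * norm v"
proof (induction n)
  case (Suc n)
  have "norm (U ((blinfun_apply U ^^ n) v)) \<le> norm U * norm ((blinfun_apply U ^^ n) v)"
    by (rule norm_blinfun)
  also have "\<dots> \<le> K * (K ^ n * norm v)"
    using assms Suc order_trans[OF norm_ge_zero assms] by (intro mult_mono) auto
  finally show ?case by (simp add: mult.assoc)
qed simp

lemma norm_funpow_diff_id_le:
  fixes U :: "'a::real_normed_vector \<Rightarrow>\<^sub>L 'a"
  assumes "\<And>k v. k < n \<Longrightarrow> norm ((blinfun_apply U ^^ k) v) \<le> M * norm v"
  shows "norm ((blinfun_apply U ^^ n) v - v) \<le> real n * M * norm (U v - v)"
  using assms
proof (induction n)
  case (Suc n)
  have "(blinfun_apply U ^^ Suc n) v - v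
      = (blinfun_apply U ^^ n) (U v - v) + ((blinfun_apply U ^^ n) v - v)"
    by (simp add: linear_diff[OF linear_funpow_blinfun] funpow_swap1)
  then have "norm ((blinfun_apply U ^^ Suc n) v - v)
      \<le> norm ((blinfun_apply U ^^ n) (U v - v)) + norm ((blinfun_apply U ^^ n) v - v)"
    by (metis norm_triangle_ineq)
  also have "\<dots> \<le> M * norm (U v - v) + real n * M * norm (U v - v)"
    using Suc.prems[of n "U v - v"] Suc.IH[OF Suc.prems] by (intro add_mono) auto
  finally show ?case by (simp add: algebra_simps)
qed simp

text \<open>In the expansion \<open>U^n v - v - n h w = \<Sum>k<n. U^k (U v - v - h w) + h (U^k w - w)\<close> the last term is
controlled by the first order bound \<open>norm_funpow_diff_id_le\<close>. If \<open>U\<close> is one step of length \<open>h\<close> of a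
scheme or of a semigroup whose generator maps \<open>v\<close> to \<open>w\<close>, this measures the deviation of an orbit from
its tangent without differentiating the orbit.\<close>

lemma norm_funpow_diff_tangent_le:
  fixes U :: "'a::real_normed_vector \<Rightarrow>\<^sub>L 'a"
  assumes "\<And>k v. k < n \<Longrightarrow> norm ((blinfun_apply U ^^ k) v) \<le> M * norm v" and "h \<ge> 0" and "M \<ge> 0"
  shows "norm ((blinfun_apply U ^^ n) v - v - (real n * h) *\<^sub>R w)
      \<le> real n * M * norm (U v - v - h *\<^sub>R w) + (real n)\<^sup>2 * h * M * norm (U w - w)"
  using assms(1)
proof (induction n)
  case (Suc n)
  let ?P = "blinfun_apply U ^^ n"
  have l: "linear ?P" by (rule linear_funpow_blinfun)
  have "(blinfun_apply U ^^ Suc n) v - v - (real (Suc n) * h) *\<^sub>R w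
      = ?P (U v - v - h *\<^sub>R w) + h *\<^sub>R (?P w - w) + (?P v - v - (real n * h) *\<^sub>R w)"
    by (simp add: linear_diff[OF l] linear_add[OF l] linear_scale[OF l] funpow_swap1 algebra_simps)
  then have "norm ((blinfun_apply U ^^ Suc n) v - v - (real (Suc n) * h) *\<^sub>R w)
      \<le> norm (?P (U v - v - h *\<^sub>R w)) + norm (h *\<^sub>R (?P w - w)) + norm (?P v - v - (real n * h) *\<^sub>R w)"
    by (simp only: norm_triangle_add3)
  also have "\<dots> \<le> M * norm (U v - v - h *\<^sub>R w) + h * (real n * M * norm (U w - w))
      + (real n * M * norm (U v - v - h *\<^sub>R w) + (real n)\<^sup>2 * h * M * norm (U w - w))"
    using Suc.prems Suc.IH[OF Suc.prems] norm_funpow_diff_id_le[of n U M w] assms(2)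
    by (intro add_mono) (auto intro!: mult_left_mono)
  also have "\<dots> = real (Suc n) * M * norm (U v - v - h *\<^sub>R w)
      + ((real n)\<^sup>2 + real n) * (h * M * norm (U w - w))"
    by (simp add: algebra_simps)
  also have "\<dots> \<le> real (Suc n) * M * norm (U v - v - h *\<^sub>R w)
      + (real (Suc n))\<^sup>2 * (h * M * norm (U w - w))"
    using assms(2,3) by (intro add_left_mono mult_right_mono) (auto simp: power2_eq_square algebra_simps)
  finally show ?case by (simp add: mult.assoc)
qed simp

text \<open>Stability and consistency give convergence: \<open>U^n - V^n\<close> is the sum of the products
\<open>U^(n-1-k) (U - V) V^k\<close>, so only the local errors along the orbit of \<open>V\<close> enter.\<close>

lemma norm_funpow_diff_funpow_le:
  fixes U V :: "'a::real_normed_vector \<Rightarrow>\<^sub>L 'a"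
  assumes "norm U \<le> K" "K \<ge> 1"
    and "\<And>k. k < n \<Longrightarrow> norm (U ((blinfun_apply V ^^ k) f) - V ((blinfun_apply V ^^ k) f)) \<le> e"
  shows "norm ((blinfun_apply U ^^ n) f - (blinfun_apply V ^^ n) f) \<le> real n * K ^ n * e"
  using assms(3)
proof (induction n)
  case (Suc n)
  let ?u = "(blinfun_apply U ^^ n) f" and ?v = "(blinfun_apply V ^^ n) f"
  have e: "norm (U ?v - V ?v) \<le> e" using Suc.prems[of n] by simp
  then have e0: "e \<ge> 0" using norm_ge_zero order_trans by blast
  have "(blinfun_apply U ^^ Suc n) f - (blinfun_apply V ^^ Suc n) f = U (?u - ?v) + (U ?v - V ?v)"
    by (simp add: blinfun.diff_right)
  then have "norm ((blinfun_apply U ^^ Suc n) f - (blinfun_apply V ^^ Suc n) f)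
      \<le> norm (U (?u - ?v)) + norm (U ?v - V ?v)"
    by (metis norm_triangle_ineq)
  also have "\<dots> \<le> K * (real n * K ^ n * e) + e"
  proof (intro add_mono e)
    have "norm (U (?u - ?v)) \<le> norm U * norm (?u - ?v)" by (rule norm_blinfun)
    also have "\<dots> \<le> K * (real n * K ^ n * e)"
      using assms Suc by (intro mult_mono) auto
    finally show "norm (U (?u - ?v)) \<le> K * (real n * K ^ n * e)" .
  qed
  also have "\<dots> \<le> real n * K ^ Suc n * e + K ^ Suc n * e"
    using mult_right_mono[OF one_le_power[OF assms(2), of "Suc n"] e0] by (simp add: mult_ac)
  finally show ?case by (simp add: algebra_simps)
qed simp

lemma tendsto_from_dense:
  fixes B :: "'i \<Rightarrow> 'a::real_normed_vector \<Rightarrow> 'b::real_normed_vector"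
  assumes lin: "\<And>i. linear (B i)" and L: "bounded_linear L"
    and bd: "\<forall>\<^sub>F i in F. \<forall>x. norm (B i x) \<le> M * norm x"
    and D: "closure D = UNIV" and lim: "\<And>g. g \<in> D \<Longrightarrow> ((\<lambda>i. B i g) \<longlongrightarrow> L g) F"
  shows "((\<lambda>i. B i f) \<longlongrightarrow> L f) F"
proof (rule tendstoI)
  fix e :: real assume e: "e > 0"
  obtain N where N: "N > 0" "\<And>x. norm (L x) \<le> norm x * N"
    using bounded_linear.pos_bounded[OF L] by blast
  define K where "K = \<bar>M\<bar> + N + 1"
  have K: "K > 0" using N by (simp add: K_def)
  define r where "r = e / (3 * K)"
  have r: "r > 0" using e K by (simp add: r_def)
  obtain g where g: "g \<in> D" "norm (g - f) < r"
    using D r closure_approachable[of f D] by (auto simp: dist_norm)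
  have small: "\<bar>M\<bar> * r \<le> e / 3" "r * N \<le> e / 3"
  proof -
    have "r * (\<bar>M\<bar> + N + 1) = e / 3" unfolding K_def[symmetric] using K by (simp add: r_def)
    then have eq: "r * \<bar>M\<bar> + r * N + r = e / 3" by (simp add: distrib_left)
    have "r * \<bar>M\<bar> \<ge> 0" "r * N \<ge> 0" using r N by auto
    with eq r show "\<bar>M\<bar> * r \<le> e / 3" "r * N \<le> e / 3"
      unfolding mult.commute[of "\<bar>M\<bar>" r] by linarith+
  qed
  have "\<forall>\<^sub>F i in F. dist (B i g) (L g) < e / 3"
    using tendstoD[OF lim[OF g(1)], of "e/3"] e by auto
  with bd show "\<forall>\<^sub>F i in F. dist (B i f) (L f) < e"
  proof eventually_elim
    case (elim i)
    have "norm (B i f - B i g) \<le> M * norm (f - g)"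
      using elim(1) by (metis linear_diff lin)
    also have "\<dots> \<le> \<bar>M\<bar> * r" using g(2) by (intro mult_mono) (auto simp: norm_minus_commute)
    finally have 1: "norm (B i f - B i g) \<le> e / 3" using small by simp
    have "norm (L g - L f) \<le> norm (g - f) * N" using N(2) by (metis L linear_diff bounded_linear.linear)
    also have "\<dots> \<le> r * N" using g N by (intro mult_right_mono) auto
    finally have 2: "norm (L g - L f) \<le> e / 3" using small by simp
    have "B i f - L f = (B i f - B i g) + (B i g - L g) + (L g - L f)" by simp
    then have "norm (B i f - L f) \<le> norm (B i f - B i g) + norm (B i g - L g) + norm (L g - L f)"
      by (simp only: norm_triangle_add3)
    with 1 2 elim(2) show ?case by (simp add: dist_norm)
  qed
qed

lemma convergent_from_dense:
  fixes B :: "nat \<Rightarrow> 'a::real_normed_vector \<Rightarrow> 'b::banach"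
  assumes lin: "\<And>i. linear (B i)"
    and bd: "\<forall>\<^sub>F i in sequentially. \<forall>x. norm (B i x) \<le> M * norm x"
    and D: "closure D = UNIV" and conv: "\<And>g. g \<in> D \<Longrightarrow> convergent (\<lambda>i. B i g)"
  shows "convergent (\<lambda>i. B i f)"
proof -
  have "Cauchy (\<lambda>i. B i f)"
  proof (rule metric_CauchyI)
    fix e :: real assume e: "e > 0"
    define K where "K = \<bar>M\<bar> + 1"
    have K: "K > 0" by (simp add: K_def)
    define r where "r = e / (3 * K)"
    have r: "r > 0" using e K by (simp add: r_def)
    obtain g where g: "g \<in> D" "norm (g - f) < r"
      using D r closure_approachable[of f D] by (auto simp: dist_norm)
    have small: "\<bar>M\<bar> * r < e / 3"
    proof -
      have "r * (\<bar>M\<bar> + 1) = e / 3" unfolding K_def[symmetric] using K by (simp add: r_def)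
      with r show ?thesis by (simp add: algebra_simps)
    qed
    obtain n1 where n1: "\<And>i x. i \<ge> n1 \<Longrightarrow> norm (B i x) \<le> M * norm x"
      using bd by (auto simp: eventually_sequentially)
    have "Cauchy (\<lambda>i. B i g)" using conv[OF g(1)] by (simp add: Cauchy_convergent_iff)
    then obtain n2 where n2: "\<And>i j. i \<ge> n2 \<Longrightarrow> j \<ge> n2 \<Longrightarrow> dist (B i g) (B j g) < e / 3"
      using metric_CauchyD[of _ "e/3"] e by (metis divide_pos_pos zero_less_numeral)
    have *: "norm (B i f - B i g) < e / 3" if "i \<ge> n1" for i
    proof -
      have "norm (B i f - B i g) \<le> M * norm (f - g)"
        using n1[OF that, of "f - g"] by (simp add: linear_diff[OF lin])
      also have "\<dots> \<le> \<bar>M\<bar> * r" using g(2) by (intro mult_mono) (auto simp: norm_minus_commute)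
      finally show ?thesis using small by simp
    qed
    have "dist (B i f) (B j f) < e" if "i \<ge> max n1 n2" "j \<ge> max n1 n2" for i j
    proof -
      have "dist (B i f) (B i g) < e / 3" "dist (B j f) (B j g) < e / 3"
        using *[of i] *[of j] that by (simp_all add: dist_norm)
      moreover have "dist (B i g) (B j g) < e / 3" using n2 that by simp
      ultimately show ?thesis
        using dist_triangle[of "B i f" "B j f" "B i g"] dist_triangle[of "B i g" "B j f" "B j g"]
          dist_commute[of "B j g" "B j f"] by linarith
    qed
    then show "\<exists>M. \<forall>m\<ge>M. \<forall>n\<ge>M. dist (B m f) (B n f) < e" by blast
  qed
  then show ?thesis by (simp add: Cauchy_convergent_iff)
qed

section \<open>Orbits of a semigroup near time zero\<close>

text \<open>Banach-Steinhaus, by the usual Baire argument: one of the closed sets where all \<open>T i\<close> are bounded by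
\<open>n\<close> contains a ball.\<close>

theorem uniform_boundedness:
  fixes T :: "'i \<Rightarrow> 'a::banach \<Rightarrow>\<^sub>L 'b::real_normed_vector"
  assumes "\<And>x. bounded ((\<lambda>i. T i x) ` I)"
  shows "\<exists>M. \<forall>i\<in>I. norm (T i) \<le> M"
proof -
  define C where "C n = {x. \<forall>i\<in>I. norm (T i x) \<le> real n}" for n
  have closed: "closed (C n)" for n
  proof -
    have "C n = (\<Inter>i\<in>I. {x. norm (T i x) \<le> real n})" by (auto simp: C_def)
    then show ?thesis by (auto intro!: closed_INT closed_Collect_le continuous_intros)
  qed
  have cover: "(\<Union>n. C n) = UNIV"
  proof -
    have "\<exists>n. x \<in> C n" for x
    proof -
      obtain b where b: "\<And>i. i \<in> I \<Longrightarrow> norm (T i x) \<le> b"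
        using assms[of x] by (auto simp: bounded_iff)
      obtain n where "b \<le> real n" using real_arch_simple by blast
      then show ?thesis using b by (auto simp: C_def intro: order_trans)
    qed
    then show ?thesis by auto
  qed
  have "\<exists>n. interior (C n) \<noteq> {}"
  proof (rule ccontr)
    assume "\<not> ?thesis"
    then have "(euclidean :: 'a topology) interior_of (\<Union>(range C)) = {}"
      by (intro Baire_category_alt) (use closed completely_metrizable_space_euclidean in auto)
    with cover show False by (simp)
  qed
  then obtain n x r where r: "r > 0" "ball x r \<subseteq> C n"
    by (meson all_not_in_conv mem_interior)
  have "norm (T i) \<le> 4 * real n / r" if i: "i \<in> I" for i
  proof (rule norm_blinfun_bound)
    show "0 \<le> 4 * real n / r" using r by simp
    fix v
    show "norm (T i v) \<le> 4 * real n / r * norm v"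
    proof (cases "v = 0")
      case False
      define z where "z = (r / (2 * norm v)) *\<^sub>R v"
      have "norm z < r" using r False by (simp add: z_def)
      then have "x + z \<in> C n" "x \<in> C n" using r by (auto simp: dist_norm subset_iff)
      then have "norm (T i (x + z)) \<le> n" "norm (T i x) \<le> n" using i by (auto simp: C_def)
      moreover have "T i z = T i (x + z) - T i x" by (simp add: blinfun.add_right)
      ultimately have "norm (T i z) \<le> 2 * real n" by (smt (verit) norm_triangle_ineq4)
      moreover have "norm (T i z) = r / (2 * norm v) * norm (T i v)"
        using r by (simp add: z_def blinfun.scaleR_right)
      ultimately show ?thesis using r False by (simp add: field_simps)
    qed (simp add: blinfun.zero_right)
  qed
  then show ?thesis by blast
qed

text \<open>Strong continuity bounds each orbit on a compact time interval; the uniform boundedness principle makes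
the bound independent of the orbit.\<close>

lemma C0_semigroup_locally_bounded:
  assumes "C0_semigroup T" obtains M where "M \<ge> 1" "\<And>r. 0 \<le> r \<Longrightarrow> r \<le> s \<Longrightarrow> norm (T r) \<le> M"
proof -
  have "bounded ((\<lambda>t. T t f) ` {0..s})" for f
  proof (intro compact_imp_bounded compact_continuous_image)
    show "continuous_on {0..s} (\<lambda>t. T t f)"
      using assms by (auto simp: C0_semigroup_def intro: continuous_on_subset[of "{0..}"])
  qed simp
  then obtain M where M: "\<forall>t\<in>{0..s}. norm (T t) \<le> M"
    using uniform_boundedness[of T "{0..s}"] by blast
  show ?thesis by (rule that[of "max M 1"]) (use M in \<open>auto simp: le_max_iff_disj\<close>)
qed

lemma C0_semigroup_funpow:
  assumes "C0_semigroup T" "h \<ge> 0"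
  shows "(blinfun_apply (T h) ^^ k) v = T (real k * h) v"
proof (induction k)
  case 0
  then show ?case using assms by (simp add: C0_semigroup_def)
next
  case (Suc k)
  have "T (real (Suc k) * h) = T h o\<^sub>L T (real k * h)"
    using assms unfolding C0_semigroup_def by (simp add: algebra_simps)
  with Suc show ?case by simp
qed

lemma generator_orbit:
  assumes T: "C0_semigroup T" and vw: "(v, w) \<in> generator T" and s: "s \<ge> 0"
  shows "(T s v, T s w) \<in> generator T"
proof -
  have lim: "((\<lambda>h. T s ((T h v - v) /\<^sub>R h)) \<longlongrightarrow> T s w) (at_right 0)"
    using vw by (intro bounded_linear.tendsto[OF blinfun.bounded_linear_right]) (simp add: generator_def)
  have "\<forall>\<^sub>F h::real in at_right 0. h > 0" by (simp add: eventually_at_right_less)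
  then have ev: "\<forall>\<^sub>F h in at_right 0. T s ((T h v - v) /\<^sub>R h) = (T h (T s v) - T s v) /\<^sub>R h"
  proof eventually_elim
    case (elim h)
    have "T (s + h) = T s o\<^sub>L T h" "T (h + s) = T h o\<^sub>L T s"
      using T s elim by (auto simp: C0_semigroup_def)
    then have "T s (T h v) = T h (T s v)" by (metis add.commute blinfun_apply_blinfun_compose)
    then show ?case by (simp add: blinfun.scaleR_right blinfun.diff_right)
  qed
  have "((\<lambda>h. (T h (T s v) - T s v) /\<^sub>R h) \<longlongrightarrow> T s w) (at_right 0)"
    by (rule Lim_transform_eventually[OF lim ev])
  then show ?thesis by (simp add: generator_def)
qed

lemma filterlim_divide_nat_at_right:
  assumes "s > 0" shows "filterlim (\<lambda>n. s / real n) (at_right 0) sequentially"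
  unfolding filterlim_at
proof
  show "\<forall>\<^sub>F n in sequentially. s / real n \<in> {0<..} \<and> s / real n \<noteq> 0"
    using eventually_gt_at_top[of 0] by eventually_elim (use assms in auto)
  show "(\<lambda>n. s / real n) \<longlonglongrightarrow> 0" by real_asymp
qed

text \<open>Since \<open>T s\<close> is the \<open>n\<close>-th power of \<open>T (s/n)\<close>, the discrete estimate applies with step \<open>s/n\<close>. As \<open>n\<close> grows,
the difference quotients in it converge to the values of the generator, which leaves
\<open>s\<^sup>2 M \<parallel>z\<parallel>\<close>.\<close>

lemma norm_orbit_tangent_le:
  assumes T: "C0_semigroup T" and bd: "\<And>r. 0 \<le> r \<Longrightarrow> r \<le> s \<Longrightarrow> norm (T r) \<le> M"
    and vw: "(v, w) \<in> generator T" and wz: "(w, z) \<in> generator T" and s: "s \<ge> 0"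
  shows "norm (T s v - v - s *\<^sub>R w) \<le> s\<^sup>2 * M * norm z"
proof -
  have M0: "M \<ge> 0" using bd[of 0] s norm_ge_zero order_trans by blast
  have pw: "norm ((blinfun_apply (T (s / real n)) ^^ k) x) \<le> M * norm x" if "k < n" for n k x
  proof -
    have "norm (T (real k * (s / real n))) \<le> M"
    proof (rule bd)
      show "real k * (s / real n) \<le> s" using that s by (simp add: field_simps mult_mono)
    qed (use s in simp)
    then show ?thesis using s
      by (simp add: C0_semigroup_funpow[OF T]) (meson mult_right_mono norm_blinfun norm_ge_zero order_trans)
  qed
  have full: "(blinfun_apply (T (s / real n)) ^^ n) x = T s x" if "n > 0" for n x
    using that s by (simp add: C0_semigroup_funpow[OF T])
  have q: "(\<lambda>n. (T (s / real n) x - x) /\<^sub>R (s / real n)) \<longlonglongrightarrow> y"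
    if "(x, y) \<in> generator T" "s > 0" for x y
    by (rule filterlim_compose[OF _ filterlim_divide_nat_at_right[OF that(2)]])
      (use that(1) in \<open>simp add: generator_def\<close>)
  show ?thesis
  proof (cases "s = 0")
    case False
    with s have s: "s > 0" by simp
    let ?q = "\<lambda>n x. (T (s / real n) x - x) /\<^sub>R (s / real n)"
    show ?thesis
    proof (rule tendsto_lowerbound)
      have "(\<lambda>n. s * M * norm (?q n v - w) + s\<^sup>2 * M * norm (?q n w))
          \<longlonglongrightarrow> s * M * norm (w - w) + s\<^sup>2 * M * norm z"
        by (intro tendsto_intros q vw wz s)
      then show "(\<lambda>n. s * M * norm (?q n v - w) + s\<^sup>2 * M * norm (?q n w)) \<longlonglongrightarrow> s\<^sup>2 * M * norm z"
        by simp
      show "\<forall>\<^sub>F n in sequentially. norm (T s v - v - s *\<^sub>R w)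
          \<le> s * M * norm (?q n v - w) + s\<^sup>2 * M * norm (?q n w)"
        using eventually_gt_at_top[of 0]
      proof eventually_elim
        case (elim n)
        define h where "h = s / real n"
        have h: "h > 0" "real n * h = s" "s / real n = h" using elim s by (auto simp: h_def)
        have "norm (T s v - v - s *\<^sub>R w) \<le> real n * M * norm (T h v - v - h *\<^sub>R w)
            + (real n)\<^sup>2 * h * M * norm (T h w - w)"
          using norm_funpow_diff_tangent_le[of n "T h" M h v w] pw[of _ n] full[OF elim] h M0 by simp
        also have "T h v - v - h *\<^sub>R w = h *\<^sub>R (?q n v - w)"
          using h by (simp add: scaleR_right_diff_distrib)
        also have "T h w - w = h *\<^sub>R ?q n w" using h by simp
        also have "real n * M * norm (h *\<^sub>R (?q n v - w)) + (real n)\<^sup>2 * h * M * norm (h *\<^sub>R ?q n w)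
            = (real n * h) * M * norm (?q n v - w) + (real n * h)\<^sup>2 * M * norm (?q n w)"
          using h(1) by (simp only: norm_scaleR) (simp add: power2_eq_square)
        finally show ?case by (simp only: h(2))
      qed
    qed simp
  qed (use T in \<open>simp add: C0_semigroup_def\<close>)
qed

section \<open>Generation of semigroups by the implicit Euler scheme\<close>

text \<open>These are the assumptions of the Hille-Yosida theorem in the form in which elliptic operators satisfy them:
the implicit Euler equation is solvable for all small steps, with a lower bound from dissipativity. The
restriction \<open>w * h0 \<le> 1/2\<close> guarantees \<open>1 / (1 - w h) \<le> exp (2 w h)\<close>.\<close>

locale quasi_m_dissipative =
  fixes A :: "('a::banach \<times> 'a) set" and w h0 :: real
  assumes lin: "linear_operator A" and dense: "closure (Domain A) = UNIV"
    and w0: "w \<ge> 0" and h0: "h0 > 0" and wh0: "w * h0 \<le> 1/2"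
    and surj: "\<And>h g. 0 < h \<Longrightarrow> h \<le> h0 \<Longrightarrow> \<exists>u v. (u, v) \<in> A \<and> u - h *\<^sub>R v = g"
    and dissip: "\<And>h u v. 0 < h \<Longrightarrow> h \<le> h0 \<Longrightarrow> (u, v) \<in> A
      \<Longrightarrow> (1 - w * h) * norm u \<le> norm (u - h *\<^sub>R v)"
begin

lemma A_add: "(u, v) \<in> A \<Longrightarrow> (u', v') \<in> A \<Longrightarrow> (u + u', v + v') \<in> A"
  using subspace_add[of A "(u, v)" "(u', v')"] lin by (simp add: linear_operator_def)

lemma A_scale: "(u, v) \<in> A \<Longrightarrow> (c *\<^sub>R u, c *\<^sub>R v) \<in> A"
  using subspace_scale[of A "(u, v)" c] lin by (simp add: linear_operator_def)

lemma A_diff: "(u, v) \<in> A \<Longrightarrow> (u', v') \<in> A \<Longrightarrow> (u - u', v - v') \<in> A"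
  using subspace_diff[of A "(u, v)" "(u', v')"] lin by (simp add: linear_operator_def)

text \<open>\<open>J h\<close> is the resolvent \<open>(1 - h A)\<^sup>-\<^sup>1\<close>, that is, one implicit Euler step; taking the identity for
\<open>h = 0\<close> makes the expansions below valid for \<open>h \<ge> 0\<close>.\<close>

definition J :: "real \<Rightarrow> 'a \<Rightarrow>\<^sub>L 'a" where
  "J h = (if h = 0 then id_blinfun
    else Blinfun (\<lambda>g. SOME u. \<exists>v. (u, v) \<in> A \<and> u - h *\<^sub>R v = g))"

lemma wh_le: "0 \<le> h \<Longrightarrow> h \<le> h0 \<Longrightarrow> w * h \<le> 1/2"
  using wh0 w0 by (meson mult_left_mono order_trans)

lemma resolvent_norm_le:
  assumes "0 < h" "h \<le> h0" "(u, v) \<in> A"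
  shows "norm u \<le> exp (2 * w * h) * norm (u - h *\<^sub>R v)"
proof -
  let ?x = "w * h"
  have x: "0 \<le> ?x" "?x \<le> 1/2" using w0 wh_le assms by auto
  have "?x * ?x \<le> ?x * (1/2)" using x by (intro mult_left_mono) auto
  then have "1 \<le> (1 + 2 * ?x) * (1 - ?x)" by (simp add: algebra_simps)
  also have "\<dots> \<le> exp (2 * ?x) * (1 - ?x)"
    using x by (intro mult_right_mono exp_ge_add_one_self) auto
  finally have "1 \<le> exp (2 * w * h) * (1 - ?x)" by (simp add: mult.assoc)
  then have "norm u \<le> exp (2 * w * h) * (1 - ?x) * norm u"
    by (metis mult_1 mult_right_mono norm_ge_zero)
  also have "\<dots> \<le> exp (2 * w * h) * norm (u - h *\<^sub>R v)"
    using dissip[OF assms] by (simp add: mult.assoc)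
  finally show ?thesis .
qed

lemma resolvent_inj:
  assumes "0 < h" "h \<le> h0" "(u, v) \<in> A" "(u', v') \<in> A" "u - h *\<^sub>R v = u' - h *\<^sub>R v'"
  shows "u = u'"
proof -
  have "(u - u') - h *\<^sub>R (v - v') = 0" using assms(5) by (simp add: algebra_simps)
  then have "norm (u - u') \<le> exp (2 * w * h) * norm (0 :: 'a)"
    using resolvent_norm_le[OF assms(1,2) A_diff[OF assms(3,4)]] by metis
  then show ?thesis by simp
qed

lemma J_mem:
  assumes h: "0 < h" "h \<le> h0"
  shows "(J h g, (J h g - g) /\<^sub>R h) \<in> A"
proof -
  define R where "R g = (SOME u. \<exists>v. (u, v) \<in> A \<and> u - h *\<^sub>R v = g)" for g
  have R: "\<exists>v. (R g, v) \<in> A \<and> R g - h *\<^sub>R v = g" for g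
    unfolding R_def by (rule someI_ex) (rule surj[OF h])
  have Req: "R g = u" if "(u, v) \<in> A" "u - h *\<^sub>R v = g" for u v g
    using R[of g] resolvent_inj[OF h _ that(1)] that(2) by blast
  have "bounded_linear R"
  proof (rule bounded_linear_intro)
    fix x y
    obtain v v' where v: "(R x, v) \<in> A" "R x - h *\<^sub>R v = x" "(R y, v') \<in> A" "R y - h *\<^sub>R v' = y"
      using R by metis
    have "(R x + R y) - h *\<^sub>R (v + v') = (R x - h *\<^sub>R v) + (R y - h *\<^sub>R v')"
      by (simp add: scaleR_add_right)
    then have "(R x + R y) - h *\<^sub>R (v + v') = x + y" by (simp only: v(2,4))
    then show "R (x + y) = R x + R y" by (rule Req[OF A_add[OF v(1,3)]])
  next
    fix r x
    obtain v where v: "(R x, v) \<in> A" "R x - h *\<^sub>R v = x" using R by metis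
    have "r *\<^sub>R R x - h *\<^sub>R (r *\<^sub>R v) = r *\<^sub>R (R x - h *\<^sub>R v)"
      by (simp add: scaleR_diff_right scaleR_left_commute)
    then have "r *\<^sub>R R x - h *\<^sub>R (r *\<^sub>R v) = r *\<^sub>R x" by (simp only: v(2))
    then show "R (r *\<^sub>R x) = r *\<^sub>R R x" by (rule Req[OF A_scale[OF v(1)]])
  next
    fix x
    obtain v where v: "(R x, v) \<in> A" "R x - h *\<^sub>R v = x" using R by metis
    show "norm (R x) \<le> norm x * exp (2 * w * h)"
      using resolvent_norm_le[OF h v(1)] unfolding v(2) by (simp add: mult.commute)
  qed
  then have J: "J h g = R g"
    using h by (simp add: J_def R_def[symmetric] bounded_linear_Blinfun_apply)
  obtain v where v: "(R g, v) \<in> A" "R g - h *\<^sub>R v = g" using R by blast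
  have "h *\<^sub>R v = R g - g" using v(2) by (simp add: algebra_simps)
  then have "(R g - g) /\<^sub>R h = (h *\<^sub>R v) /\<^sub>R h" by simp
  also have "\<dots> = v" using h by simp
  finally show ?thesis using v(1) by (simp only: J)
qed

lemma J_diff_scaleR:
  assumes "0 \<le> h" "h \<le> h0" "(u, v) \<in> A" shows "J h (u - h *\<^sub>R v) = u"
proof (cases "h = 0")
  case False
  with assms have h: "0 < h" by simp
  show ?thesis
    by (rule resolvent_inj[OF h assms(2) J_mem[OF h assms(2)] assms(3)]) (use h in simp)
qed (simp add: J_def)

lemma norm_J:
  assumes "0 \<le> h" "h \<le> h0" shows "norm (J h) \<le> exp (2 * w * h)"
proof (cases "h = 0")
  case False
  with assms have h: "0 < h" by simp
  show ?thesis
    using resolvent_norm_le[OF h assms(2) J_mem[OF h assms(2)]] h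
    by (intro norm_blinfun_bound) auto
qed (simp add: J_def norm_blinfun_id_le)

lemma J_A:
  assumes h: "0 \<le> h" "h \<le> h0" and uv: "(u, v) \<in> A"
  shows "(J h u, J h v) \<in> A" and "J h u = u + h *\<^sub>R J h v"
proof -
  show *: "J h u = u + h *\<^sub>R J h v"
    using J_diff_scaleR[OF h uv] by (simp add: blinfun.diff_right blinfun.scaleR_right algebra_simps)
  show "(J h u, J h v) \<in> A"
  proof (cases "h = 0")
    case False
    with h have h': "0 < h" by simp
    show ?thesis using J_mem[OF h' h(2), of u] * h' by simp
  qed (use uv in \<open>simp add: J_def\<close>)
qed

lemma J_commute:
  assumes h: "0 \<le> h" "h \<le> h0" and k: "0 \<le> k" "k \<le> h0"
  shows "J h (J k g) = J k (J h g)"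
proof (cases "k = 0")
  case False
  with k have k': "0 < k" by simp
  define x y where "x = J k g" and "y = (J k g - g) /\<^sub>R k"
  have xy: "(x, y) \<in> A" unfolding x_def y_def by (rule J_mem[OF k' k(2)])
  have g: "x - k *\<^sub>R y = g" using k' by (simp add: x_def y_def)
  have "J k (J h x - k *\<^sub>R J h y) = J h x" by (rule J_diff_scaleR[OF k J_A(1)[OF h xy]])
  moreover have "J h x - k *\<^sub>R J h y = J h g"
    by (simp add: g[symmetric] blinfun.diff_right blinfun.scaleR_right)
  ultimately show ?thesis by (simp add: x_def)
qed (simp add: J_def)

lemma J_pow_A:
  assumes h: "0 \<le> h" "h \<le> h0" and uv: "(u, v) \<in> A"
  shows "((blinfun_apply (J h) ^^ n) u, (blinfun_apply (J h) ^^ n) v) \<in> A"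
  by (induction n) (use J_A(1)[OF h] uv in auto)

lemma norm_J_pow:
  assumes "0 \<le> h" "h \<le> h0"
  shows "norm ((blinfun_apply (J h) ^^ n) v) \<le> exp (2 * w * (real n * h)) * norm v"
  using norm_funpow_le[OF norm_J[OF assms], of n v]
  by (simp add: exp_of_nat_mult[symmetric] mult_ac)

lemma norm_J_apply: "0 \<le> h \<Longrightarrow> h \<le> h0 \<Longrightarrow> norm (J h v) \<le> exp (2 * w * h) * norm v"
  using norm_J_pow[of h 1 v] by simp

lemma J_pow_mono:
  assumes "0 \<le> h" "h \<le> h0" "real n * h \<le> s"
  shows "norm ((blinfun_apply (J h) ^^ n) v) \<le> exp (2 * w * s) * norm v"
proof -
  have "w * (real n * h) \<le> w * s" using w0 assms(3) by (rule mult_left_mono[rotated])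
  then have "exp (2 * w * (real n * h)) * norm v \<le> exp (2 * w * s) * norm v"
    by (intro mult_right_mono) auto
  then show ?thesis using norm_J_pow[OF assms(1,2), of n v] by (rule order_trans[rotated])
qed

text \<open>On the domain of \<open>A\<^sup>2\<close> one has \<open>J h f = f + h A f + h\<^sup>2 J h (A\<^sup>2 f)\<close>, so \<open>J h (J k f)\<close> and
\<open>J (h + k) f\<close> agree up to second order.\<close>

lemma J_compose_near:
  assumes h: "0 \<le> h" and k: "0 \<le> k" and hk: "h + k \<le> h0"
    and f: "(f, f1) \<in> A" "(f1, f2) \<in> A"
  shows "norm (J h (J k f) - J (h + k) f) \<le> 2 * (h + k)\<^sup>2 * exp (2 * w * (h + k)) * norm f2"
proof -
  have h': "h \<le> h0" and k': "k \<le> h0" and hk': "0 \<le> h + k" using assms by auto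
  have ex: "J r f = f + r *\<^sub>R f1 + r\<^sup>2 *\<^sub>R J r f2" if "0 \<le> r" "r \<le> h0" for r
    using J_A(2)[OF that f(1)] J_A(2)[OF that f(2)]
    by (simp add: scaleR_add_right power2_eq_square)
  have "J h (J k f) = J h f + k *\<^sub>R J h f1 + k\<^sup>2 *\<^sub>R J h (J k f2)"
    by (simp add: ex[OF k k'] blinfun.add_right blinfun.scaleR_right)
  also have "\<dots> = f + (h + k) *\<^sub>R f1 + (h\<^sup>2 *\<^sub>R J h f2 + (k * h) *\<^sub>R J h f2 + k\<^sup>2 *\<^sub>R J h (J k f2))"
    by (simp add: ex[OF h h'] J_A(2)[OF h h' f(2)] algebra_simps)
  finally have "J h (J k f) - J (h + k) f
      = (h\<^sup>2 *\<^sub>R J h f2 + (k * h) *\<^sub>R J h f2 + k\<^sup>2 *\<^sub>R J h (J k f2)) - (h + k)\<^sup>2 *\<^sub>R J (h + k) f2"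
    by (simp add: ex[OF hk' hk])
  then have "norm (J h (J k f) - J (h + k) f)
      \<le> norm (h\<^sup>2 *\<^sub>R J h f2) + norm ((k * h) *\<^sub>R J h f2) + norm (k\<^sup>2 *\<^sub>R J h (J k f2))
        + norm ((h + k)\<^sup>2 *\<^sub>R J (h + k) f2)"
    by (simp only: order_trans[OF norm_triangle_ineq4 add_right_mono[OF norm_triangle_add3]])
  also have "\<dots> = h\<^sup>2 * norm (J h f2) + (k * h) * norm (J h f2) + k\<^sup>2 * norm (J h (J k f2))
        + (h + k)\<^sup>2 * norm (J (h + k) f2)"
    using h k by simp
  also have "\<dots> \<le> (h\<^sup>2 + k * h + k\<^sup>2 + (h + k)\<^sup>2) * (exp (2 * w * (h + k)) * norm f2)"
  proof -
    let ?e = "exp (2 * w * (h + k)) * norm f2"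
    have "2 * w * h \<le> 2 * w * (h + k)" using w0 k by (intro mult_left_mono) auto
    then have "exp (2 * w * h) * norm f2 \<le> ?e" by (intro mult_right_mono) auto
    then have 1: "norm (J h f2) \<le> ?e" using norm_J_apply[OF h h', of f2] by linarith
    have "norm (J h (J k f2)) \<le> exp (2 * w * h) * norm (J k f2)" by (rule norm_J_apply[OF h h'])
    also have "\<dots> \<le> exp (2 * w * h) * (exp (2 * w * k) * norm f2)"
      using norm_J_apply[OF k k', of f2] by (intro mult_left_mono) auto
    finally have 2: "norm (J h (J k f2)) \<le> ?e" by (simp add: distrib_left exp_add mult.assoc)
    have 3: "norm (J (h + k) f2) \<le> ?e" by (rule norm_J_apply[OF hk' hk])
    show ?thesis using mult_left_mono[OF 1, of "h\<^sup>2"] mult_left_mono[OF 1, of "k * h"]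
        mult_left_mono[OF 2, of "k\<^sup>2"] mult_left_mono[OF 3, of "(h + k)\<^sup>2"] h k
      by (simp add: distrib_right)
  qed
  also have "\<dots> \<le> (2 * (h + k)\<^sup>2) * (exp (2 * w * (h + k)) * norm f2)"
    using h k by (intro mult_right_mono) (auto simp: power2_eq_square algebra_simps)
  finally show ?thesis by (simp add: mult.assoc)
qed

lemma J_pow_commute:
  assumes h: "0 \<le> h" "h \<le> h0" and k: "0 \<le> k" "k \<le> h0"
  shows "(blinfun_apply (J h o\<^sub>L J k) ^^ n) g = (blinfun_apply (J h) ^^ n) ((blinfun_apply (J k) ^^ n) g)"
proof (induction n)
  case (Suc n)
  have c: "J k ((blinfun_apply (J h) ^^ n) x) = (blinfun_apply (J h) ^^ n) (J k x)" for x n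
    by (induction n) (simp_all add: J_commute[OF k h])
  let ?g = "(blinfun_apply (J h o\<^sub>L J k) ^^ n) g"
  have "(blinfun_apply (J h o\<^sub>L J k) ^^ Suc n) g = J h (J k ?g)" by simp
  then show ?case unfolding Suc by (simp add: c del: blinfun_apply_blinfun_compose)
qed simp

text \<open>For \<open>s = t\<close> this compares the Euler scheme with the one in which every step is halved, which makes the
scheme a Cauchy sequence; for general \<open>s\<close> and \<open>t\<close> it is the semigroup law of the limit.\<close>

lemma J_pow_split:
  assumes s: "0 \<le> s" and t: "0 \<le> t" and n: "n > 0" "(s + t) / real n \<le> h0"
    and f: "(f, f1) \<in> A" "(f1, f2) \<in> A"
  shows "norm ((blinfun_apply (J (s / real n)) ^^ n) ((blinfun_apply (J (t / real n)) ^^ n) f)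
        - (blinfun_apply (J ((s + t) / real n)) ^^ n) f)
      \<le> 2 * (s + t)\<^sup>2 * exp (6 * w * (s + t)) * norm f2 / real n"
proof -
  define h k where "h = s / real n" and "k = t / real n"
  have hk: "0 \<le> h" "0 \<le> k" "h + k \<le> h0" "(s + t) / real n = h + k" "h \<le> h0" "k \<le> h0"
    using s t n by (auto simp: h_def k_def add_divide_distrib intro: order_trans[rotated])
  have nhk: "real n * (h + k) = s + t" using n by (simp add: h_def k_def algebra_simps)
  define E where "E = exp (2 * w * (s + t))"
  have le: "exp (2 * w * (h + k)) \<le> E"
  proof -
    have "h + k \<le> s + t" using nhk hk n
      by (metis add_nonneg_nonneg mult_1 mult_right_mono of_nat_1 of_nat_le_iff Suc_leI One_nat_def)
    then show ?thesis unfolding E_def using w0 by (simp add: mult_left_mono)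
  qed
  have "norm ((blinfun_apply (J h o\<^sub>L J k) ^^ n) f - (blinfun_apply (J (h + k)) ^^ n) f)
      \<le> real n * exp (2 * w * (h + k)) ^ n * (2 * (h + k)\<^sup>2 * E * (E * norm f2))"
  proof (rule norm_funpow_diff_funpow_le)
    have "norm (J h o\<^sub>L J k) \<le> norm (J h) * norm (J k)" by (rule norm_blinfun_compose)
    also have "\<dots> \<le> exp (2 * w * h) * exp (2 * w * k)"
      by (intro mult_mono norm_J) (use hk in auto)
    finally show "norm (J h o\<^sub>L J k) \<le> exp (2 * w * (h + k))" by (simp add: distrib_left exp_add)
    show "1 \<le> exp (2 * w * (h + k))" using w0 hk by simp
    fix m assume m: "m < n"
    let ?P = "blinfun_apply (J (h + k)) ^^ m"
    have pw: "(?P f, ?P f1) \<in> A" "(?P f1, ?P f2) \<in> A"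
      using J_pow_A[of "h + k" _ _ m] hk f by auto
    have mhk: "real m * (h + k) \<le> s + t"
      using nhk m hk by (smt (verit) mult_right_mono of_nat_less_iff)
    have "norm ((J h o\<^sub>L J k) (?P f) - J (h + k) (?P f))
        \<le> 2 * (h + k)\<^sup>2 * exp (2 * w * (h + k)) * norm (?P f2)"
      using J_compose_near[OF hk(1-3) pw] by simp
    also have "\<dots> \<le> 2 * (h + k)\<^sup>2 * E * (E * norm f2)"
      using J_pow_mono[of "h + k" m "s + t" f2] hk mhk le
      by (intro mult_mono) (auto simp: E_def)
    finally show "norm ((J h o\<^sub>L J k) (?P f) - J (h + k) (?P f)) \<le> 2 * (h + k)\<^sup>2 * E * (E * norm f2)" .
  qed
  also have "exp (2 * w * (h + k)) ^ n = E"
  proof -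
    have "real n * (2 * w * (h + k)) = 2 * w * (real n * (h + k))" by (simp add: mult_ac)
    then show ?thesis using nhk by (simp add: E_def exp_of_nat_mult[symmetric])
  qed
  also have "real n * E * (2 * (h + k)\<^sup>2 * E * (E * norm f2))
      = 2 * (real n * (h + k))\<^sup>2 * (E * E * E) * norm f2 / real n"
    using n by (simp add: power2_eq_square field_simps)
  also have "E * E * E = exp (6 * w * (s + t))" by (simp add: E_def exp_add[symmetric])
  finally show ?thesis
    by (simp only: J_pow_commute[OF hk(1,5) hk(2,6)] hk(4) nhk h_def[symmetric] k_def[symmetric])
qed

end

lemma norm_divideR_le:
  fixes x :: "'a::real_normed_vector"
  assumes "0 < t" "norm x \<le> t * y" shows "norm (x /\<^sub>R t) \<le> y"
  using assms by (simp add: field_simps)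

context quasi_m_dissipative
begin

lemma J_tendsto: "((\<lambda>h. J h f) \<longlongrightarrow> f) (at_right 0)"
proof -
  have ev: "\<forall>\<^sub>F h in at_right 0. 0 < h \<and> h \<le> h0"
    using h0 by (auto simp: eventually_at_right_field intro!: exI[of _ h0])
  show ?thesis
  proof (rule tendsto_from_dense[of "\<lambda>h. blinfun_apply (J h)" "\<lambda>x. x"])
    show "\<forall>\<^sub>F h in at_right 0. \<forall>x. norm (J h x) \<le> exp (2 * w * h0) * norm x"
      using ev
    proof eventually_elim
      case (elim h)
      then show ?case using J_pow_mono[of h 1 h0] by simp
    qed
    show "closure (Domain A) = UNIV" by (rule dense)
    fix g assume "g \<in> Domain A"
    then obtain g1 where g: "(g, g1) \<in> A" by blast
    show "((\<lambda>h. J h g) \<longlongrightarrow> g) (at_right 0)"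
    proof (rule LIM_zero_cancel, rule Lim_null_comparison)
      show "\<forall>\<^sub>F h in at_right 0. norm (J h g - g) \<le> h * (exp (2 * w * h0) * norm g1)"
        using ev
      proof eventually_elim
        case (elim h)
        have "norm (J h g - g) = h * norm (J h g1)" using J_A(2)[OF _ _ g, of h] elim by simp
        also have "\<dots> \<le> h * (exp (2 * w * h0) * norm g1)"
          using elim J_pow_mono[of h 1 h0] by (intro mult_left_mono) auto
        finally show ?case using elim by simp
      qed
      show "((\<lambda>h. h * (exp (2 * w * h0) * norm g1)) \<longlongrightarrow> 0) (at_right 0)"
        by (auto intro!: tendsto_eq_intros)
    qed
  qed (auto intro: bounded_linear.linear blinfun.bounded_linear_right bounded_linear_ident)
qed

definition D2 :: "'a set" where "D2 = {f. \<exists>f1 f2. (f, f1) \<in> A \<and> (f1, f2) \<in> A}"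

lemma J_J_D2: assumes "0 < h" "h \<le> h0" shows "J h (J h f) \<in> D2"
proof -
  let ?x = "J h f" and ?y = "(J h f - f) /\<^sub>R h"
  have "(?x, ?y) \<in> A" by (rule J_mem[OF assms])
  then have "(J h ?x, J h ?y) \<in> A" by (rule J_A(1)[rotated 2]) (use assms in auto)
  with J_mem[OF assms, of ?y] show ?thesis by (auto simp: D2_def)
qed

text \<open>Since \<open>J h\<close> converges strongly to the identity, so does its square, which maps into \<open>D2\<close>.\<close>

lemma D2_dense: "closure D2 = UNIV"
proof -
  have "f \<in> closure D2" for f
    unfolding closure_approachable
  proof (intro allI impI)
    fix e :: real assume e: "e > 0"
    have "((\<lambda>h. J h (J h f)) \<longlongrightarrow> f) (at_right 0)"
    proof (rule LIM_zero_cancel, rule Lim_null_comparison)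
      have ev: "\<forall>\<^sub>F h in at_right 0. 0 < h \<and> h \<le> h0"
        using h0 by (auto simp: eventually_at_right_field intro!: exI[of _ h0])
      then show "\<forall>\<^sub>F h in at_right 0. norm (J h (J h f) - f) \<le> (exp (2 * w * h0) + 1) * norm (J h f - f)"
      proof eventually_elim
        case (elim h)
        have "norm (J h (J h f) - f) \<le> norm (J h (J h f) - J h f) + norm (J h f - f)"
          using norm_triangle_ineq[of "J h (J h f) - J h f" "J h f - f"] by simp
        then show ?case using J_pow_mono[of h 1 h0 "J h f - f"] elim
          by (simp add: blinfun.diff_right algebra_simps)
      qed
      have "((\<lambda>h. (exp (2 * w * h0) + 1) * norm (J h f - f)) \<longlongrightarrow>
          (exp (2 * w * h0) + 1) * norm (f - f)) (at_right 0)"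
        by (intro tendsto_intros J_tendsto)
      then show "((\<lambda>h. (exp (2 * w * h0) + 1) * norm (J h f - f)) \<longlongrightarrow> 0) (at_right 0)"
        by simp
    qed
    then have "\<forall>\<^sub>F h in at_right 0. dist (J h (J h f)) f < e" using e by (rule tendstoD)
    moreover have "\<forall>\<^sub>F h in at_right 0. 0 < h \<and> h \<le> h0"
      using h0 by (auto simp: eventually_at_right_field intro!: exI[of _ h0])
    ultimately have "\<forall>\<^sub>F h in at_right 0. dist (J h (J h f)) f < e \<and> 0 < h \<and> h \<le> h0"
      by (rule eventually_conj)
    then obtain h where "dist (J h (J h f)) f < e" "0 < h" "h \<le> h0"
      using eventually_happens'[OF trivial_limit_at_right_real] by blast
    then show "\<exists>y\<in>D2. dist y f < e" using J_J_D2 by blast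
  qed
  then show ?thesis by auto
qed

text \<open>The step sizes are halved from one \<open>n\<close> to the next, so that consecutive approximations differ by a
summable amount \<open>O(2^(-n))\<close> on \<open>D2\<close>.\<close>

definition euler :: "nat \<Rightarrow> real \<Rightarrow> 'a \<Rightarrow> 'a" where
  "euler n t = (blinfun_apply (J (t / 2 ^ n)) ^^ (2 ^ n))"

definition euler_limit :: "real \<Rightarrow> 'a \<Rightarrow>\<^sub>L 'a" where
  "euler_limit t = Blinfun (\<lambda>f. lim (\<lambda>n. euler n t f))"

lemma eventually_step_small: "\<forall>\<^sub>F n in sequentially. t / 2 ^ n \<le> h0"
proof -
  have "(\<lambda>n. t / 2 ^ n) \<longlonglongrightarrow> 0" by real_asymp
  then have "\<forall>\<^sub>F n in sequentially. t / 2 ^ n < h0" using h0 by (rule order_tendstoD)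
  then show ?thesis by (rule eventually_mono) auto
qed

lemma linear_euler: "linear (euler n t)"
  unfolding euler_def by (rule linear_funpow_blinfun)

lemma norm_euler:
  assumes "t \<ge> 0" "t / 2 ^ n \<le> h0" shows "norm (euler n t f) \<le> exp (2 * w * t) * norm f"
  using norm_J_pow[of "t / 2 ^ n" "2 ^ n" f] assms by (simp add: euler_def)

lemma euler_converges:
  assumes t: "t \<ge> 0" shows "(\<lambda>n. euler n t f) \<longlonglongrightarrow> lim (\<lambda>n. euler n t f)"
proof -
  have "convergent (\<lambda>n. euler n t f)"
  proof (rule convergent_from_dense[OF linear_euler _ D2_dense])
    show "\<forall>\<^sub>F n in sequentially. \<forall>x. norm (euler n t x) \<le> exp (2 * w * t) * norm x"
      using eventually_step_small[of t] by eventually_elim (use t norm_euler in blast)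
    fix g assume "g \<in> D2"
    then obtain g1 g2 where g: "(g, g1) \<in> A" "(g1, g2) \<in> A" by (auto simp: D2_def)
    define C where "C = 2 * t\<^sup>2 * exp (6 * w * t) * norm g2"
    have step: "\<forall>\<^sub>F n in sequentially. norm (euler (Suc n) t g - euler n t g) \<le> C * (1 / 2) ^ n"
      using eventually_step_small[of t]
    proof eventually_elim
      case (elim n)
      have s: "euler (Suc n) t g
          = (blinfun_apply (J (t / 2 / real (2 ^ n))) ^^ (2 ^ n))
              ((blinfun_apply (J (t / 2 / real (2 ^ n))) ^^ (2 ^ n)) g)"
      proof -
        have "(2::nat) ^ Suc n = 2 ^ n + 2 ^ n" "t / 2 ^ Suc n = t / 2 / real (2 ^ n)" by simp_all
        then show ?thesis unfolding euler_def by (simp only: funpow_add comp_apply)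
      qed
      have "norm (euler (Suc n) t g - euler n t g) \<le> C / real (2 ^ n)"
        using J_pow_split[of "t/2" "t/2" "2 ^ n", OF _ _ _ _ g] t elim
        unfolding s by (simp add: euler_def C_def)
      then show ?case by (simp add: power_divide)
    qed
    have "summable (\<lambda>n. euler (Suc n) t g - euler n t g)"
      by (rule summable_comparison_test_ev[OF step]) (intro summable_mult summable_geometric, simp)
    then have "convergent (\<lambda>n. \<Sum>k<n. euler (Suc k) t g - euler k t g)"
      by (simp add: summable_iff_convergent)
    then have "convergent (\<lambda>n. euler n t g - euler 0 t g)" unfolding sum_lessThan_telescope[of "\<lambda>k. euler k t g"] .
    then have "convergent (\<lambda>n. (euler n t g - euler 0 t g) + euler 0 t g)"
      by (rule convergent_add[OF _ convergent_const])
    then show "convergent (\<lambda>n. euler n t g)" by simp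
  qed
  then show ?thesis by (simp add: convergent_LIMSEQ_iff)
qed

lemma euler_limit_bounded_linear:
  assumes t: "t \<ge> 0" shows "bounded_linear (\<lambda>f. lim (\<lambda>n. euler n t f))"
proof (rule bounded_linear_intro)
  note c = euler_converges[OF t]
  fix f g and r
  show "lim (\<lambda>n. euler n t (f + g)) = lim (\<lambda>n. euler n t f) + lim (\<lambda>n. euler n t g)"
    using tendsto_add[OF c[of f] c[of g]] by (intro limI) (simp only: linear_add[OF linear_euler])
  show "lim (\<lambda>n. euler n t (r *\<^sub>R f)) = r *\<^sub>R lim (\<lambda>n. euler n t f)"
    using tendsto_scaleR[OF tendsto_const c[of f], of r] by (intro limI) (simp only: linear_scale[OF linear_euler])
  show "norm (lim (\<lambda>n. euler n t f)) \<le> norm f * exp (2 * w * t)"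
  proof (rule tendsto_upperbound[OF tendsto_norm[OF c[of f]]])
    show "\<forall>\<^sub>F n in sequentially. norm (euler n t f) \<le> norm f * exp (2 * w * t)"
      using eventually_step_small[of t] by eventually_elim (use norm_euler[OF t] in \<open>simp add: mult.commute\<close>)
  qed simp
qed

lemma euler_tendsto: "t \<ge> 0 \<Longrightarrow> (\<lambda>n. euler n t f) \<longlonglongrightarrow> euler_limit t f"
  using euler_converges[of t f] by (simp add: euler_limit_def bounded_linear_Blinfun_apply[OF euler_limit_bounded_linear])

lemma euler_limit_norm_le:
  assumes "t \<ge> 0" and "\<forall>\<^sub>F n in sequentially. norm (euler n t f - g) \<le> c" shows "norm (euler_limit t f - g) \<le> c"
  by (rule tendsto_upperbound[OF tendsto_norm[OF tendsto_diff[OF euler_tendsto[OF assms(1)] tendsto_const]] assms(2)]) simp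

lemma norm_euler_limit: assumes "t \<ge> 0" shows "norm (euler_limit t f) \<le> exp (2 * w * t) * norm f"
proof -
  have "norm (euler_limit t f - 0) \<le> exp (2 * w * t) * norm f"
    by (rule euler_limit_norm_le[OF assms], use eventually_step_small[of t] in eventually_elim)
      (use norm_euler[OF assms] in simp)
  then show ?thesis by simp
qed

text \<open>The iterates of \<open>J h\<close> satisfy these bounds uniformly in \<open>n\<close> because \<open>J h f - f = h J h (A f)\<close> and the
tangent estimate for iterates applies; both bounds pass to the limit.\<close>

lemma euler_limit_near_id:
  assumes t: "t \<ge> 0" and f: "(f, f1) \<in> A"
  shows "norm (euler_limit t f - f) \<le> t * exp (4 * w * t) * norm f1"
    and "(f1, f2) \<in> A \<Longrightarrow> norm (euler_limit t f - f - t *\<^sub>R f1) \<le> 2 * t\<^sup>2 * exp (4 * w * t) * norm f2"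
proof -
  have pw: "norm ((blinfun_apply (J (t / 2 ^ n)) ^^ k) v) \<le> exp (2 * w * t) * norm v"
    if "t / 2 ^ n \<le> h0" "k \<le> 2 ^ n" for n k v
  proof (rule J_pow_mono)
    have "real k * (t / 2 ^ n) \<le> 2 ^ n * (t / 2 ^ n)"
      using that t by (intro mult_right_mono) (auto simp: of_nat_le_iff[symmetric] simp del: of_nat_le_iff)
    then show "real k * (t / 2 ^ n) \<le> t" by simp
  qed (use that t in auto)
  have ee: "exp (2 * w * t) * exp (2 * w * t) = exp (4 * w * t)" by (simp add: exp_add[symmetric])
  have one: "norm (J h v) \<le> exp (2 * w * t) * norm v" if "h = t / 2 ^ n" "t / 2 ^ n \<le> h0" for h n v
    using pw[OF that(2), of 1 v] that(1) by simp
  show "norm (euler_limit t f - f) \<le> t * exp (4 * w * t) * norm f1"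
  proof (rule euler_limit_norm_le[OF t], use eventually_step_small[of t] in eventually_elim)
    case (elim n)
    define h where "h = t / 2 ^ n"
    have h: "0 \<le> h" "h \<le> h0" "2 ^ n * h = t" using t elim by (auto simp: h_def)
    have "norm (euler n t f - f) \<le> real (2 ^ n) * exp (2 * w * t) * norm (J h f - f)"
      unfolding euler_def h_def by (rule norm_funpow_diff_id_le) (rule pw[OF elim], simp)
    also have "J h f - f = h *\<^sub>R J h f1" using J_A(2)[OF h(1,2) f] by simp
    also have "real (2 ^ n) * exp (2 * w * t) * norm (h *\<^sub>R J h f1)
        = (2 ^ n * h) * exp (2 * w * t) * norm (J h f1)"
      using h by simp
    also have "\<dots> \<le> t * exp (2 * w * t) * (exp (2 * w * t) * norm f1)"
      unfolding h(3) using t by (intro mult_left_mono one[OF h_def elim]) auto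
    also have "\<dots> = t * exp (4 * w * t) * norm f1" unfolding ee[symmetric] by (simp add: mult_ac)
    finally show ?case .
  qed
  assume f1: "(f1, f2) \<in> A"
  have "norm (euler_limit t f - (f + t *\<^sub>R f1)) \<le> 2 * t\<^sup>2 * exp (4 * w * t) * norm f2"
  proof (rule euler_limit_norm_le[OF t], use eventually_step_small[of t] in eventually_elim)
    case (elim n)
    define h where "h = t / 2 ^ n"
    have h: "0 \<le> h" "h \<le> h0" "2 ^ n * h = t" using t elim by (auto simp: h_def)
    have a: "J h f1 - f1 = h *\<^sub>R J h f2" using J_A(2)[OF h(1,2) f1] by simp
    have b: "J h f - f - h *\<^sub>R f1 = h *\<^sub>R (h *\<^sub>R J h f2)"
      using J_A(2)[OF h(1,2) f] a by (simp add: scaleR_diff_right[symmetric] del: scaleR_scaleR)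
    have "norm (euler n t f - f - (real (2 ^ n) * h) *\<^sub>R f1)
        \<le> real (2 ^ n) * exp (2 * w * t) * norm (J h f - f - h *\<^sub>R f1)
          + (real (2 ^ n))\<^sup>2 * h * exp (2 * w * t) * norm (J h f1 - f1)"
      unfolding euler_def h_def[symmetric]
    proof (rule norm_funpow_diff_tangent_le)
      show "norm ((blinfun_apply (J h) ^^ k) v) \<le> exp (2 * w * t) * norm v" if "k < 2 ^ n" for k v
        unfolding h_def using that by (intro pw[OF elim]) simp
    qed (use h in auto)
    also have "\<dots> = ((2 ^ n * h) * h + (2 ^ n * h)\<^sup>2) * exp (2 * w * t) * norm (J h f2)"
      unfolding a b norm_scaleR using h(1) by (simp add: power2_eq_square algebra_simps)
    also have "\<dots> = (t * h + t\<^sup>2) * exp (2 * w * t) * norm (J h f2)" unfolding h(3) ..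
    also have "\<dots> \<le> (2 * t\<^sup>2) * exp (2 * w * t) * (exp (2 * w * t) * norm f2)"
    proof (intro mult_mono one[OF h_def elim])
      have "h \<le> t" using mult_left_mono[OF one_le_power[of "2::real" n] t]
        by (simp add: h_def field_simps)
      then have "t * h \<le> t * t" using t by (rule mult_left_mono)
      then show "t * h + t\<^sup>2 \<le> 2 * t\<^sup>2" by (simp add: power2_eq_square)
    qed (use t h in auto)
    also have "\<dots> = 2 * t\<^sup>2 * exp (4 * w * t) * norm f2" unfolding ee[symmetric] by (simp add: mult_ac)
    finally show ?case using h(3) by (simp add: diff_diff_eq)
  qed
  then show "norm (euler_limit t f - f - t *\<^sub>R f1) \<le> 2 * t\<^sup>2 * exp (4 * w * t) * norm f2"
    by (simp add: diff_diff_eq)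
qed

lemma euler_limit_add:
  assumes s: "s \<ge> 0" and t: "t \<ge> 0"
  shows "euler_limit (s + t) f = euler_limit s (euler_limit t f)"
proof -
  have Eq: "euler_limit s (euler_limit t g) = euler_limit (s + t) g" if "g \<in> D2" for g
  proof -
    obtain g1 g2 where g: "(g, g1) \<in> A" "(g1, g2) \<in> A" using \<open>g \<in> D2\<close> by (auto simp: D2_def)
    define C where "C = 2 * (s + t)\<^sup>2 * exp (6 * w * (s + t)) * norm g2"
    have 1: "(\<lambda>n. euler n s (euler n t g) - euler n (s + t) g) \<longlonglongrightarrow> 0"
    proof (rule Lim_null_comparison)
      show "\<forall>\<^sub>F n in sequentially. norm (euler n s (euler n t g) - euler n (s + t) g) \<le> C / 2 ^ n"
        using eventually_step_small[of "s + t"]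
      proof eventually_elim
        case (elim n)
        then show ?case using J_pow_split[OF s t, of "2 ^ n", OF _ _ g] by (simp add: euler_def C_def)
      qed
      show "(\<lambda>n. C / 2 ^ n) \<longlonglongrightarrow> 0" by real_asymp
    qed
    have 2: "(\<lambda>n. euler n s (euler n t g - euler_limit t g)) \<longlonglongrightarrow> 0"
    proof (rule Lim_null_comparison)
      show "\<forall>\<^sub>F n in sequentially. norm (euler n s (euler n t g - euler_limit t g)) \<le> exp (2 * w * s) * norm (euler n t g - euler_limit t g)"
        using eventually_step_small[of s] by eventually_elim (rule norm_euler[OF s])
      have "(\<lambda>n. euler n t g - euler_limit t g) \<longlonglongrightarrow> euler_limit t g - euler_limit t g" by (intro tendsto_intros euler_tendsto t)
      then show "(\<lambda>n. exp (2 * w * s) * norm (euler n t g - euler_limit t g)) \<longlonglongrightarrow> 0"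
        by (auto intro!: tendsto_mult_right_zero tendsto_norm_zero)
    qed
    have "(\<lambda>n. euler n s (euler_limit t g) - euler n (s + t) g) \<longlonglongrightarrow> 0 - 0"
      using tendsto_diff[OF 1 2] by (simp add: linear_diff[OF linear_euler])
    moreover have "(\<lambda>n. euler n s (euler_limit t g) - euler n (s + t) g) \<longlonglongrightarrow> euler_limit s (euler_limit t g) - euler_limit (s + t) g"
      using s t by (intro tendsto_diff euler_tendsto) auto
    ultimately have "euler_limit s (euler_limit t g) - euler_limit (s + t) g = 0 - 0" by (rule LIMSEQ_unique[rotated])
    then show ?thesis by simp
  qed
  have "closed {g. euler_limit s (euler_limit t g) = euler_limit (s + t) g}"
    by (intro closed_Collect_eq continuous_intros)
  then have "closure D2 \<subseteq> {g. euler_limit s (euler_limit t g) = euler_limit (s + t) g}"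
    by (intro closure_minimal) (use Eq in auto)
  then have "f \<in> {g. euler_limit s (euler_limit t g) = euler_limit (s + t) g}" unfolding D2_dense by blast
  then show ?thesis by simp
qed

lemma euler_limit_zero: "euler_limit 0 = id_blinfun"
proof (rule blinfun_eqI)
  fix f
  have "(\<lambda>n. euler n 0 f) \<longlonglongrightarrow> f"
  proof -
    have "(blinfun_apply id_blinfun ^^ n) f = f" for n by (induction n) auto
    then show ?thesis by (simp add: euler_def J_def)
  qed
  then show "euler_limit 0 f = id_blinfun f" using euler_tendsto[of 0 f] LIMSEQ_unique by fastforce
qed

lemma euler_limit_tendsto: "((\<lambda>h. euler_limit h f) \<longlongrightarrow> f) (at_right 0)"
proof (rule tendsto_from_dense[of "\<lambda>h. blinfun_apply (euler_limit h)" "\<lambda>x. x"])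
  have ev: "\<forall>\<^sub>F h in at_right 0. 0 < h \<and> h \<le> (1::real)"
    by (auto simp: eventually_at_right_field intro!: exI[of _ 1])
  show "\<forall>\<^sub>F h in at_right 0. \<forall>x. norm (euler_limit h x) \<le> exp (2 * w) * norm x"
    using ev
  proof eventually_elim
    case (elim h)
    have "norm (euler_limit h x) \<le> exp (2 * w) * norm x" for x
    proof -
      have "w * h \<le> w * 1" using elim w0 by (intro mult_left_mono) auto
      then have "exp (2 * w * h) * norm x \<le> exp (2 * w) * norm x" by (intro mult_right_mono) auto
      then show ?thesis using norm_euler_limit[of h x] elim by linarith
    qed
    then show ?case by blast
  qed
  show "closure (Domain A) = UNIV" by (rule dense)
  fix g assume "g \<in> Domain A"
  then obtain g1 where g: "(g, g1) \<in> A" by blast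
  show "((\<lambda>h. euler_limit h g) \<longlongrightarrow> g) (at_right 0)"
  proof (rule LIM_zero_cancel, rule Lim_null_comparison)
    show "\<forall>\<^sub>F h in at_right 0. norm (euler_limit h g - g) \<le> h * exp (4 * w * h) * norm g1"
      using ev by eventually_elim (use euler_limit_near_id(1)[OF _ g] in simp)
    have "((\<lambda>h. h * exp (4 * w * h) * norm g1) \<longlongrightarrow> 0 * exp (4 * w * 0) * norm g1) (at_right 0)"
      by (intro tendsto_intros)
    then show "((\<lambda>h. h * exp (4 * w * h) * norm g1) \<longlongrightarrow> 0) (at_right 0)" by simp
  qed
qed (auto intro: bounded_linear.linear blinfun.bounded_linear_right bounded_linear_ident)

text \<open>By the semigroup law and the exponential bound, continuity at all times follows from continuity at
\<open>0\<close>.\<close>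

lemma C0_semigroup_euler_limit: "C0_semigroup euler_limit"
  unfolding C0_semigroup_def
proof (intro conjI allI impI)
  show "euler_limit 0 = id_blinfun" by (rule euler_limit_zero)
  show "euler_limit (s + t) = euler_limit s o\<^sub>L euler_limit t" if "0 \<le> s" "0 \<le> t" for s t
    by (rule blinfun_eqI) (simp add: euler_limit_add[OF that])
  fix f
  show "continuous_on {0..} (\<lambda>t. euler_limit t f)"
    unfolding continuous_on_iff
  proof (intro ballI allI impI)
    fix t e :: real assume t: "t \<in> {0..}" and e: "e > 0"
    define K where "K = exp (2 * w * (t + 1))"
    have K: "K > 0" by (simp add: K_def)
    have near: "norm (euler_limit r f - euler_limit s f) \<le> K * norm (euler_limit (r - s) f - f)" if "0 \<le> s" "s \<le> r" "s \<le> t + 1" for r s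
    proof -
      have "euler_limit r f - euler_limit s f = euler_limit s (euler_limit (r - s) f - f)"
        using euler_limit_add[of s "r - s" f] that by (simp add: blinfun.diff_right)
      then have "norm (euler_limit r f - euler_limit s f) \<le> exp (2 * w * s) * norm (euler_limit (r - s) f - f)"
        using norm_euler_limit[OF that(1)] by simp
      also have "\<dots> \<le> K * norm (euler_limit (r - s) f - f)"
        unfolding K_def using w0 that by (intro mult_right_mono) (auto intro: mult_left_mono)
      finally show ?thesis .
    qed
    have "\<forall>\<^sub>F h in at_right 0. dist (euler_limit h f) f < e / K" using euler_limit_tendsto e K by (intro tendstoD) auto
    then obtain d where d: "d > 0" "\<And>h. 0 < h \<Longrightarrow> h < d \<Longrightarrow> norm (euler_limit h f - f) < e / K"
      by (auto simp: eventually_at_right_field dist_norm)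
    have d0: "K * norm (euler_limit h f - f) < e" if "0 \<le> h" "h < d" for h
    proof (cases "h = 0")
      case False
      then have "norm (euler_limit h f - f) < e / K" using d(2) that by simp
      then show ?thesis using K by (simp add: field_simps)
    qed (use e euler_limit_zero in simp)
    have "dist (euler_limit s f) (euler_limit t f) < e" if "s \<in> {0..}" "dist s t < min d 1" for s
    proof (cases "s \<le> t")
      case True
      then show ?thesis using near[of s t] d0[of "t - s"] that by (auto simp: dist_norm norm_minus_commute)
    next
      case False
      then show ?thesis using near[of t s] d0[of "s - t"] that t by (auto simp: dist_norm)
    qed
    then show "\<exists>d>0. \<forall>s\<in>{0..}. dist s t < d \<longrightarrow> dist (euler_limit s f) (euler_limit t f) < e"
      using d(1) by (intro exI[of _ "min d 1"]) auto
  qed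
qed

text \<open>On \<open>D2\<close> the second bound of \<open>euler_limit_near_id\<close> gives differentiability at \<open>0\<close>. A general \<open>f\<close> in the domain of \<open>A\<close> is
replaced by \<open>J h f\<close>; the resulting error in the difference quotient is bounded by
\<open>\<parallel>A f - J h (A f)\<parallel>\<close> uniformly in \<open>t\<close>, by the first bound.\<close>

lemma A_subset_generator: "A \<subseteq> generator euler_limit"
proof (clarsimp simp: generator_def)
  fix f f1 assume f: "(f, f1) \<in> A"
  show "((\<lambda>t. (euler_limit t f - f) /\<^sub>R t) \<longlongrightarrow> f1) (at_right 0)"
  proof (rule tendstoI)
    fix e :: real assume e: "e > 0"
    define K where "K = exp (4 * w) + 1"
    have K: "K > 0" by (simp add: K_def add_pos_pos)
    have "\<forall>\<^sub>F h in at_right 0. dist (J h f1) f1 < e / (2 * K)"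
      using J_tendsto e K by (intro tendstoD) auto
    moreover have "\<forall>\<^sub>F h in at_right 0. 0 < h \<and> h \<le> h0"
      using h0 by (auto simp: eventually_at_right_field intro!: exI[of _ h0])
    ultimately have "\<forall>\<^sub>F h in at_right 0. dist (J h f1) f1 < e / (2 * K) \<and> 0 < h \<and> h \<le> h0"
      by (rule eventually_conj)
    then obtain h where h: "0 < h" "h \<le> h0" "norm (J h f1 - f1) < e / (2 * K)"
      using eventually_happens'[OF trivial_limit_at_right_real] unfolding dist_norm by blast
    define g g1 where "g = J h f" and "g1 = J h f1"
    have g: "(g, g1) \<in> A" using J_A(1)[OF _ h(2) f] h by (simp add: g_def g1_def)
    obtain g2 where g2: "(g1, g2) \<in> A" using J_mem[OF h(1,2)] by (auto simp: g1_def)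
    define C where "C = 2 * exp (4 * w) * norm g2"
    have "((\<lambda>t. t * C) \<longlongrightarrow> 0) (at_right 0)" by (auto intro!: tendsto_eq_intros)
    then have "\<forall>\<^sub>F t in at_right 0. t * C < e / 2" using e by (intro order_tendstoD) auto
    moreover have "\<forall>\<^sub>F t in at_right 0. 0 < t \<and> t \<le> (1::real)"
      by (auto simp: eventually_at_right_field intro!: exI[of _ 1])
    ultimately show "\<forall>\<^sub>F t in at_right 0. dist ((euler_limit t f - f) /\<^sub>R t) f1 < e"
    proof eventually_elim
      case (elim t)
      have et: "exp (4 * w * t) \<le> exp (4 * w)" using elim w0 by (simp add: mult_left_le)
      have 1: "norm ((euler_limit t (f - g) - (f - g)) /\<^sub>R t) \<le> exp (4 * w) * norm (f1 - g1)"
      proof -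
        have "norm (euler_limit t (f - g) - (f - g)) \<le> t * exp (4 * w * t) * norm (f1 - g1)"
          using euler_limit_near_id(1)[OF _ A_diff[OF f g], of t] elim by simp
        also have "\<dots> \<le> t * exp (4 * w) * norm (f1 - g1)"
          using elim et by (intro mult_mono) auto
        finally show ?thesis using elim by (intro norm_divideR_le) (simp_all add: mult.assoc)
      qed
      have 2: "norm ((euler_limit t g - g - t *\<^sub>R g1) /\<^sub>R t) \<le> t * C"
      proof -
        have "norm (euler_limit t g - g - t *\<^sub>R g1) \<le> 2 * t\<^sup>2 * exp (4 * w * t) * norm g2"
          using euler_limit_near_id(2)[OF _ g g2] elim by simp
        also have "\<dots> \<le> 2 * t\<^sup>2 * exp (4 * w) * norm g2"
          using elim et by (intro mult_mono) auto
        finally show ?thesis using elim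
          by (intro norm_divideR_le) (simp_all add: C_def power2_eq_square mult_ac)
      qed
      have "(euler_limit t f - f) /\<^sub>R t - f1 = (euler_limit t (f - g) - (f - g)) /\<^sub>R t + (euler_limit t g - g - t *\<^sub>R g1) /\<^sub>R t + (g1 - f1)"
        using elim by (simp add: blinfun.diff_right scaleR_diff_right)
      then have "norm ((euler_limit t f - f) /\<^sub>R t - f1) \<le> norm ((euler_limit t (f - g) - (f - g)) /\<^sub>R t)
          + norm ((euler_limit t g - g - t *\<^sub>R g1) /\<^sub>R t) + norm (g1 - f1)"
        by (simp only: norm_triangle_add3)
      also have "\<dots> \<le> exp (4 * w) * norm (f1 - g1) + t * C + norm (g1 - f1)"
        using 1 2 by simp
      also have "\<dots> = K * norm (g1 - f1) + t * C"
        by (simp add: K_def norm_minus_commute algebra_simps)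
      also have "\<dots> < e / 2 + e / 2"
        using h(3) K elim by (intro add_strict_mono) (auto simp: g1_def field_simps)
      finally show ?case by (simp add: dist_norm)
    qed
  qed
qed

text \<open>The growth bound makes the generator dissipative up to the shift \<open>2 w\<close>: expanding \<open>T t u\<close> to first order
and comparing norms gives \<open>l \<parallel>u\<parallel> \<le> 2 w \<parallel>u\<parallel>\<close>.\<close>

lemma generator_eigenvector_zero:
  assumes lam: "l > 2 * w" and u: "(u, l *\<^sub>R u) \<in> generator euler_limit"
  shows "u = 0"
proof -
  let ?q = "\<lambda>t. (euler_limit t u - u) /\<^sub>R t"
  have q: "(?q \<longlongrightarrow> l *\<^sub>R u) (at_right 0)" using u by (simp add: generator_def)
  have "((\<lambda>t. (exp (2 * w * t) - 1) / t * norm u + norm (?q t - l *\<^sub>R u)) \<longlongrightarrow>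
      (2 * w) * norm u + norm (l *\<^sub>R u - l *\<^sub>R u)) (at_right 0)"
  proof (rule tendsto_add[OF tendsto_mult[OF _ tendsto_const]
        tendsto_norm[OF tendsto_diff[OF q tendsto_const]]])
    show "((\<lambda>t. (exp (2 * w * t) - 1) / t) \<longlongrightarrow> 2 * w) (at_right 0)" by real_asymp
  qed
  then have "l * norm u \<le> (2 * w) * norm u + norm (l *\<^sub>R u - l *\<^sub>R u)"
  proof (rule tendsto_lowerbound)
    show "\<forall>\<^sub>F t in at_right 0. l * norm u \<le> (exp (2 * w * t) - 1) / t * norm u + norm (?q t - l *\<^sub>R u)"
      using eventually_at_right_less[of "0::real"]
    proof eventually_elim
      case (elim t)
      have l0: "l > 0" using lam w0 by linarith
      have "(1 + t * l) *\<^sub>R u = euler_limit t u - t *\<^sub>R (?q t - l *\<^sub>R u)"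
        using elim by (simp add: scaleR_diff_right scaleR_add_left)
      then have "norm ((1 + t * l) *\<^sub>R u) \<le> norm (euler_limit t u) + norm (t *\<^sub>R (?q t - l *\<^sub>R u))"
        by (metis norm_triangle_ineq4)
      moreover have "norm ((1 + t * l) *\<^sub>R u) = (1 + t * l) * norm u"
        using elim l0 by simp
      moreover have "norm (t *\<^sub>R (?q t - l *\<^sub>R u)) = t * norm (?q t - l *\<^sub>R u)" using elim by simp
      ultimately have "(1 + t * l) * norm u \<le> exp (2 * w * t) * norm u + t * norm (?q t - l *\<^sub>R u)"
        using norm_euler_limit[of t u] elim by linarith
      then have "t * (l * norm u) \<le> (exp (2 * w * t) - 1) * norm u + t * norm (?q t - l *\<^sub>R u)"
        by (simp add: algebra_simps)
      also have "\<dots> = t * ((exp (2 * w * t) - 1) / t * norm u + norm (?q t - l *\<^sub>R u))"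
        using elim by (simp add: field_simps)
      finally show ?case using elim by (rule mult_left_le_imp_le)
    qed
  qed simp
  then have "(l - 2 * w) * norm u \<le> 0" by (simp add: algebra_simps)
  then show ?thesis using lam by (simp add: mult_le_0_iff)
qed

text \<open>\<open>A\<close> is contained in the generator. It cannot be smaller, because \<open>1 - h A\<close> is already onto while
\<open>1 - h\<close> times the generator is injective.\<close>

theorem generates_euler_limit: "generates A euler_limit"
  unfolding generates_def
proof (intro conjI C0_semigroup_euler_limit equalityI A_subset_generator subrelI)
  fix f g assume fg: "(f, g) \<in> generator euler_limit"
  \<comment> \<open>This bound on \<open>h\<close> puts \<open>1/h\<close> above \<open>2 w\<close>, where the generator has no eigenvalues.\<close>
  define h where "h = min h0 (1 / (2 * w + 1))"
  have h: "0 < h" "h \<le> h0" "h \<le> 1 / (2 * w + 1)" using h0 w0 by (auto simp: h_def)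
  have l: "1 / h > 2 * w"
  proof -
    have "2 * w + 1 \<le> 1 / h" using h w0 by (simp add: field_simps)
    then show ?thesis by linarith
  qed
  obtain u v where uv: "(u, v) \<in> A" "u - h *\<^sub>R v = f - h *\<^sub>R g" using surj[OF h(1,2)] by blast
  have "(u, v) \<in> generator euler_limit" using uv A_subset_generator by blast
  with fg have "((\<lambda>t. (euler_limit t f - f) /\<^sub>R t - (euler_limit t u - u) /\<^sub>R t) \<longlongrightarrow> g - v) (at_right 0)"
    by (intro tendsto_diff) (auto simp: generator_def)
  then have gen: "(f - u, g - v) \<in> generator euler_limit"
    by (simp add: generator_def blinfun.diff_right scaleR_diff_right algebra_simps)
  have "f - u = h *\<^sub>R (g - v)" using uv(2) by (simp add: algebra_simps)
  then have "(1 / h) *\<^sub>R (f - u) = (1 / h) *\<^sub>R (h *\<^sub>R (g - v))" by (rule arg_cong)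
  then have gv: "g - v = (1 / h) *\<^sub>R (f - u)" using h(1) by simp
  have "f - u = 0" using generator_eigenvector_zero[OF l] gen unfolding gv by blast
  with gv uv(1) show "(f, g) \<in> A" by simp
qed

end

section \<open>The method of continuity\<close>

text \<open>Solvability at the parameter \<open>s\<close> carries over to \<open>s + 1/N\<close> for any \<open>N > M\<close>: with a right inverse \<open>K\<close> of the
operator at \<open>s\<close>, the equation at \<open>s + 1/N\<close> becomes a fixed point equation for a map with Lipschitz constant
\<open>M/N\<close>. As the a priori estimate does not depend on \<open>s\<close>, neither does the step, and \<open>N\<close> steps lead
from \<open>0\<close> to \<open>1\<close>.\<close>

theorem method_of_continuity:
  fixes B0 B1 :: "'a::real_normed_vector \<Rightarrow> 'b::banach"
  assumes D: "\<And>u v. u \<in> D \<Longrightarrow> v \<in> D \<Longrightarrow> u - v \<in> D"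
    and B0: "\<And>u v. u \<in> D \<Longrightarrow> v \<in> D \<Longrightarrow> B0 (u - v) = B0 u - B0 v"
    and B1: "\<And>u v. u \<in> D \<Longrightarrow> v \<in> D \<Longrightarrow> B1 (u - v) = B1 u - B1 v"
    and est: "\<And>s u. 0 \<le> s \<Longrightarrow> s \<le> 1 \<Longrightarrow> u \<in> D \<Longrightarrow>
      norm (B1 u - B0 u) \<le> M * norm (B0 u + s *\<^sub>R (B1 u - B0 u))"
    and surj0: "\<And>g. \<exists>u\<in>D. B0 u = g"
  shows "\<exists>u\<in>D. B1 u = g"
proof -
  define Bs where "Bs s u = B0 u + s *\<^sub>R (B1 u - B0 u)" for s u
  have diff: "Bs s (u - v) = Bs s u - Bs s v" if "u \<in> D" "v \<in> D" for s u v
    using that by (simp add: Bs_def B0 B1 algebra_simps)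
  \<comment> \<open>The continuity path is cut into \<open>N > M\<close> equal pieces.\<close>
  define N where "N = nat \<lceil>\<bar>M\<bar>\<rceil> + 1"
  have N: "real N > \<bar>M\<bar>" "N > 0" unfolding N_def by linarith+
  have step: "\<exists>u\<in>D. Bs (real k / real N) u = g" if "k \<le> N" for k g
    using that
  proof (induction k arbitrary: g)
    case 0
    then show ?case using surj0 by (simp add: Bs_def)
  next
    case (Suc k)
    define s where "s = real k / real N"
    have s: "0 \<le> s" "s \<le> 1" using Suc N by (auto simp: s_def)
    define K where "K g = (SOME u. u \<in> D \<and> Bs s u = g)" for g
    have K: "K g \<in> D \<and> Bs s (K g) = g" for g
      unfolding K_def by (rule someI_ex) (use Suc s_def in auto)
    define \<Phi> where "\<Phi> v = g - (1 / real N) *\<^sub>R (B1 (K v) - B0 (K v))" for v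
    have "\<exists>!v. \<Phi> v = v"
    proof (rule banach_fix_type[of "\<bar>M\<bar> / real N"])
      show "0 \<le> \<bar>M\<bar> / real N" "\<bar>M\<bar> / real N < 1" using N by auto
      show "\<forall>x y. dist (\<Phi> x) (\<Phi> y) \<le> \<bar>M\<bar> / real N * dist x y"
      proof (intro allI)
        fix x y
        have KD: "K x \<in> D" "K y \<in> D" using K by auto
        let ?u = "K x - K y"
        have "dist (\<Phi> x) (\<Phi> y) = norm ((1 / real N) *\<^sub>R (B1 ?u - B0 ?u))"
          unfolding \<Phi>_def dist_norm B0[OF KD] B1[OF KD]
          by (subst norm_minus_commute) (simp add: algebra_simps)
        also have "\<dots> = norm (B1 ?u - B0 ?u) / real N" by simp
        also have "\<dots> \<le> (M * norm (Bs s ?u)) / real N"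
          unfolding Bs_def using est[OF s D[OF KD]] by (intro divide_right_mono) auto
        also have "\<dots> \<le> (\<bar>M\<bar> * norm (Bs s ?u)) / real N"
          by (intro divide_right_mono mult_right_mono) auto
        also have "Bs s ?u = x - y" using K by (simp add: diff[OF KD])
        finally show "dist (\<Phi> x) (\<Phi> y) \<le> \<bar>M\<bar> / real N * dist x y" by (simp add: dist_norm)
      qed
    qed
    then obtain v where v: "\<Phi> v = v" by blast
    have "Bs (real (Suc k) / real N) (K v) = Bs s (K v) + (1 / real N) *\<^sub>R (B1 (K v) - B0 (K v))"
      by (simp add: Bs_def s_def add_divide_distrib scaleR_add_left)
    also have "\<dots> = v + (g - \<Phi> v)" using K by (simp add: \<Phi>_def)
    finally show ?case using v K by (intro bexI[of _ "K v"]) auto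
  qed
  show ?thesis using step[of N g] N by (simp add: Bs_def)
qed

section \<open>Functions with bounded uniformly continuous derivatives\<close>

lemma sup_norm_ge: "f \<in> UCb \<Longrightarrow> \<bar>f x\<bar> \<le> sup_norm f"
  using ucb_apply_le_norm[of "Abs_ucb f" x] by (simp add: norm_ucb_def Abs_ucb_inverse)

lemma sup_norm_le: "(\<And>x. \<bar>f x\<bar> \<le> B) \<Longrightarrow> sup_norm f \<le> B"
  unfolding sup_norm_def by (rule cSUP_least) auto

lemma sup_norm_nonneg: "f \<in> UCb \<Longrightarrow> 0 \<le> sup_norm f"
  using sup_norm_ge[of f 0] abs_ge_zero order_trans by blast

lemma times_differentiable_Suc:
  "times_differentiable (Suc k) f \<longleftrightarrow>
    (\<forall>x. f field_differentiable at x) \<and> times_differentiable k (deriv f)"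
proof -
  have "(deriv ^^ Suc i) f = (deriv ^^ i) (deriv f)" for i by (simp only: funpow_Suc_right comp_apply)
  then show ?thesis
    unfolding times_differentiable_def by (simp only: All_less_Suc2 funpow_0)
qed

lemma UCb_n_alt: "f \<in> UCb_n n \<longleftrightarrow> times_differentiable n f \<and> (\<forall>j\<le>n. (deriv ^^ j) f \<in> UCb)"
proof -
  have "(\<forall>j\<le>n. (deriv ^^ j) f \<in> UCb) \<longleftrightarrow> f \<in> UCb \<and> (\<forall>j\<in>{1..n}. (deriv ^^ j) f \<in> UCb)"
  proof
    assume *: "f \<in> UCb \<and> (\<forall>j\<in>{1..n}. (deriv ^^ j) f \<in> UCb)"
    show "\<forall>j\<le>n. (deriv ^^ j) f \<in> UCb"
    proof (intro allI impI)
      fix j assume "j \<le> n"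
      with * show "(deriv ^^ j) f \<in> UCb" by (cases "j = 0") auto
    qed
  next
    assume *: "\<forall>j\<le>n. (deriv ^^ j) f \<in> UCb"
    from *[rule_format, of 0] have "f \<in> UCb" by simp
    with * show "f \<in> UCb \<and> (\<forall>j\<in>{1..n}. (deriv ^^ j) f \<in> UCb)" by auto
  qed
  then show ?thesis by (auto simp: UCb_n_def)
qed

lemma UCb_n_0 [simp]: "UCb_n 0 = UCb"
  by (auto simp: UCb_n_def times_differentiable_def)

text \<open>The recursion on which the inductions over the order of differentiability are based.\<close>

lemma UCb_n_Suc:
  "f \<in> UCb_n (Suc n) \<longleftrightarrow> f \<in> UCb \<and> (\<forall>x. (f has_real_derivative deriv f x) (at x)) \<and> deriv f \<in> UCb_n n"
proof -
  have 1: "(deriv ^^ Suc i) f = (deriv ^^ i) (deriv f)" for i by (simp only: funpow_Suc_right comp_apply)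
  have "(\<forall>j\<le>Suc n. (deriv ^^ j) f \<in> UCb) \<longleftrightarrow> f \<in> UCb \<and> (\<forall>j\<le>n. (deriv ^^ j) (deriv f) \<in> UCb)"
    unfolding less_Suc_eq_le[symmetric] All_less_Suc2[of "Suc n"] by (simp only: 1 funpow_0)
  then show ?thesis
    unfolding UCb_n_alt times_differentiable_Suc
    using DERIV_deriv_iff_field_differentiable by blast
qed

lemma UCb_n_SucI:
  assumes "f \<in> UCb" "\<And>x. (f has_real_derivative g x) (at x)" "g \<in> UCb_n n"
  shows "f \<in> UCb_n (Suc n)" and "deriv f = g"
proof -
  show "deriv f = g" using assms(2) by (auto intro: DERIV_imp_deriv)
  with assms show "f \<in> UCb_n (Suc n)" by (simp add: UCb_n_Suc)
qed

lemma UCb_n_subset_Suc: "f \<in> UCb_n (Suc n) \<Longrightarrow> f \<in> UCb_n n"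
proof (induction n arbitrary: f)
  case (Suc n)
  from Suc.prems[unfolded UCb_n_Suc[of _ "Suc n"]] Suc.IH[of "deriv f"] show ?case
    by (simp add: UCb_n_Suc)
qed (simp add: UCb_n_Suc)

lemma UCb_n_mono: "n \<le> m \<Longrightarrow> f \<in> UCb_n m \<Longrightarrow> f \<in> UCb_n n"
  by (induction rule: dec_induct) (use UCb_n_subset_Suc in auto)

lemma UCb_n_UCb: "f \<in> UCb_n n \<Longrightarrow> f \<in> UCb"
  using UCb_n_mono[of 0 n f] by simp

lemma UCb_diff: "f \<in> UCb \<Longrightarrow> g \<in> UCb \<Longrightarrow> (\<lambda>x. f x - g x) \<in> UCb"
  using UCb_add[OF _ UCb_mult[OF UCb_const[of "-1"]], of f g] by simp

lemma UCb_shift: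
  assumes "f \<in> UCb" shows "(\<lambda>x. f (x + h)) \<in> UCb"
proof -
  obtain B where B: "B > 0" "\<And>x. \<bar>f x\<bar> \<le> B" by (rule UCb_bound[OF assms]) blast
  show ?thesis
  proof (rule UCbI[of _ B])
    have u: "uniformly_continuous_on UNIV f" using assms by (simp add: UCb_def)
    show "uniformly_continuous_on UNIV (\<lambda>x. f (x + h))"
      unfolding uniformly_continuous_on_def
    proof (intro allI impI)
      fix e :: real assume "e > 0"
      then obtain d where d: "d > 0" "\<And>x y. dist y x < d \<Longrightarrow> dist (f y) (f x) < e"
        using u unfolding uniformly_continuous_on_def by (metis UNIV_I)
      then show "\<exists>d>0. \<forall>x\<in>UNIV. \<forall>x'\<in>UNIV. dist x' x < d \<longrightarrow> dist (f (x' + h)) (f (x + h)) < e"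
        by (intro exI[of _ d]) (auto simp: dist_real_def)
    qed
  qed (use B in auto)
qed

lemma UCb_Lipschitz:
  assumes "\<And>x. (F has_real_derivative f x) (at x)" and "\<And>x. \<bar>f x\<bar> \<le> L0" and "\<And>x. \<bar>F x\<bar> \<le> B"
  shows "F \<in> UCb"
proof (rule UCbI[OF assms(3)])
  define L where "L = \<bar>L0\<bar> + 1"
  have L: "L > 0" "\<bar>f x\<bar> \<le> L" for x using assms(2)[of x] by (auto simp: L_def)
  have lip: "\<bar>F y - F x\<bar> \<le> L * \<bar>y - x\<bar>" for x y
    using field_differentiable_bound[of UNIV F f L y x] assms(1) L by simp
  show "uniformly_continuous_on UNIV F"
    unfolding uniformly_continuous_on_def
  proof (intro allI impI)
    fix e :: real assume e: "e > 0"
    have "dist (F y) (F x) < e" if "dist y x < e / L" for x y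
      using lip[of y x] that L by (simp add: dist_real_def field_simps abs_minus_commute)
    then show "\<exists>d>0. \<forall>x\<in>UNIV. \<forall>x'\<in>UNIV. dist x' x < d \<longrightarrow> dist (F x') (F x) < e"
      using e L by (intro exI[of _ "e / L"]) auto
  qed
qed

definition cn :: "nat \<Rightarrow> (real \<Rightarrow> real) \<Rightarrow> real" where
  "cn k f = (\<Sum>j\<le>k. sup_norm ((deriv ^^ j) f))"

lemma cn_0 [simp]: "cn 0 f = sup_norm f"
  by (simp add: cn_def)

lemma cn_Suc: "cn (Suc k) f = sup_norm f + cn k (deriv f)"
  unfolding cn_def by (simp only: sum.atMost_Suc_shift funpow_Suc_right comp_apply funpow_0)

lemma cn_nonneg: "f \<in> UCb_n k \<Longrightarrow> 0 \<le> cn k f"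
  by (auto simp: cn_def UCb_n_alt intro!: sum_nonneg sup_norm_nonneg)

lemma cn_ge_sup_norm: "f \<in> UCb_n k \<Longrightarrow> j \<le> k \<Longrightarrow> sup_norm ((deriv ^^ j) f) \<le> cn k f"
  unfolding cn_def by (rule member_le_sum) (auto simp: UCb_n_alt intro: sup_norm_nonneg)

lemma cn_mono:
  assumes "f \<in> UCb_n m" "k \<le> m" shows "cn k f \<le> cn m f"
  unfolding cn_def by (rule sum_mono2) (use assms in \<open>auto simp: UCb_n_alt intro: sup_norm_nonneg\<close>)

lemma UCb_n_const: "(\<lambda>x. r) \<in> UCb_n k"
proof (induction k arbitrary: r)
  case (Suc k)
  show ?case by (rule UCb_n_SucI(1)[OF UCb_const DERIV_const Suc])
qed (simp add: UCb_const)

lemma UCb_n_add: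
  assumes "f \<in> UCb_n k" "g \<in> UCb_n k"
  shows "(\<lambda>x. f x + g x) \<in> UCb_n k \<and> cn k (\<lambda>x. f x + g x) \<le> cn k f + cn k g"
  using assms
proof (induction k arbitrary: f g)
  case 0
  have "sup_norm (\<lambda>x. f x + g x) \<le> sup_norm f + sup_norm g"
    by (rule sup_norm_le) (use 0 in \<open>auto intro: order_trans[OF abs_triangle_ineq] add_mono sup_norm_ge\<close>)
  with 0 show ?case by (simp add: UCb_add)
next
  case (Suc k)
  note f = Suc.prems(1)[unfolded UCb_n_Suc] and g = Suc.prems(2)[unfolded UCb_n_Suc]
  have IH: "(\<lambda>x. deriv f x + deriv g x) \<in> UCb_n k"
    "cn k (\<lambda>x. deriv f x + deriv g x) \<le> cn k (deriv f) + cn k (deriv g)"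
    using Suc.IH f g by blast+
  have d: "((\<lambda>x. f x + g x) has_real_derivative deriv f x + deriv g x) (at x)" for x
    using f g by (intro DERIV_add) auto
  have mem: "(\<lambda>x. f x + g x) \<in> UCb_n (Suc k)" and eq: "deriv (\<lambda>x. f x + g x) = (\<lambda>x. deriv f x + deriv g x)"
    using UCb_n_SucI[OF UCb_add d IH(1)] f g by auto
  have "sup_norm (\<lambda>x. f x + g x) \<le> sup_norm f + sup_norm g"
    by (rule sup_norm_le) (use f g in \<open>auto intro: order_trans[OF abs_triangle_ineq] add_mono sup_norm_ge\<close>)
  with IH(2) mem show ?case by (simp add: cn_Suc eq)
qed

text \<open>Leibniz' rule in recursive form. The factor \<open>2 ^ k\<close> survives the induction because
\<open>F0 G0 + F1 (G0 + G1) + G1 (F0 + F1)\<close> is \<open>(F0 + F1) (G0 + G1) + F1 G1\<close>.\<close>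

lemma UCb_n_mult:
  assumes "f \<in> UCb_n k" "g \<in> UCb_n k"
  shows "(\<lambda>x. f x * g x) \<in> UCb_n k \<and> cn k (\<lambda>x. f x * g x) \<le> 2 ^ k * cn k f * cn k g"
  using assms
proof (induction k arbitrary: f g)
  case 0
  have "sup_norm (\<lambda>x. f x * g x) \<le> sup_norm f * sup_norm g"
    by (rule sup_norm_le) (use 0 in \<open>auto simp: abs_mult intro!: mult_mono sup_norm_ge sup_norm_nonneg\<close>)
  with 0 show ?case by (simp add: UCb_mult)
next
  case (Suc k)
  note f = Suc.prems(1)[unfolded UCb_n_Suc] and g = Suc.prems(2)[unfolded UCb_n_Suc]
  have fk: "f \<in> UCb_n k" "g \<in> UCb_n k" using Suc.prems UCb_n_subset_Suc by auto
  let ?l = "\<lambda>x. deriv f x * g x" and ?r = "\<lambda>x. deriv g x * f x"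
  have l: "?l \<in> UCb_n k" "cn k ?l \<le> 2 ^ k * cn k (deriv f) * cn k g"
    using Suc.IH[of "deriv f" g] f fk by blast+
  have r: "?r \<in> UCb_n k" "cn k ?r \<le> 2 ^ k * cn k (deriv g) * cn k f"
    using Suc.IH[of "deriv g" f] g fk by blast+
  have lr: "(\<lambda>x. ?l x + ?r x) \<in> UCb_n k" "cn k (\<lambda>x. ?l x + ?r x) \<le> cn k ?l + cn k ?r"
    using UCb_n_add[OF l(1) r(1)] by auto
  have d: "((\<lambda>x. f x * g x) has_real_derivative ?l x + ?r x) (at x)" for x
    using f g by (intro DERIV_mult) auto
  have mem: "(\<lambda>x. f x * g x) \<in> UCb_n (Suc k)" and eq: "deriv (\<lambda>x. f x * g x) = (\<lambda>x. ?l x + ?r x)"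
    using UCb_n_SucI[OF UCb_mult d lr(1)] f g by auto
  define F0 F1 G0 G1 where "F0 = sup_norm f" and "F1 = cn k (deriv f)"
    and "G0 = sup_norm g" and "G1 = cn k (deriv g)"
  have nn: "0 \<le> F0" "0 \<le> F1" "0 \<le> G0" "0 \<le> G1"
    using f g by (auto simp: F0_def F1_def G0_def G1_def sup_norm_nonneg cn_nonneg)
  have le: "cn k f \<le> F0 + F1" "cn k g \<le> G0 + G1"
    using cn_mono[OF Suc.prems(1), of k] cn_mono[OF Suc.prems(2), of k]
    by (auto simp: cn_Suc F0_def F1_def G0_def G1_def)
  have "sup_norm (\<lambda>x. f x * g x) \<le> F0 * G0" unfolding F0_def G0_def
    by (rule sup_norm_le) (use f g in \<open>auto simp: abs_mult intro!: mult_mono sup_norm_ge sup_norm_nonneg\<close>)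
  also have "\<dots> \<le> 2 ^ k * (F0 * G0)" using mult_right_mono[of 1 "2 ^ k" "F0 * G0"] nn by simp
  finally have "cn (Suc k) (\<lambda>x. f x * g x) \<le> 2 ^ k * (F0 * G0) + (2 ^ k * F1 * cn k g + 2 ^ k * G1 * cn k f)"
    unfolding cn_Suc eq using lr(2) l(2) r(2) by (simp add: F1_def G1_def)
  also have "\<dots> \<le> 2 ^ k * (F0 * G0) + (2 ^ k * F1 * (G0 + G1) + 2 ^ k * G1 * (F0 + F1))"
    using nn le by (intro add_left_mono add_mono mult_left_mono) auto
  also have "\<dots> = 2 ^ k * ((F0 + F1) * (G0 + G1)) + 2 ^ k * (F1 * G1)" by (simp add: algebra_simps)
  also have "\<dots> \<le> 2 ^ k * ((F0 + F1) * (G0 + G1)) + 2 ^ k * ((F0 + F1) * (G0 + G1))"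
    using nn by (intro add_left_mono mult_left_mono mult_mono) auto
  finally show ?case using mem by (simp add: cn_Suc F0_def F1_def G0_def G1_def mult_ac)
qed

lemma UCb_n_cmult: "f \<in> UCb_n k \<Longrightarrow> (\<lambda>x. r * f x) \<in> UCb_n k"
  using UCb_n_mult[OF UCb_n_const] by blast

lemma sup_norm_uminus: "sup_norm (\<lambda>x. - f x) = sup_norm f"
  by (simp add: sup_norm_def)

lemma cn_uminus: "f \<in> UCb_n k \<Longrightarrow> cn k (\<lambda>x. - f x) = cn k f"
proof (induction k arbitrary: f)
  case (Suc k)
  then have "deriv (\<lambda>x. - f x) = (\<lambda>x. - deriv f x)"
    by (auto simp: UCb_n_Suc intro!: DERIV_imp_deriv DERIV_minus)
  with Suc show ?case by (simp add: cn_Suc sup_norm_uminus UCb_n_Suc)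
qed (simp add: sup_norm_uminus)

lemma UCb_n_diff:
  assumes "f \<in> UCb_n k" "g \<in> UCb_n k"
  shows "(\<lambda>x. f x - g x) \<in> UCb_n k \<and> cn k (\<lambda>x. f x - g x) \<le> cn k f + cn k g"
proof -
  have "(\<lambda>x. - g x) \<in> UCb_n k" using UCb_n_cmult[OF assms(2), of "-1"] by simp
  then show ?thesis using UCb_n_add[OF assms(1), of "\<lambda>x. - g x"] cn_uminus[OF assms(2)] by simp
qed

text \<open>The derivative \<open>- a' (1/a)\<^sup>2\<close> consists of factors that are in \<open>UCb_n k\<close> by induction.\<close>

lemma UCb_n_inverse:
  assumes "a \<in> UCb_n k" "a0 > 0" "\<And>x. a x \<ge> a0"
  shows "(\<lambda>x. 1 / a x) \<in> UCb_n k"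
  using assms
proof (induction k)
  case 0
  have pos: "a x > 0" for x using 0 less_le_trans by blast
  show ?case
    unfolding UCb_n_0
  proof (rule UCbI[of _ "1 / a0"])
    show "\<bar>1 / a x\<bar> \<le> 1 / a0" for x using 0 pos[of x] by (simp add: frac_le)
    show "uniformly_continuous_on UNIV (\<lambda>x. 1 / a x)"
      unfolding uniformly_continuous_on_def
    proof (intro allI impI)
      fix e :: real assume e: "e > 0"
      have "uniformly_continuous_on UNIV a" using 0 by (simp add: UCb_def)
      moreover have "e * (a0 * a0) > 0" using e 0 by simp
      ultimately obtain d where d: "d > 0" "\<And>x y. dist y x < d \<Longrightarrow> dist (a y) (a x) < e * (a0 * a0)"
        unfolding uniformly_continuous_on_def by (metis UNIV_I)
      have "dist (1 / a y) (1 / a x) < e" if "dist y x < d" for x y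
      proof -
        have "a0 * a0 \<le> a x * a y" using 0 pos by (intro mult_mono) (auto simp: less_imp_le)
        have "\<bar>1 / a y - 1 / a x\<bar> = \<bar>a y - a x\<bar> / (a x * a y)"
          using pos[of x] pos[of y] by (simp add: field_simps abs_minus_commute abs_mult)
        also have "\<dots> \<le> \<bar>a y - a x\<bar> / (a0 * a0)"
          using \<open>a0 * a0 \<le> a x * a y\<close> 0 pos[of x] pos[of y] by (intro divide_left_mono) auto
        also have "\<dots> < e" using d(2)[OF that] 0 by (simp add: dist_real_def field_simps)
        finally show ?thesis by (simp add: dist_real_def)
      qed
      with d(1) show "\<exists>d>0. \<forall>x\<in>UNIV. \<forall>x'\<in>UNIV. dist x' x < d \<longrightarrow> dist (1 / a x') (1 / a x) < e"
        by blast
    qed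
  qed
next
  case (Suc k)
  note a = Suc.prems(1)[unfolded UCb_n_Suc]
  have pos: "a x > 0" for x using Suc.prems less_le_trans by blast
  have IH: "(\<lambda>x. 1 / a x) \<in> UCb_n k" using Suc UCb_n_subset_Suc by blast
  have "(\<lambda>x. (-1 * deriv a x) * ((1 / a x) * (1 / a x))) \<in> UCb_n k"
    using a IH UCb_n_mult UCb_n_cmult by blast
  moreover have "((\<lambda>x. 1 / a x) has_real_derivative (-1 * deriv a x) * ((1 / a x) * (1 / a x))) (at x)" for x
    by (rule derivative_eq_intros a[THEN conjunct2, THEN conjunct1, rule_format] refl
        | use pos[of x] in \<open>simp add: field_simps\<close>)+
  ultimately show ?case using UCb_n_UCb[OF IH] by (intro UCb_n_SucI(1))
qed

text \<open>By the mean value theorem every interval of length \<open>e\<close> contains a point where \<open>\<bar>f'\<bar>\<close> is at most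
\<open>2 \<parallel>f\<parallel> / e\<close>; from there \<open>f'\<close> varies by at most \<open>e \<parallel>f''\<parallel>\<close>.\<close>

lemma sup_norm_deriv_interpolation:
  assumes f: "f \<in> UCb_n 2" and e: "e > 0"
  shows "sup_norm (deriv f) \<le> 2 / e * sup_norm f + e * sup_norm (deriv (deriv f))"
proof (rule sup_norm_le)
  fix x
  have d: "f \<in> UCb" "\<And>x. (f has_real_derivative deriv f x) (at x)"
    "deriv f \<in> UCb" "\<And>x. (deriv f has_real_derivative deriv (deriv f) x) (at x)" "deriv (deriv f) \<in> UCb"
    using f by (auto simp: numeral_2_eq_2 UCb_n_Suc)
  obtain z where z: "x < z" "z < x + e" "f (x + e) - f x = e * deriv f z"
    using MVT2[of x "x + e" f "deriv f"] d(2) e by auto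
  have "\<bar>e * deriv f z\<bar> \<le> 2 * sup_norm f"
    using sup_norm_ge[OF d(1), of "x + e"] sup_norm_ge[OF d(1), of x] z(3) by linarith
  then have 1: "\<bar>deriv f z\<bar> \<le> 2 / e * sup_norm f" using e by (simp add: abs_mult field_simps)
  have "\<bar>deriv f z - deriv f x\<bar> \<le> sup_norm (deriv (deriv f)) * \<bar>z - x\<bar>"
    using field_differentiable_bound[of UNIV "deriv f" "deriv (deriv f)" "sup_norm (deriv (deriv f))" z x]
      d(4) sup_norm_ge[OF d(5)] by simp
  also have "\<dots> \<le> sup_norm (deriv (deriv f)) * e"
    using z sup_norm_nonneg[OF d(5)] by (intro mult_left_mono) auto
  finally show "\<bar>deriv f x\<bar> \<le> 2 / e * sup_norm f + e * sup_norm (deriv (deriv f))"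
    using 1 by (simp add: mult.commute)
qed

section \<open>Smoothing by moving averages\<close>

lemma antiderivative_UNIV:
  assumes "continuous_on UNIV (f :: real \<Rightarrow> real)"
  obtains F where "\<And>x. (F has_real_derivative f x) (at x)"
proof -
  have "\<exists>F. \<forall>x :: real. (-\<infinity>::ereal) < ereal x \<longrightarrow> ereal x < \<infinity> \<longrightarrow> (F has_vector_derivative f x) (at x)"
    by (rule einterval_antiderivative) (use assms in \<open>auto simp: continuous_on_eq_continuous_at\<close>)
  then show ?thesis using that by (auto simp: has_real_derivative_iff_has_vector_derivative)
qed

text \<open>The average of \<open>f\<close> over \<open>[x, x + h]\<close> is \<open>(F (x + h) - F x) / h\<close> for an antiderivative \<open>F\<close>, and it has one
derivative more than \<open>f\<close>. By the mean value theorem its \<open>j\<close>-th derivative at \<open>x\<close> is the value of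
\<open>f^(j)\<close> at some point of the interval, hence close to \<open>f^(j) x\<close>. The induction on \<open>k\<close> works since
the derivative of the average of \<open>f\<close> is the average of \<open>f'\<close>.\<close>

lemma moving_average:
  assumes "f \<in> UCb_n k" and "\<And>x. (F has_real_derivative f x) (at x)" and h: "h > 0"
    and "\<And>j x y. j \<le> k \<Longrightarrow> \<bar>x - y\<bar> \<le> h \<Longrightarrow> \<bar>(deriv ^^ j) f x - (deriv ^^ j) f y\<bar> \<le> e"
  shows "(\<lambda>x. (F (x + h) - F x) / h) \<in> UCb_n (Suc k)"
    and "j \<le> k \<Longrightarrow> \<bar>(deriv ^^ j) (\<lambda>x. (F (x + h) - F x) / h) x - (deriv ^^ j) f x\<bar> \<le> e"
proof -
  have "(\<lambda>x. (F (x + h) - F x) / h) \<in> UCb_n (Suc k) \<and>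
    (\<forall>j\<le>k. \<forall>x. \<bar>(deriv ^^ j) (\<lambda>x. (F (x + h) - F x) / h) x - (deriv ^^ j) f x\<bar> \<le> e)"
    using assms(1,2,4)
  proof (induction k arbitrary: f F)
    have mean: "\<exists>z. x < z \<and> z < x + h \<and> (F (x + h) - F x) / h = f z"
      if "\<And>x. (F has_real_derivative f x) (at x)" for F f :: "real \<Rightarrow> real" and x
      using MVT2[of x "x + h" F f] that h by auto
    have close: "\<bar>(F (x + h) - F x) / h - f x\<bar> \<le> e"
      if "\<And>x. (F has_real_derivative f x) (at x)" "\<And>x y. \<bar>x - y\<bar> \<le> h \<Longrightarrow> \<bar>f x - f y\<bar> \<le> e" for F f x
    proof -
      note D = that(1)
      obtain z where "x < z" "z < x + h" "(F (x + h) - F x) / h = f z" using mean[OF D] by blast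
      then show ?thesis using that(2)[of z x] by simp
    qed
    have d: "((\<lambda>x. (F (x + h) - F x) / h) has_real_derivative (f (x + h) - f x) / h) (at x)"
      if "\<And>x. (F has_real_derivative f x) (at x)" for F f x
    proof -
      have "((\<lambda>x. F (x + h)) has_real_derivative f (x + h)) (at x)"
        using that[of "x + h"] by (simp add: DERIV_shift)
      then show ?thesis using that[of x] by (intro DERIV_cdivide DERIV_diff)
    qed
    have ucb: "(\<lambda>x. (F (x + h) - F x) / h) \<in> UCb"
      if "f \<in> UCb" "\<And>x. (F has_real_derivative f x) (at x)" for F f
    proof (rule UCb_Lipschitz[OF d[OF that(2)]])
      have "(\<lambda>x. (f (x + h) - f x) / h) \<in> UCb"
        using UCb_mult[OF UCb_const[of "1/h"] UCb_diff[OF UCb_shift[OF that(1)] that(1)]] by simp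
      then show "\<bar>(f (x + h) - f x) / h\<bar> \<le> sup_norm (\<lambda>x. (f (x + h) - f x) / h)" for x
        by (rule sup_norm_ge)
      fix x
      note D = that(2)
      obtain z where "(F (x + h) - F x) / h = f z" using mean[OF D] by blast
      then show "\<bar>(F (x + h) - F x) / h\<bar> \<le> sup_norm f" using sup_norm_ge[OF that(1), of z] by simp
    qed
    {
      case 0
      have "(\<lambda>x. (f (x + h) - f x) / h) \<in> UCb_n 0"
        using 0 UCb_mult[OF UCb_const[of "1/h"] UCb_diff[OF UCb_shift, of f f]] by simp
      then have "(\<lambda>x. (F (x + h) - F x) / h) \<in> UCb_n (Suc 0)"
        using UCb_n_SucI(1)[OF ucb[OF _ 0(2)] d[OF 0(2)]] 0 by simp
      moreover have "\<bar>(F (x + h) - F x) / h - f x\<bar> \<le> e" for x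
        using close[OF 0(2)] 0(3)[of 0] by simp
      ultimately show ?case by simp
    next
      case (Suc k)
      note f = Suc.prems(1)[unfolded UCb_n_Suc]
      have eqf: "(deriv ^^ Suc j) f = (deriv ^^ j) (deriv f)" for j and f :: "real \<Rightarrow> real"
        by (simp only: funpow_Suc_right comp_apply)
      have IH: "(\<lambda>x. (f (x + h) - f x) / h) \<in> UCb_n (Suc k) \<and>
        (\<forall>j\<le>k. \<forall>x. \<bar>(deriv ^^ j) (\<lambda>x. (f (x + h) - f x) / h) x - (deriv ^^ j) (deriv f) x\<bar> \<le> e)"
      proof (rule Suc.IH)
        fix j x y assume "j \<le> k" "\<bar>x - y\<bar> \<le> h"
        then show "\<bar>(deriv ^^ j) (deriv f) x - (deriv ^^ j) (deriv f) y\<bar> \<le> e"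
          using Suc.prems(3)[of "Suc j" x y] unfolding eqf by simp
      qed (use f in auto)
      have mem: "(\<lambda>x. (F (x + h) - F x) / h) \<in> UCb_n (Suc (Suc k))"
        and eq: "deriv (\<lambda>x. (F (x + h) - F x) / h) = (\<lambda>x. (f (x + h) - f x) / h)"
        using UCb_n_SucI[OF ucb[OF _ Suc.prems(2)] d[OF Suc.prems(2)]] IH f by auto
      have "\<bar>(deriv ^^ j) (\<lambda>x. (F (x + h) - F x) / h) x - (deriv ^^ j) f x\<bar> \<le> e" if "j \<le> Suc k" for j x
      proof (cases j)
        case 0
        then show ?thesis using close[OF Suc.prems(2)] Suc.prems(3)[of 0] by simp
      next
        case (Suc i)
        then show ?thesis using IH that unfolding Suc eqf eq by simp
      qed
      with mem show ?case by blast
    }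
  qed
  then show "(\<lambda>x. (F (x + h) - F x) / h) \<in> UCb_n (Suc k)"
    and "j \<le> k \<Longrightarrow> \<bar>(deriv ^^ j) (\<lambda>x. (F (x + h) - F x) / h) x - (deriv ^^ j) f x\<bar> \<le> e"
    by auto
qed

lemma UCb_oscillation:
  assumes "finite I" "\<And>i. i \<in> I \<Longrightarrow> g i \<in> UCb" "e > 0"
  shows "\<exists>d>0. \<forall>i\<in>I. \<forall>x y. \<bar>x - y\<bar> \<le> d \<longrightarrow> \<bar>g i x - g i y\<bar> \<le> e"
  using assms(1,2)
proof (induction rule: finite_induct)
  case empty
  show ?case by (auto intro: exI[of _ 1])
next
  case (insert i I)
  then obtain d where d: "d > 0" "\<And>i x y. i \<in> I \<Longrightarrow> \<bar>x - y\<bar> \<le> d \<Longrightarrow> \<bar>g i x - g i y\<bar> \<le> e"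
    by auto
  have "uniformly_continuous_on UNIV (g i)" using insert by (auto simp: UCb_def)
  then obtain d' where d': "d' > 0" "\<And>x y. dist y x < d' \<Longrightarrow> dist (g i y) (g i x) < e"
    using assms(3) unfolding uniformly_continuous_on_def by (metis UNIV_I)
  have "\<bar>g j x - g j y\<bar> \<le> e" if "j \<in> insert i I" "\<bar>x - y\<bar> \<le> min d (d' / 2)" for j x y
  proof (cases "j = i")
    case True
    have "dist x y < d'" using that d' by (simp add: dist_real_def)
    then show ?thesis using d'(2)[of x y] True by (simp add: dist_real_def)
  next
    case False
    then show ?thesis using d(2)[of j x y] that by auto
  qed
  then show ?case using d d' by (intro exI[of _ "min d (d' / 2)"]) auto
qed

lemma UCb_n_approx:
  assumes f: "f \<in> UCb_n k" and e: "e > 0"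
  obtains g where "g \<in> UCb_n (Suc k)" "\<And>j x. j \<le> k \<Longrightarrow> \<bar>(deriv ^^ j) g x - (deriv ^^ j) f x\<bar> \<le> e"
proof -
  have "continuous_on UNIV f" using UCb_n_UCb[OF f] by (simp add: UCb_def uniformly_continuous_imp_continuous)
  then obtain F where F: "\<And>x. (F has_real_derivative f x) (at x)" by (rule antiderivative_UNIV) blast
  obtain h where h: "h > 0" "\<And>j x y. j \<le> k \<Longrightarrow> \<bar>x - y\<bar> \<le> h \<Longrightarrow> \<bar>(deriv ^^ j) f x - (deriv ^^ j) f y\<bar> \<le> e"
    using UCb_oscillation[of "{..k}" "\<lambda>j. (deriv ^^ j) f" e] f e by (auto simp: UCb_n_alt)
  show ?thesis
  proof (rule that)
    show "(\<lambda>x. (F (x + h) - F x) / h) \<in> UCb_n (Suc k)" by (rule moving_average(1)[OF f F h])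
    show "j \<le> k \<Longrightarrow> \<bar>(deriv ^^ j) (\<lambda>x. (F (x + h) - F x) / h) x - (deriv ^^ j) f x\<bar> \<le> e" for j x
      by (rule moving_average(2)[OF f F h])
  qed
qed

text \<open>A bounded derivative makes a function Lipschitz, that is, Hoelder continuous with exponent \<open>1\<close>.\<close>

lemma UCb_n_Suc_HCb:
  assumes "f \<in> UCb_n (Suc k)" shows "f \<in> HCb k"
proof -
  have der: "times_differentiable (Suc k) f" "\<And>j. j \<le> Suc k \<Longrightarrow> (deriv ^^ j) f \<in> UCb"
    using assms by (auto simp: UCb_n_alt)
  have "Hoelder_continuous ((deriv ^^ j) f)" if j: "j \<le> k" for j
  proof -
    let ?g = "(deriv ^^ j) f"
    have d: "(?g has_real_derivative deriv ?g x) (at x)" for x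
      using der(1) j by (auto simp: times_differentiable_def DERIV_deriv_iff_field_differentiable)
    have u: "deriv ?g \<in> UCb" using der(2)[of "Suc j"] j by simp
    have "\<bar>?g x - ?g y\<bar> \<le> sup_norm (deriv ?g) * \<bar>x - y\<bar>" for x y
      using field_differentiable_bound[of UNIV ?g "deriv ?g" "sup_norm (deriv ?g)" x y]
        d sup_norm_ge[OF u] by simp
    then show ?thesis
      unfolding Hoelder_continuous_def
      by (intro exI[of _ "sup_norm (deriv ?g)"] conjI sup_norm_nonneg[OF u] bexI[of _ 1]) auto
  qed
  moreover have "times_differentiable k f" using der(1) by (auto simp: times_differentiable_def)
  ultimately show ?thesis using der(2) by (auto simp: HCb_def UCb_def)
qed

section \<open>The differential operator\<close>

abbreviation C2 :: "ucb \<Rightarrow> bool" where "C2 u \<equiv> ucb_apply u \<in> UCb_n 2"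

lemma funpow_2: "(f ^^ 2) x = f (f x)" by (simp add: numeral_2_eq_2)

lemma UCb_n_2:
  "f \<in> UCb_n 2 \<longleftrightarrow> f \<in> UCb \<and> (\<forall>x. (f has_real_derivative deriv f x) (at x)) \<and>
    deriv f \<in> UCb \<and> (\<forall>x. (deriv f has_real_derivative deriv (deriv f) x) (at x)) \<and> deriv (deriv f) \<in> UCb"
  by (simp add: numeral_2_eq_2 UCb_n_Suc)

lemma cn_2: "cn 2 f = sup_norm f + (sup_norm (deriv f) + sup_norm (deriv (deriv f)))"
  by (simp add: numeral_2_eq_2 cn_Suc)

lemma norm_le_cn: "ucb_apply u \<in> UCb_n k \<Longrightarrow> norm u \<le> cn k u"
  using cn_ge_sup_norm[of u k 0] by (simp add: norm_ucb_def)

lemma abs_deriv_le_cn: "f \<in> UCb_n k \<Longrightarrow> j \<le> k \<Longrightarrow> \<bar>(deriv ^^ j) f x\<bar> \<le> cn k f"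
  using sup_norm_ge[of "(deriv ^^ j) f" x] cn_ge_sup_norm[of f k j] by (auto simp: UCb_n_alt)

lemma C2_lincomb:
  assumes u: "C2 u" and v: "C2 v"
  shows "C2 (r *\<^sub>R u + s *\<^sub>R v)"
    and "H_op a b c (r *\<^sub>R u + s *\<^sub>R v) = r *\<^sub>R H_op a b c u + s *\<^sub>R H_op a b c v"
proof -
  let ?w = "r *\<^sub>R u + s *\<^sub>R v"
  have w: "ucb_apply ?w = (\<lambda>x. r * u x + s * v x)" by (auto simp: plus_ucb.rep_eq scaleR_ucb.rep_eq)
  note u' = u[unfolded UCb_n_2] and v' = v[unfolded UCb_n_2]
  have 1: "deriv (\<lambda>x. r * u x + s * v x) = (\<lambda>x. r * deriv u x + s * deriv v x)"
    using u' v' by (intro ext DERIV_imp_deriv DERIV_add DERIV_cmult) auto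
  have 2: "deriv (\<lambda>x. r * deriv u x + s * deriv v x) = (\<lambda>x. r * deriv (deriv u) x + s * deriv (deriv v) x)"
    using u' v' by (intro ext DERIV_imp_deriv DERIV_add DERIV_cmult) auto
  show "C2 ?w" unfolding w using UCb_n_add[OF UCb_n_cmult[OF u] UCb_n_cmult[OF v]] by blast
  show "H_op a b c ?w = r *\<^sub>R H_op a b c u + s *\<^sub>R H_op a b c v"
    by (rule ucb_eqI)
      (simp add: plus_ucb.rep_eq scaleR_ucb.rep_eq H_op_apply[OF \<open>C2 ?w\<close>] H_op_apply[OF u]
        H_op_apply[OF v] H_fun_def w 1 2 funpow_2 algebra_simps)
qed

lemma C2_diff:
  assumes u: "C2 u" and v: "C2 v"
  shows "C2 (u - v)" and "H_op a b c (u - v) = H_op a b c u - H_op a b c v"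
  using C2_lincomb[OF u v, where r = 1 and s = "-1"] by simp_all

lemma C2_zero: "C2 0" and H_op_zero: "H_op a b c 0 = 0"
proof -
  have "ucb_apply 0 = (\<lambda>x. 0)" by (simp add: zero_ucb.rep_eq)
  then show z: "C2 0" using UCb_n_const[of 0 2] by simp
  show "H_op a b c 0 = 0" using C2_lincomb(2)[OF z z, where r = 0 and s = 0] by simp
qed

lemma norm_H_op_le:
  assumes u: "C2 u" shows "norm (H_op a b c u) \<le> (norm a + norm b + norm c) * cn 2 u"
proof (rule ucb_norm_le)
  fix x
  have d: "\<bar>(deriv ^^ 2) u x\<bar> \<le> cn 2 u" "\<bar>deriv u x\<bar> \<le> cn 2 u" "\<bar>u x\<bar> \<le> cn 2 u"
    using abs_deriv_le_cn[OF u, of 2] abs_deriv_le_cn[OF u, of 1] abs_deriv_le_cn[OF u, of 0] by auto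
  have "\<bar>H_fun a b c u x\<bar> \<le> \<bar>a x * (deriv ^^ 2) u x\<bar> + \<bar>b x * deriv u x\<bar> + \<bar>c x * u x\<bar>"
    unfolding H_fun_def by linarith
  also have "\<dots> \<le> norm a * cn 2 u + norm b * cn 2 u + norm c * cn 2 u"
    unfolding abs_mult by (intro add_mono mult_mono d ucb_apply_le_norm) auto
  finally show "\<bar>H_op a b c u x\<bar> \<le> (norm a + norm b + norm c) * cn 2 u"
    by (simp add: H_op_apply[OF u] algebra_simps)
qed

text \<open>In one dimension the equation can be solved for the second derivative,
\<open>u'' = (H u - b u' - c u) / a\<close>, and the choice of \<open>e\<close> makes the interpolation
inequality absorb half of \<open>a0 \<parallel>u''\<parallel>\<close>. The constant depends on the coefficients only through
\<open>a0\<close>, \<open>B\<close> and \<open>C\<close>; the method of continuity needs such a uniform constant.\<close>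

lemma elliptic_estimate:
  fixes a b c :: ucb
  assumes u: "C2 u" and a: "\<And>x. a x \<ge> a0" and a0: "a0 > 0"
    and b: "norm b \<le> B" and c: "norm c \<le> C" and e: "e = a0 / (2 * (B + 1))"
  shows "cn 2 u \<le> (1 + 2 / e + (1 + e) * (2 / a0 * (1 + 2 * B / e + C))) * (norm u + norm (H_op a b c u))"
proof -
  have BC: "0 \<le> B" "0 \<le> C" using b c norm_ge_zero order_trans by blast+
  have e0: "e > 0" using a0 BC unfolding e by simp
  note u' = u[unfolded UCb_n_2]
  define U U1 U2 X where "U = norm u" and "U1 = sup_norm (deriv u)" and "U2 = sup_norm (deriv (deriv u))"
    and "X = norm (H_op a b c u)"
  have nn: "0 \<le> U" "0 \<le> U1" "0 \<le> U2" "0 \<le> X"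
    using u' by (auto simp: U_def U1_def U2_def X_def sup_norm_nonneg)
  have U: "U = sup_norm u" by (simp add: U_def norm_ucb_def)
  have i: "U1 \<le> 2 / e * U + e * U2"
    unfolding U U1_def U2_def by (rule sup_norm_deriv_interpolation[OF u e0])
  have Be: "B * e \<le> a0 / 2"
  proof -
    have "B * a0 \<le> (B + 1) * a0" using a0 by simp
    then show ?thesis using BC unfolding e by (simp add: field_simps)
  qed
  have "a0 * U2 \<le> X + B * U1 + C * U"
  proof -
    have "U2 \<le> (X + B * U1 + C * U) / a0"
      unfolding U2_def
    proof (rule sup_norm_le)
      fix x
      have "a0 * \<bar>deriv (deriv u) x\<bar> \<le> \<bar>a x * deriv (deriv u) x\<bar>"
        using a[of x] a0 by (simp add: abs_mult mult_right_mono)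
      also have "a x * deriv (deriv u) x = H_op a b c u x - b x * deriv u x - c x * u x"
        by (simp add: H_op_apply[OF u] H_fun_def funpow_2)
      also have "\<bar>\<dots>\<bar> \<le> \<bar>H_op a b c u x\<bar> + \<bar>b x\<bar> * \<bar>deriv u x\<bar> + \<bar>c x\<bar> * \<bar>u x\<bar>"
        unfolding abs_mult[symmetric] by linarith
      also have "\<dots> \<le> X + B * U1 + C * U"
        using u' nn BC unfolding X_def U_def U1_def
        by (intro add_mono mult_mono ucb_apply_le_norm sup_norm_ge
            order_trans[OF ucb_apply_le_norm b] order_trans[OF ucb_apply_le_norm c]) auto
      finally show "\<bar>deriv (deriv u) x\<bar> \<le> (X + B * U1 + C * U) / a0"
        using a0 by (simp add: field_simps)
    qed
    then show ?thesis using a0 by (simp add: field_simps)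
  qed
  also have "B * U1 \<le> B * (2 / e * U + e * U2)" using i BC by (intro mult_left_mono)
  also have "\<dots> = 2 * B / e * U + (B * e) * U2" by (simp add: algebra_simps)
  also have "(B * e) * U2 \<le> a0 / 2 * U2" using Be nn by (intro mult_right_mono)
  finally have "a0 / 2 * U2 \<le> X + (2 * B / e + C) * U" unfolding distrib_right by linarith
  then have "U2 \<le> 2 / a0 * (X + (2 * B / e + C) * U)" using a0 by (simp add: field_simps)
  also have "\<dots> \<le> 2 / a0 * ((1 + 2 * B / e + C) * (U + X))"
  proof (intro mult_left_mono)
    have "0 \<le> (2 * B / e + C) * X" using nn BC e0 by (intro mult_nonneg_nonneg add_nonneg_nonneg) auto
    then show "X + (2 * B / e + C) * U \<le> (1 + 2 * B / e + C) * (U + X)"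
      using nn by (simp add: distrib_right distrib_left)
  qed (use a0 in auto)
  finally have U2: "U2 \<le> 2 / a0 * (1 + 2 * B / e + C) * (U + X)" by (simp only: mult.assoc)
  have "cn 2 u = U + (U1 + U2)" by (simp add: cn_2 U U1_def U2_def)
  also have "\<dots> \<le> (1 + 2 / e) * U + (1 + e) * U2" using i by (simp add: algebra_simps)
  also have "\<dots> \<le> (1 + 2 / e) * (U + X) + (1 + e) * (2 / a0 * (1 + 2 * B / e + C) * (U + X))"
    using U2 nn e0 by (intro add_mono mult_left_mono) auto
  also have "\<dots> = (1 + 2 / e + (1 + e) * (2 / a0 * (1 + 2 * B / e + C))) * (U + X)"
  proof -
    have "p * W + q * (K * W) = (p + q * K) * W" for p q K W :: real by (simp add: algebra_simps)
    then show ?thesis by (simp only:)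
  qed
  finally show ?thesis by (simp only: U_def X_def)
qed

section \<open>Taylor expansion of the approximating operators\<close>

text \<open>The mean of \<open>(s y + \<beta>)^k\<close> over \<open>[-1,1]\<close> is \<open>\<beta>\<close>, \<open>s\<^sup>2/3 + \<beta>\<^sup>2\<close> and
\<open>s\<^sup>2 \<beta> + \<beta>\<^sup>3\<close> for \<open>k = 1, 2, 3\<close>. Taking \<open>u3 = 0\<close> covers quadratic approximations.\<close>

lemma average_taylor:
  fixes u :: "real \<Rightarrow> real"
  assumes u: "continuous_on UNIV u"
    and R: "\<And>h y. \<bar>y\<bar> \<le> 1 \<Longrightarrow> h = s * y + \<beta> \<Longrightarrow>
      \<bar>u (x + h) - (u0 + u1 * h + u2 * h\<^sup>2 / 2 + u3 * h ^ 3 / 6)\<bar> \<le> R"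
  shows "\<bar>1/2 * integral {-1..1} (\<lambda>y. u (x + s * y + \<beta>))
      - (u0 + u1 * \<beta> + u2 * (s\<^sup>2 / 3 + \<beta>\<^sup>2) / 2 + u3 * (s\<^sup>2 * \<beta> + \<beta> ^ 3) / 6)\<bar> \<le> R"
proof -
  define k0 k1 k2 k3 where "k0 = u0 + u1 * \<beta> + u2 * \<beta>\<^sup>2 / 2 + u3 * \<beta> ^ 3 / 6"
    and "k1 = u1 * s + u2 * (s * \<beta>) + u3 * (s * \<beta>\<^sup>2) / 2"
    and "k2 = u2 * s\<^sup>2 / 2 + u3 * (s\<^sup>2 * \<beta>) / 2" and "k3 = u3 * s ^ 3 / 6"
  define P where "P y = k0 + k1 * y + k2 * y\<^sup>2 + k3 * y ^ 3" for y
  have P: "P y = u0 + u1 * (s * y + \<beta>) + u2 * (s * y + \<beta>)\<^sup>2 / 2 + u3 * (s * y + \<beta>) ^ 3 / 6" for y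
    unfolding P_def k0_def k1_def k2_def k3_def
    by (simp add: power2_eq_square power3_eq_cube algebra_simps add_divide_distrib)
  define Q where "Q y = k0 * y + k1 / 2 * y\<^sup>2 + k2 / 3 * y ^ 3 + k3 / 4 * y ^ 4" for y
  have dQ: "(Q has_real_derivative P y) (at y within S)" for y S
    unfolding Q_def P_def by (auto intro!: derivative_eq_intros)
  have "(P has_integral (Q 1 - Q (-1))) {-1..1}"
    by (rule fundamental_theorem_of_calculus)
      (auto simp: has_real_derivative_iff_has_vector_derivative[symmetric] dQ)
  then have iP: "integral {-1..1} P = Q 1 - Q (-1)" "P integrable_on {-1..1}" by (auto simp: integral_unique has_integral_integrable)
  have cu: "continuous_on {-1..1} (\<lambda>y. u (x + s * y + \<beta>))"
    by (rule continuous_on_compose2[OF u]) (auto intro!: continuous_intros)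
  have "integral {-1..1} (\<lambda>y. u (x + s * y + \<beta>) - P y)
      = integral {-1..1} (\<lambda>y. u (x + s * y + \<beta>)) - (Q 1 - Q (-1))"
    unfolding iP(1)[symmetric] by (rule integral_diff) (use iP integrable_continuous_real[OF cu] in auto)
  moreover have "norm (integral {-1..1} (\<lambda>y. u (x + s * y + \<beta>) - P y)) \<le> R * (1 - (-1))"
  proof (rule integral_bound)
    show "continuous_on {-1..1} (\<lambda>y. u (x + s * y + \<beta>) - P y)"
      unfolding P_def by (intro continuous_intros cu)
    show "norm (u (x + s * y + \<beta>) - P y) \<le> R" if "y \<in> {-1..1}" for y
      using R[of y "s * y + \<beta>"] that by (simp add: P add.assoc abs_le_iff[of y])
  qed simp
  ultimately have "\<bar>integral {-1..1} (\<lambda>y. u (x + s * y + \<beta>)) - (Q 1 - Q (-1))\<bar> \<le> R * 2" by simp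
  moreover have "Q 1 - Q (-1)
      = 2 * (u0 + u1 * \<beta> + u2 * (s\<^sup>2 / 3 + \<beta>\<^sup>2) / 2 + u3 * (s\<^sup>2 * \<beta> + \<beta> ^ 3) / 6)"
    by (simp add: Q_def k0_def k2_def algebra_simps add_divide_distrib)
  moreover have "\<bar>1/2 * I - Z\<bar> \<le> R" if "\<bar>I - q\<bar> \<le> R * 2" "q = 2 * Z" for I Z q :: real
    using that by (auto simp: abs_le_iff)
  ultimately show ?thesis by blast
qed

lemma UCb_n_taylor:
  assumes u: "u \<in> UCb_n n"
  shows "\<exists>t. \<bar>t\<bar> \<le> \<bar>h\<bar> \<and> u (x + h) =
    (\<Sum>m<n. (deriv ^^ m) u x / fact m * h ^ m) + (deriv ^^ n) u (x + t) / fact n * h ^ n"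
proof -
  have "\<forall>m t. m < n \<and> \<bar>t\<bar> \<le> \<bar>h\<bar> \<longrightarrow>
      DERIV (\<lambda>h. (deriv ^^ m) u (x + h)) t :> (deriv ^^ Suc m) u (x + t)"
  proof (intro allI impI)
    fix m t assume "m < n \<and> \<bar>t\<bar> \<le> \<bar>h\<bar>"
    then have "((deriv ^^ m) u has_real_derivative (deriv ^^ Suc m) u (x + t)) (at (x + t))"
      using u by (auto simp: UCb_n_alt times_differentiable_def DERIV_deriv_iff_field_differentiable)
    then show "DERIV (\<lambda>h. (deriv ^^ m) u (x + h)) t :> (deriv ^^ Suc m) u (x + t)"
      by (simp add: DERIV_shift add.commute[of x])
  qed
  from Maclaurin_bi_le[of "\<lambda>m h. (deriv ^^ m) u (x + h)" "\<lambda>h. u (x + h)", OF _ this]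
  show ?thesis by simp
qed

lemma ucb_continuous: "continuous_on UNIV (ucb_apply f)"
  using ucb_apply[of f] by (simp add: UCb_def uniformly_continuous_imp_continuous)

lemma uniformly_continuous_on_mono:
  fixes f :: "'a::metric_space \<Rightarrow> 'b::metric_space"
  shows "uniformly_continuous_on A f \<Longrightarrow> B \<subseteq> A \<Longrightarrow> uniformly_continuous_on B f"
  unfolding uniformly_continuous_on_def
proof (intro allI impI)
  fix e :: real
  assume *: "\<forall>e>0. \<exists>d>0. \<forall>x\<in>A. \<forall>x'\<in>A. dist x' x < d \<longrightarrow> dist (f x') (f x) < e" "B \<subseteq> A" "0 < e"
  then obtain d where "d > 0" "\<forall>x\<in>A. \<forall>x'\<in>A. dist x' x < d \<longrightarrow> dist (f x') (f x) < e" by blast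
  with *(2) show "\<exists>d>0. \<forall>x\<in>B. \<forall>x'\<in>B. dist x' x < d \<longrightarrow> dist (f x') (f x) < e" by blast
qed

locale elliptic =
  fixes a b c :: ucb and a0 :: real
  assumes a0: "a0 > 0" and a_ge: "\<And>x. a x \<ge> a0"
begin

abbreviation "H \<equiv> H_op a b c"
abbreviation "S \<equiv> S_op a b c"

text \<open>For \<open>t \<le> 1\<close> the argument of \<open>f\<close> in \<open>S(t) f x\<close> is at distance at most \<open>step_const * sqrt t\<close> from \<open>x\<close>.\<close>

definition step_const :: real where "step_const = sqrt (6 * norm a) + norm b"

lemma a_nonneg: "0 \<le> a x" using a_ge[of x] a0 by linarith

lemma a_le: "a x \<le> norm a" using ucb_apply_le_norm[of a x] by linarith

lemma sqrt_coeff_UCb: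
  assumes t: "t \<ge> 0" shows "(\<lambda>x. sqrt (6 * a x * t)) \<in> UCb"
proof -
  have in_UCb: "(\<lambda>x. 6 * a x * t) \<in> UCb"
    using UCb_mult[OF UCb_const[of "6 * t"] ucb_apply[of a]] by (simp add: mult_ac)
  have rng: "6 * a x * t \<in> {0..6 * norm a * t}" for x
    using a_nonneg[of x] a_le[of x] t by (auto intro!: mult_right_mono)
  show ?thesis
  proof (rule UCbI[of _ "sqrt (6 * norm a * t)"])
    show "\<bar>sqrt (6 * a x * t)\<bar> \<le> sqrt (6 * norm a * t)" for x
      using rng[of x] by (simp add: abs_of_nonneg)
    show "uniformly_continuous_on UNIV (\<lambda>x. sqrt (6 * a x * t))"
    proof (rule uniformly_continuous_on_compose[of UNIV "\<lambda>x. 6 * a x * t" sqrt, unfolded o_def])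
      show "uniformly_continuous_on UNIV (\<lambda>x. 6 * a x * t)" using in_UCb by (simp add: UCb_def)
      have "uniformly_continuous_on {0..6 * norm a * t} sqrt"
        by (intro compact_uniformly_continuous continuous_intros) simp
      then show "uniformly_continuous_on (range (\<lambda>x. 6 * a x * t)) sqrt"
        by (rule uniformly_continuous_on_mono) (use rng in blast)
    qed
  qed
qed

lemma integrand_continuous:
  fixes f :: "real \<Rightarrow> real" and s r x :: real
  assumes "continuous_on UNIV f"
  shows "continuous_on {-1..1} (\<lambda>y. f (x + s * y + r))"
  by (rule continuous_on_compose2[OF assms]) (auto intro!: continuous_intros)

lemma S_fun_eq:
  "S_fun a b c t f x =
    (1 + c x * t) * (1/2 * integral {-1..1} (\<lambda>y. f (x + sqrt (6 * a x * t) * y + b x * t)))"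
  unfolding S_fun_def by (simp only: integral_mult_right mult_ac)

lemma average_abs_le:
  fixes f :: "real \<Rightarrow> real"
  assumes "continuous_on UNIV f" "\<And>x. \<bar>f x\<bar> \<le> B"
  shows "\<bar>1/2 * integral {-1..1} (\<lambda>y. f (x + s * y + r))\<bar> \<le> B"
proof -
  have "norm (integral {-1..1} (\<lambda>y. f (x + s * y + r))) \<le> B * (1 - (-1))"
    by (rule integral_bound[OF _ integrand_continuous[OF assms(1)]]) (use assms in auto)
  then show ?thesis by (simp add: abs_mult)
qed

text \<open>The point at which \<open>f\<close> is evaluated depends uniformly continuously on \<open>x\<close>, uniformly in \<open>y\<close>; for the square
root this holds because it is uniformly continuous on the compact range of \<open>6 a t\<close>.\<close>

lemma S_fun_UCb:
  assumes t: "t \<ge> 0" and f: "f \<in> UCb" shows "S_fun a b c t f \<in> UCb"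
proof -
  define s where "s x = sqrt (6 * a x * t)" for x
  define g where "g x = 1/2 * integral {-1..1} (\<lambda>y. f (x + s x * y + b x * t))" for x
  have s: "s \<in> UCb" unfolding s_def using sqrt_coeff_UCb[OF t] .
  have bt: "(\<lambda>x. b x * t) \<in> UCb" by (rule UCb_mult[OF ucb_apply UCb_const])
  have fc: "continuous_on UNIV f" using f by (simp add: UCb_def uniformly_continuous_imp_continuous)
  have "g \<in> UCb"
  proof (rule UCbI[of _ "sup_norm f"])
    show "\<bar>g x\<bar> \<le> sup_norm f" for x
      unfolding g_def by (rule average_abs_le[OF fc sup_norm_ge[OF f]])
    show "uniformly_continuous_on UNIV g"
      unfolding uniformly_continuous_on_def
    proof (intro allI impI)
      fix e :: real assume e: "e > 0"
      obtain d where d: "d > 0" "\<And>x y. \<bar>x - y\<bar> \<le> d \<Longrightarrow> \<bar>f x - f y\<bar> \<le> e / 2"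
        using UCb_oscillation[of "{f}" "\<lambda>f. f" "e/2"] f e by auto
      obtain d1 where d1: "d1 > 0" "\<And>x y. \<bar>x - y\<bar> \<le> d1 \<Longrightarrow> \<bar>s x - s y\<bar> \<le> d / 3"
        using UCb_oscillation[of "{s}" "\<lambda>f. f" "d/3"] s d by auto
      obtain d2 where d2: "d2 > 0" "\<And>x y. \<bar>x - y\<bar> \<le> d2 \<Longrightarrow> \<bar>b x * t - b y * t\<bar> \<le> d / 3"
        using UCb_oscillation[of "{\<lambda>x. b x * t}" "\<lambda>f. f" "d/3"] bt d by auto
      define \<delta> where "\<delta> = min (d / 3) (min d1 d2)"
      have "\<bar>g x' - g x\<bar> < e" if xx: "\<bar>x' - x\<bar> < \<delta>" for x x'
      proof -
        let ?F = "\<lambda>x y. f (x + s x * y + b x * t)"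
        have c: "continuous_on {-1..1} (?F x)" for x by (rule integrand_continuous[OF fc])
        have "norm (integral {-1..1} (\<lambda>y. ?F x' y - ?F x y)) \<le> e / 2 * (1 - (-1))"
        proof (rule integral_bound)
          show "continuous_on {-1..1} (\<lambda>y. ?F x' y - ?F x y)" by (intro continuous_intros c)
          fix y :: real assume y: "y \<in> {-1..1}"
          have "\<bar>(s x' - s x) * y\<bar> \<le> d / 3 * 1"
            unfolding abs_mult using y d1(2)[of x' x] xx d by (intro mult_mono) (auto simp: \<delta>_def)
          moreover have "\<bar>b x' * t - b x * t\<bar> \<le> d / 3" using d2(2)[of x' x] xx by (auto simp: \<delta>_def)
          moreover have "\<bar>x' - x\<bar> \<le> d / 3" using xx by (auto simp: \<delta>_def)
          moreover have "(s x' - s x) * y = s x' * y - s x * y" by (simp add: algebra_simps)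
          ultimately have "\<bar>(x' + s x' * y + b x' * t) - (x + s x * y + b x * t)\<bar> \<le> d" by linarith
          then show "norm (?F x' y - ?F x y) \<le> e / 2" using d(2) by simp
        qed simp
        moreover have "integral {-1..1} (\<lambda>y. ?F x' y - ?F x y) = integral {-1..1} (?F x') - integral {-1..1} (?F x)"
          by (intro integral_diff integrable_continuous_real c)
        ultimately have "\<bar>integral {-1..1} (?F x') - integral {-1..1} (?F x)\<bar> \<le> e" by simp
        moreover have "g x' - g x = 1/2 * (integral {-1..1} (?F x') - integral {-1..1} (?F x))"
          by (simp add: g_def algebra_simps)
        ultimately show ?thesis using e by (simp add: abs_mult)
      qed
      moreover have "\<delta> > 0" using d d1 d2 by (simp add: \<delta>_def)
      ultimately show "\<exists>d>0. \<forall>x\<in>UNIV. \<forall>x'\<in>UNIV. dist x' x < d \<longrightarrow> dist (g x') (g x) < e"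
        by (auto simp: dist_real_def)
    qed
  qed
  then have "(\<lambda>x. (1 + c x * t) * g x) \<in> UCb"
    by (intro UCb_mult UCb_add UCb_const ucb_apply)
  moreover have "S_fun a b c t f = (\<lambda>x. (1 + c x * t) * g x)"
    by (rule ext) (simp only: S_fun_eq g_def s_def)
  ultimately show ?thesis by simp
qed

lemma S_map_apply: "t \<ge> 0 \<Longrightarrow> ucb_apply (S_map a b c t f) = S_fun a b c t f"
  unfolding S_map_def by (simp add: Abs_ucb_inverse S_fun_UCb ucb_apply)

lemma norm_S_map_le:
  assumes t: "t \<ge> 0" and K: "\<And>x. \<bar>1 + c x * t\<bar> \<le> K"
  shows "norm (S_map a b c t f) \<le> K * norm f"
proof (rule ucb_norm_le)
  fix x
  have "\<bar>S_fun a b c t f x\<bar> \<le> K * norm f"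
    unfolding S_fun_eq abs_mult[of "1 + c x * t"]
    by (intro mult_mono K average_abs_le[OF ucb_continuous ucb_apply_le_norm] order_trans[OF abs_ge_zero K]) auto
  then show "\<bar>S_map a b c t f x\<bar> \<le> K * norm f" by (simp add: S_map_apply[OF t])
qed

lemma abs_one_plus_ct_le: "t \<ge> 0 \<Longrightarrow> \<bar>1 + c x * t\<bar> \<le> 1 + norm c * t"
proof -
  assume t: "t \<ge> 0"
  have "\<bar>c x * t\<bar> \<le> norm c * t" unfolding abs_mult using t ucb_apply_le_norm by (intro mult_mono) auto
  then show ?thesis by linarith
qed

lemma bounded_linear_S_map:
  assumes t: "t \<ge> 0" shows "bounded_linear (S_map a b c t)"
proof (rule bounded_linear_intro)
  fix f g :: ucb and r :: real
  let ?A = "\<lambda>f x. integral {-1..1} (\<lambda>y. f (x + sqrt (6 * a x * t) * y + b x * t))"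
  have int: "(\<lambda>y. ucb_apply f (x + sqrt (6 * a x * t) * y + b x * t)) integrable_on {-1..1}" for f x
    by (intro integrable_continuous_real integrand_continuous ucb_continuous)
  show "S_map a b c t (f + g) = S_map a b c t f + S_map a b c t g"
  proof (rule ucb_eqI)
    fix x
    have "?A (f + g) x = ?A f x + ?A g x"
      unfolding plus_ucb.rep_eq by (rule integral_add[OF int int])
    then show "S_map a b c t (f + g) x = (S_map a b c t f + S_map a b c t g) x"
      unfolding plus_ucb.rep_eq[of "S_map a b c t f"] S_map_apply[OF t] S_fun_eq
      by (simp only: distrib_left)
  qed
  show "S_map a b c t (r *\<^sub>R f) = r *\<^sub>R S_map a b c t f"
    by (rule ucb_eqI) (simp add: S_map_apply[OF t] scaleR_ucb.rep_eq S_fun_eq)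
  show "norm (S_map a b c t f) \<le> norm f * (1 + norm c * t)"
    using norm_S_map_le[OF t abs_one_plus_ct_le[OF t]] by (simp add: mult.commute)
qed

lemma S_apply: "t \<ge> 0 \<Longrightarrow> ucb_apply (S t f) = S_fun a b c t f"
  by (simp add: S_op_def bounded_linear_Blinfun_apply bounded_linear_S_map S_map_apply)

lemma norm_S_le: "t \<ge> 0 \<Longrightarrow> (\<And>x. \<bar>1 + c x * t\<bar> \<le> K) \<Longrightarrow> norm (S t) \<le> K"
  using norm_S_map_le[of t K] order_trans[OF abs_ge_zero, of "1 + c 0 * t" K]
  by (intro norm_blinfun_bound)
    (auto simp: S_op_def bounded_linear_Blinfun_apply bounded_linear_S_map)

lemma norm_S_exp_le: assumes "t \<ge> 0" shows "norm (S t) \<le> exp (norm c * t)"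
proof -
  have "norm (S t) \<le> 1 + norm c * t" by (rule norm_S_le[OF assms abs_one_plus_ct_le[OF assms]])
  also have "\<dots> \<le> exp (norm c * t)" by (rule exp_ge_add_one_self)
  finally show ?thesis .
qed

text \<open>While \<open>\<parallel>c\<parallel> t \<le> 1\<close>, the factor \<open>1 + c t\<close> is nonnegative, so its modulus is at most \<open>1 + \<gamma> t\<close> even for negative
\<open>\<gamma>\<close>.\<close>

lemma norm_S_small_time:
  assumes t: "t \<ge> 0" "norm c * t \<le> 1" and g: "\<And>x. c x \<le> \<gamma>"
  shows "norm (S t) \<le> 1 + \<gamma> * t"
proof (rule norm_S_le[OF t(1)])
  fix x
  have "\<bar>c x * t\<bar> \<le> norm c * t" unfolding abs_mult using t ucb_apply_le_norm by (intro mult_mono) auto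
  then have "0 \<le> 1 + c x * t" using t by linarith
  moreover have "c x * t \<le> \<gamma> * t" using g t by (intro mult_right_mono) auto
  ultimately show "\<bar>1 + c x * t\<bar> \<le> 1 + \<gamma> * t" by simp
qed

lemma S_zero: "S 0 = id_blinfun"
proof (rule blinfun_eqI, rule ucb_eqI)
  fix f x show "S 0 f x = id_blinfun f x" by (simp add: S_apply S_fun_eq)
qed

lemma displacement_le:
  assumes t: "0 \<le> t" "t \<le> 1" and y: "\<bar>y\<bar> \<le> 1"
  shows "\<bar>sqrt (6 * a x * t) * y + b x * t\<bar> \<le> step_const * sqrt t"
proof -
  have "\<bar>sqrt (6 * a x * t) * y\<bar> \<le> sqrt (6 * a x * t) * 1"
    unfolding abs_mult using t y a_nonneg[of x] by (intro mult_mono) auto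
  also have "\<dots> \<le> sqrt (6 * norm a) * sqrt t"
    using a_le[of x] t by (simp add: real_sqrt_mult mult_right_mono)
  finally have 1: "\<bar>sqrt (6 * a x * t) * y\<bar> \<le> sqrt (6 * norm a) * sqrt t" .
  have "t \<le> sqrt t" using t by (metis real_le_rsqrt power2_eq_square mult_left_le)
  then have "\<bar>b x * t\<bar> \<le> norm b * sqrt t"
    unfolding abs_mult using t ucb_apply_le_norm by (intro mult_mono) auto
  with 1 show ?thesis by (simp add: step_const_def distrib_right) 
qed

text \<open>Multiplying the average \<open>M\<close> by \<open>1 + c t\<close> adds the potential term: the product \<open>(1 + c t) (u + t v)\<close> is
\<open>u + t (v + c u)\<close> up to \<open>t\<^sup>2 c v\<close>.\<close>

lemma S_remainder:
  fixes M u v C t \<rho> cx :: real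
  assumes "\<bar>M - u - t * v\<bar> \<le> \<rho>" and t: "0 \<le> t" "t \<le> 1" and c: "\<bar>cx\<bar> \<le> C" and v: "\<bar>v\<bar> \<le> V"
  shows "\<bar>(1 + cx * t) * M - u - t * (v + cx * u)\<bar> \<le> t\<^sup>2 * (C * V) + (1 + C) * \<rho>"
proof -
  have "(1 + cx * t) * M - u - t * (v + cx * u) = t\<^sup>2 * (cx * v) + (1 + cx * t) * (M - u - t * v)"
    by (simp add: algebra_simps power2_eq_square)
  moreover have "\<bar>t\<^sup>2 * (cx * v)\<bar> \<le> t\<^sup>2 * (C * V)"
    unfolding abs_mult using c v by (intro mult_mono) (auto intro: order_trans[OF abs_ge_zero])
  moreover have "\<bar>(1 + cx * t) * (M - u - t * v)\<bar> \<le> (1 + C) * \<rho>"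
  proof -
    have "\<bar>cx * t\<bar> \<le> C * 1" unfolding abs_mult using c t by (intro mult_mono) auto
    then have "\<bar>1 + cx * t\<bar> \<le> 1 + C" by linarith
    then show ?thesis unfolding abs_mult using assms(1) by (intro mult_mono) auto
  qed
  ultimately show ?thesis by linarith
qed

lemma S_tangent_norm_le:
  assumes u: "C2 u" and t: "0 \<le> t" "t \<le> 1" and N: "cn 2 u \<le> N"
    and M: "\<And>x. \<bar>1/2 * integral {-1..1} (\<lambda>y. u (x + sqrt (6 * a x * t) * y + b x * t)) - u x
      - t * (b x * deriv u x + a x * (deriv ^^ 2) u x)\<bar> \<le> \<rho>"
  shows "norm (S t u - u - t *\<^sub>R H u) \<le> t\<^sup>2 * (norm c * ((norm b + norm a) * N)) + (1 + norm c) * \<rho>"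
proof (rule ucb_norm_le)
  fix x
  define v where "v = b x * deriv u x + a x * (deriv ^^ 2) u x"
  have d: "\<bar>(deriv ^^ 2) u x\<bar> \<le> N" "\<bar>deriv u x\<bar> \<le> N"
    using abs_deriv_le_cn[OF u, of 2 x] abs_deriv_le_cn[OF u, of 1 x] N by auto
  have "\<bar>v\<bar> \<le> \<bar>b x * deriv u x\<bar> + \<bar>a x * (deriv ^^ 2) u x\<bar>" unfolding v_def by linarith
  also have "\<dots> \<le> norm b * N + norm a * N"
    unfolding abs_mult by (intro add_mono mult_mono ucb_apply_le_norm d) auto
  finally have v: "\<bar>v\<bar> \<le> (norm b + norm a) * N" by (simp add: distrib_right)
  have "(S t u - u - t *\<^sub>R H u) x
      = (1 + c x * t) * (1/2 * integral {-1..1} (\<lambda>y. u (x + sqrt (6 * a x * t) * y + b x * t)))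
        - u x - t * (v + c x * u x)"
    unfolding minus_ucb.rep_eq scaleR_ucb.rep_eq S_apply[OF t(1)] S_fun_eq H_op_apply[OF u] H_fun_def v_def
    by (simp add: algebra_simps)
  then show "\<bar>(S t u - u - t *\<^sub>R H u) x\<bar> \<le> t\<^sup>2 * (norm c * ((norm b + norm a) * N)) + (1 + norm c) * \<rho>"
    using S_remainder[OF M[of x, folded v_def] t ucb_apply_le_norm v] by simp
qed

definition taylor2_const :: real where
  "taylor2_const = (1 + norm c) * (norm a + norm b + (norm b)\<^sup>2 + step_const\<^sup>2)"

lemma taylor2_const_nonneg: "0 \<le> taylor2_const"
  by (simp add: taylor2_const_def)

text \<open>For \<open>s = (6 a t)\<^sup>1\<^sup>/\<^sup>2\<close> the second moment \<open>s\<^sup>2/3\<close> is \<open>2 a t\<close>, which turns the term \<open>u''/2\<close> of the Taylor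
expansion into \<open>t a u''\<close>; this is the reason for the factor \<open>6\<close>. The remainder is controlled by the oscillation of \<open>u''\<close> at
the scale of the displacement.\<close>

lemma S_taylor2:
  assumes u: "C2 u" and t: "0 \<le> t" "t \<le> 1"
    and osc: "\<And>x y. \<bar>x - y\<bar> \<le> step_const * sqrt t \<Longrightarrow> \<bar>(deriv ^^ 2) u x - (deriv ^^ 2) u y\<bar> \<le> e"
  shows "norm (S t u - u - t *\<^sub>R H u) \<le> taylor2_const * (t * (e + t * cn 2 u))"
proof -
  define N where "N = cn 2 u"
  have N: "0 \<le> N" using cn_nonneg[OF u] by (simp add: N_def)
  have e: "0 \<le> e" using osc[of 0 0] t by (simp add: step_const_def)
  define \<rho> where "\<rho> = t\<^sup>2 * ((norm b)\<^sup>2 * N) + step_const\<^sup>2 * (t * e)"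
  have M: "\<bar>1/2 * integral {-1..1} (\<lambda>y. u (x + sqrt (6 * a x * t) * y + b x * t)) - u x
      - t * (b x * deriv u x + a x * (deriv ^^ 2) u x)\<bar> \<le> \<rho>" for x
  proof -
    define s \<beta> u2 where "s = sqrt (6 * a x * t)" and "\<beta> = b x * t" and "u2 = (deriv ^^ 2) u x"
    have s2: "s\<^sup>2 = 6 * a x * t" unfolding s_def using a_nonneg[of x] t by simp
    have "\<bar>1/2 * integral {-1..1} (\<lambda>y. u (x + s * y + \<beta>))
        - (u x + deriv u x * \<beta> + u2 * (s\<^sup>2 / 3 + \<beta>\<^sup>2) / 2 + 0 * (s\<^sup>2 * \<beta> + \<beta> ^ 3) / 6)\<bar>
        \<le> step_const\<^sup>2 * (t * e)"
    proof (rule average_taylor[OF ucb_continuous])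
      fix h y :: real assume y: "\<bar>y\<bar> \<le> 1" and h: "h = s * y + \<beta>"
      have hle: "\<bar>h\<bar> \<le> step_const * sqrt t" unfolding h s_def \<beta>_def by (rule displacement_le[OF t y])
      obtain z where z: "\<bar>z\<bar> \<le> \<bar>h\<bar>" "u (x + h) = (\<Sum>m<2. (deriv ^^ m) u x / fact m * h ^ m)
          + (deriv ^^ 2) u (x + z) / fact 2 * h ^ 2"
        using UCb_n_taylor[OF u] by blast
      have "u (x + h) - (u x + deriv u x * h + u2 * h\<^sup>2 / 2 + 0 * h ^ 3 / 6)
          = ((deriv ^^ 2) u (x + z) - u2) * h\<^sup>2 / 2"
        using z(2) by (simp add: numeral_2_eq_2 algebra_simps diff_divide_distrib add_divide_distrib)
      also have "\<bar>\<dots>\<bar> = \<bar>(deriv ^^ 2) u (x + z) - u2\<bar> * h\<^sup>2 / 2" by (simp add: abs_mult)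
      also have "\<dots> \<le> e * (step_const * sqrt t)\<^sup>2 / 2"
      proof (intro divide_right_mono mult_mono)
        show "\<bar>(deriv ^^ 2) u (x + z) - u2\<bar> \<le> e" unfolding u2_def by (rule osc) (use z hle in auto)
        show "h\<^sup>2 \<le> (step_const * sqrt t)\<^sup>2" using hle by (meson abs_le_square_iff abs_ge_self order_trans)
      qed (use e in auto)
      also have "\<dots> \<le> step_const\<^sup>2 * (t * e)" using t e by (simp add: power_mult_distrib)
      finally show "\<bar>u (x + h) - (u x + deriv u x * h + u2 * h\<^sup>2 / 2 + 0 * h ^ 3 / 6)\<bar> \<le> step_const\<^sup>2 * (t * e)" .
    qed
    moreover have "u x + deriv u x * \<beta> + u2 * (s\<^sup>2 / 3 + \<beta>\<^sup>2) / 2 + 0 * (s\<^sup>2 * \<beta> + \<beta> ^ 3) / 6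
        = u x + t * (b x * deriv u x + a x * u2) + t\<^sup>2 * ((b x)\<^sup>2 * u2 / 2)"
      unfolding s2 \<beta>_def by (simp add: field_simps power2_eq_square)
    moreover have "\<bar>t\<^sup>2 * ((b x)\<^sup>2 * u2 / 2)\<bar> \<le> t\<^sup>2 * ((norm b)\<^sup>2 * N)"
    proof -
      have "\<bar>u2\<bar> \<le> N" unfolding u2_def N_def using abs_deriv_le_cn[OF u, of 2] by simp
      then have "\<bar>u2\<bar> / 2 \<le> N" by linarith
      moreover have "(b x)\<^sup>2 \<le> (norm b)\<^sup>2" using ucb_apply_le_norm[of b x] by (simp add: abs_le_square_iff[symmetric])
      ultimately have "(b x)\<^sup>2 * (\<bar>u2\<bar> / 2) \<le> (norm b)\<^sup>2 * N" by (intro mult_mono) auto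
      then have "t\<^sup>2 * ((b x)\<^sup>2 * (\<bar>u2\<bar> / 2)) \<le> t\<^sup>2 * ((norm b)\<^sup>2 * N)" by (intro mult_left_mono) auto
      then show ?thesis by (simp add: abs_mult)
    qed
    ultimately show ?thesis unfolding \<rho>_def s_def \<beta>_def u2_def by linarith
  qed
  have "norm (S t u - u - t *\<^sub>R H u) \<le> t\<^sup>2 * (norm c * ((norm b + norm a) * N)) + (1 + norm c) * \<rho>"
    by (rule S_tangent_norm_le[OF u t _ M]) (simp add: N_def)
  also have "\<dots> \<le> t\<^sup>2 * ((1 + norm c) * ((norm b + norm a) * N)) + (1 + norm c) * \<rho>"
    using N by (intro add_right_mono mult_left_mono mult_right_mono) auto
  also have "\<dots> = (1 + norm c) * (t * ((norm a + norm b + (norm b)\<^sup>2) * (t * N) + step_const\<^sup>2 * e))"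
    by (simp add: \<rho>_def algebra_simps power2_eq_square)
  also have "\<dots> \<le> (1 + norm c) * (t * ((norm a + norm b + (norm b)\<^sup>2 + step_const\<^sup>2) * (e + t * N)))"
  proof (intro mult_left_mono)
    let ?A = "norm a + norm b + (norm b)\<^sup>2"
    have "0 \<le> ?A * e" "0 \<le> step_const\<^sup>2 * (t * N)" using e N t by auto
    then show "?A * (t * N) + step_const\<^sup>2 * e \<le> (?A + step_const\<^sup>2) * (e + t * N)"
      by (simp add: distrib_right distrib_left)
  qed (use t in auto)
  finally show ?thesis by (simp add: taylor2_const_def N_def mult_ac)
qed

definition taylor4_const :: real where
  "taylor4_const = norm c * (norm b + norm a)
    + (1 + norm c) * ((norm b)\<^sup>2 + norm a * norm b + norm b ^ 3 + step_const ^ 4)"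

text \<open>The third moment \<open>s\<^sup>2 \<beta> + \<beta>\<^sup>3\<close> is of order \<open>t\<^sup>2\<close> because the odd powers of \<open>s\<close> average out, and the fourth order
remainder is of the order \<open>(t\<^sup>1\<^sup>/\<^sup>2)^4\<close>.\<close>

lemma S_taylor4:
  assumes u: "ucb_apply u \<in> UCb_n 4" and t: "0 \<le> t" "t \<le> 1"
  shows "norm (S t u - u - t *\<^sub>R H u) \<le> taylor4_const * t\<^sup>2 * cn 4 u"
proof -
  have u2: "C2 u" by (rule UCb_n_mono[OF _ u]) simp
  define N where "N = cn 4 u"
  have N: "0 \<le> N" using cn_nonneg[OF u] by (simp add: N_def)
  define \<rho> where "\<rho> = t\<^sup>2 * (((norm b)\<^sup>2 + norm a * norm b + norm b ^ 3 + step_const ^ 4) * N)"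
  have M: "\<bar>1/2 * integral {-1..1} (\<lambda>y. u (x + sqrt (6 * a x * t) * y + b x * t)) - u x
      - t * (b x * deriv u x + a x * (deriv ^^ 2) u x)\<bar> \<le> \<rho>" for x
  proof -
    define s \<beta> u2 u3 where "s = sqrt (6 * a x * t)" and "\<beta> = b x * t" and "u2 = (deriv ^^ 2) u x"
      and "u3 = (deriv ^^ 3) u x"
    have s2: "s\<^sup>2 = 6 * a x * t" unfolding s_def using a_nonneg[of x] t by simp
    have "\<bar>1/2 * integral {-1..1} (\<lambda>y. u (x + s * y + \<beta>))
        - (u x + deriv u x * \<beta> + u2 * (s\<^sup>2 / 3 + \<beta>\<^sup>2) / 2 + u3 * (s\<^sup>2 * \<beta> + \<beta> ^ 3) / 6)\<bar>
        \<le> t\<^sup>2 * (step_const ^ 4 * N)"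
    proof (rule average_taylor[OF ucb_continuous])
      fix h y :: real assume y: "\<bar>y\<bar> \<le> 1" and h: "h = s * y + \<beta>"
      have hle: "\<bar>h\<bar> \<le> step_const * sqrt t" unfolding h s_def \<beta>_def by (rule displacement_le[OF t y])
      obtain z where z: "\<bar>z\<bar> \<le> \<bar>h\<bar>" "u (x + h) = (\<Sum>m<4. (deriv ^^ m) u x / fact m * h ^ m)
          + (deriv ^^ 4) u (x + z) / fact 4 * h ^ 4"
        using UCb_n_taylor[OF u] by blast
      have sum: "(\<Sum>m<4. (deriv ^^ m) u x / fact m * h ^ m) = u x + deriv u x * h + u2 * h\<^sup>2 / 2 + u3 * h ^ 3 / 6"
      proof -
        have "{..<4} = {0, 1, 2, 3 :: nat}" by auto
        then show ?thesis unfolding u2_def u3_def by (simp add: fact_numeral)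
      qed
      have "u (x + h) - (u x + deriv u x * h + u2 * h\<^sup>2 / 2 + u3 * h ^ 3 / 6) = (deriv ^^ 4) u (x + z) / fact 4 * h ^ 4"
        using z(2) unfolding sum by simp
      also have "\<bar>\<dots>\<bar> = \<bar>(deriv ^^ 4) u (x + z)\<bar> / fact 4 * \<bar>h\<bar> ^ 4" by (simp add: abs_mult power_abs)
      also have "\<dots> \<le> N * (step_const * sqrt t) ^ 4"
      proof (intro mult_mono power_mono hle)
        have "\<bar>(deriv ^^ 4) u (x + z)\<bar> / fact 4 \<le> \<bar>(deriv ^^ 4) u (x + z)\<bar> / 1"
          by (intro divide_left_mono) auto
        then show "\<bar>(deriv ^^ 4) u (x + z)\<bar> / fact 4 \<le> N"
          using abs_deriv_le_cn[OF u, of 4 "x + z"] by (simp add: N_def)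
      qed (use N in auto)
      also have "\<dots> = t\<^sup>2 * (step_const ^ 4 * N)"
      proof -
        have "sqrt t ^ 4 = ((sqrt t)\<^sup>2)\<^sup>2" by (simp only: power_mult[symmetric]) simp
        then have "sqrt t ^ 4 = t\<^sup>2" using t by simp
        then show ?thesis by (simp add: power_mult_distrib)
      qed
      finally show "\<bar>u (x + h) - (u x + deriv u x * h + u2 * h\<^sup>2 / 2 + u3 * h ^ 3 / 6)\<bar> \<le> t\<^sup>2 * (step_const ^ 4 * N)" .
    qed
    moreover have "u x + deriv u x * \<beta> + u2 * (s\<^sup>2 / 3 + \<beta>\<^sup>2) / 2 + u3 * (s\<^sup>2 * \<beta> + \<beta> ^ 3) / 6
        = u x + t * (b x * deriv u x + a x * u2)
          + t\<^sup>2 * ((b x)\<^sup>2 * u2 / 2 + a x * b x * u3 + t * (b x ^ 3 * u3) / 6)"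
      unfolding s2 \<beta>_def by (simp add: field_simps power2_eq_square power3_eq_cube)
    moreover have "\<bar>t\<^sup>2 * ((b x)\<^sup>2 * u2 / 2 + a x * b x * u3 + t * (b x ^ 3 * u3) / 6)\<bar>
        \<le> t\<^sup>2 * ((norm b)\<^sup>2 * N + norm a * norm b * N + norm b ^ 3 * N)"
    proof -
      have un: "\<bar>u2\<bar> \<le> N" "\<bar>u3\<bar> \<le> N" unfolding u2_def u3_def N_def
        using abs_deriv_le_cn[OF u, of 2] abs_deriv_le_cn[OF u, of 3] by simp_all
      have bp: "\<bar>b x\<bar> ^ k \<le> norm b ^ k" for k by (intro power_mono ucb_apply_le_norm) auto
      have 1: "\<bar>(b x)\<^sup>2 * u2\<bar> \<le> (norm b)\<^sup>2 * N"
        unfolding abs_mult power_abs by (intro mult_mono un bp) auto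
      have 2: "\<bar>a x * b x * u3\<bar> \<le> norm a * norm b * N"
        unfolding abs_mult by (intro mult_mono un ucb_apply_le_norm) (auto simp: N)
      have 3: "\<bar>t * (b x ^ 3 * u3)\<bar> \<le> 1 * (norm b ^ 3 * N)"
        unfolding abs_mult power_abs using t by (intro mult_mono un bp) (auto simp: N)
      have "\<bar>(b x)\<^sup>2 * u2 / 2 + a x * b x * u3 + t * (b x ^ 3 * u3) / 6\<bar>
          \<le> (norm b)\<^sup>2 * N + norm a * norm b * N + norm b ^ 3 * N"
        using 1 2 3 by linarith
      then show ?thesis by (simp add: abs_mult mult_left_mono)
    qed
    moreover have "\<rho> = t\<^sup>2 * ((norm b)\<^sup>2 * N + norm a * norm b * N + norm b ^ 3 * N) + t\<^sup>2 * (step_const ^ 4 * N)"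
      by (simp add: \<rho>_def algebra_simps)
    ultimately show ?thesis unfolding s_def \<beta>_def u2_def by linarith
  qed
  have "norm (S t u - u - t *\<^sub>R H u) \<le> t\<^sup>2 * (norm c * ((norm b + norm a) * N)) + (1 + norm c) * \<rho>"
    by (rule S_tangent_norm_le[OF u2 t _ M]) (use cn_mono[OF u, of 2] in \<open>simp add: N_def\<close>)
  also have "\<dots> = taylor4_const * t\<^sup>2 * N" by (simp add: \<rho>_def taylor4_const_def algebra_simps)
  finally show ?thesis by (simp add: N_def)
qed

lemma taylor4_const_nonneg: "0 \<le> taylor4_const"
proof -
  have "0 \<le> step_const" by (simp add: step_const_def)
  then show ?thesis by (simp add: taylor4_const_def)
qed

lemma S_derivative:
  assumes u: "C2 u" shows "((\<lambda>t. (S t u - u) /\<^sub>R t) \<longlongrightarrow> H u) (at_right 0)"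
proof (rule tendstoI)
  fix e :: real assume e: "e > 0"
  define N where "N = cn 2 u"
  have N: "0 \<le> N" using cn_nonneg[OF u] by (simp add: N_def)
  define L where "L = taylor2_const + 1"
  have L: "L > 0" "taylor2_const \<le> L" using taylor2_const_nonneg by (auto simp: L_def)
  define e' where "e' = e / (4 * L)"
  have e': "e' > 0" using e L by (simp add: e'_def)
  have "(deriv ^^ 2) u \<in> UCb" using u by (auto simp: UCb_n_alt)
  then obtain d where d: "d > 0" "\<And>x y. \<bar>x - y\<bar> \<le> d \<Longrightarrow> \<bar>(deriv ^^ 2) u x - (deriv ^^ 2) u y\<bar> \<le> e'"
    using UCb_oscillation[of "{(deriv ^^ 2) u}" "\<lambda>f. f" e'] e' by auto
  have "((\<lambda>t. step_const * sqrt t) \<longlongrightarrow> step_const * sqrt 0) (at_right 0)"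
    by (intro tendsto_intros)
  then have "\<forall>\<^sub>F t in at_right 0. step_const * sqrt t < d"
    using d by (intro order_tendstoD(2)[of _ "step_const * sqrt 0"]) auto
  moreover have "((\<lambda>t. t * N) \<longlongrightarrow> 0 * N) (at_right 0)" by (intro tendsto_intros)
  then have "\<forall>\<^sub>F t in at_right 0. t * N < e'"
    using e' by (intro order_tendstoD(2)[of _ "0 * N"]) auto
  moreover have "\<forall>\<^sub>F t in at_right 0. 0 < t \<and> t \<le> (1::real)"
    by (auto simp: eventually_at_right_field intro!: exI[of _ 1])
  ultimately show "\<forall>\<^sub>F t in at_right 0. dist ((S t u - u) /\<^sub>R t) (H u) < e"
  proof eventually_elim
    case (elim t)
    have "norm (S t u - u - t *\<^sub>R H u) \<le> taylor2_const * (t * (e' + t * N))"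
      unfolding N_def
    proof (rule S_taylor2[OF u])
      fix x y :: real assume "\<bar>x - y\<bar> \<le> step_const * sqrt t"
      with elim(1) have "\<bar>x - y\<bar> \<le> d" by linarith
      then show "\<bar>(deriv ^^ 2) u x - (deriv ^^ 2) u y\<bar> \<le> e'" by (rule d(2))
    qed (use elim in auto)
    also have "\<dots> \<le> L * (t * (2 * e'))"
      using elim L e' N taylor2_const_nonneg by (intro mult_mono mult_left_mono) auto
    also have "\<dots> = t * (e / 2)" using L by (simp add: e'_def)
    finally have "norm ((S t u - u - t *\<^sub>R H u) /\<^sub>R t) \<le> e / 2" using elim by (intro norm_divideR_le) auto
    moreover have "(S t u - u - t *\<^sub>R H u) /\<^sub>R t = (S t u - u) /\<^sub>R t - H u"
      using elim by (simp add: scaleR_diff_right)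
    ultimately show ?case using e by (simp add: dist_norm)
  qed
qed

section \<open>Dissipativity and the resolvent\<close>

text \<open>The maximum principle without extremal points: \<open>(1 + t l) u\<close> equals \<open>t (l u - H u) + S(t) u\<close> up to
\<open>o(t)\<close>, and \<open>\<parallel>S(t) u\<parallel> \<le> (1 + \<gamma> t) \<parallel>u\<parallel>\<close>. Taking norms and dividing by \<open>t\<close> gives the claim in the limit.\<close>

lemma dissipative:
  assumes u: "C2 u" and g: "\<And>x. c x \<le> \<gamma>"
  shows "(l - \<gamma>) * norm u \<le> norm (l *\<^sub>R u - H u)"
proof -
  let ?q = "\<lambda>t. (S t u - u) /\<^sub>R t"
  have "((\<lambda>t. norm (l *\<^sub>R u - H u) + norm (?q t - H u)) \<longlongrightarrow>
      norm (l *\<^sub>R u - H u) + norm (H u - H u)) (at_right 0)"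
    by (intro tendsto_add tendsto_const tendsto_norm tendsto_diff S_derivative[OF u])
  then have "(l - \<gamma>) * norm u \<le> norm (l *\<^sub>R u - H u) + norm (H u - H u)"
  proof (rule tendsto_lowerbound)
    have "((\<lambda>t. norm c * t) \<longlongrightarrow> norm c * 0) (at_right 0)" by (intro tendsto_intros)
    then have "\<forall>\<^sub>F t in at_right 0. norm c * t < 1" by (rule order_tendstoD) simp
    then show "\<forall>\<^sub>F t in at_right 0. (l - \<gamma>) * norm u \<le> norm (l *\<^sub>R u - H u) + norm (?q t - H u)"
      using eventually_at_right_less[of "0::real"]
    proof eventually_elim
      case (elim t)
      have "(1 + t * l) * norm u \<le> \<bar>1 + t * l\<bar> * norm u" by (intro mult_right_mono) auto
      also have "\<dots> = norm ((1 + t * l) *\<^sub>R u)" by simp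
      also have "(1 + t * l) *\<^sub>R u = t *\<^sub>R (l *\<^sub>R u - H u) + S t u + t *\<^sub>R (H u - ?q t)"
        using elim by (simp add: scaleR_diff_right scaleR_add_left)
      also have "norm \<dots> \<le> norm (t *\<^sub>R (l *\<^sub>R u - H u)) + norm (S t u) + norm (t *\<^sub>R (H u - ?q t))"
        by (rule norm_triangle_add3)
      also have "\<dots> = t * norm (l *\<^sub>R u - H u) + norm (S t u) + t * norm (?q t - H u)"
        using elim by (simp only: norm_scaleR norm_minus_commute[of "H u"])
      also have "norm (S t u) \<le> (1 + \<gamma> * t) * norm u"
        using norm_S_small_time[of t \<gamma>] elim g
        by (intro order_trans[OF norm_blinfun mult_right_mono]) auto
      finally have "t * ((l - \<gamma>) * norm u) \<le> t * (norm (l *\<^sub>R u - H u) + norm (?q t - H u))"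
        by (simp add: algebra_simps)
      then show ?case using elim by (simp add: mult_le_cancel_left_pos)
    qed
  qed simp
  then show ?thesis by simp
qed

lemma norm_dissipative:
  assumes u: "C2 u" shows "(l - norm c) * norm u \<le> norm (l *\<^sub>R u - H u)"
  by (rule dissipative[OF u]) (use ucb_apply_le_norm[of c] in \<open>simp add: abs_le_iff\<close>)

end

text \<open>The bounded solution is \<open>v x = exp (m x) (I - G x)\<close>, where \<open>G\<close> is an antiderivative of
\<open>exp (- m x) g x\<close> and \<open>I\<close> is its limit at infinity. With \<open>\<bar>g\<bar> \<le> B\<close> and \<open>E x = B/m exp (- m x)\<close>, the functions
\<open>G - E\<close> and \<open>G + E\<close> are increasing and decreasing; therefore \<open>I\<close> can be taken as a supremum, and
it lies between the two, which is the bound \<open>\<bar>v\<bar> \<le> B/m\<close>.\<close>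

lemma bounded_solution_first_order:
  assumes g: "g \<in> UCb" and m: "m > 0"
  obtains v where "v \<in> UCb" "\<And>x. (v has_real_derivative m * v x - g x) (at x)"
proof -
  obtain B where B: "B > 0" "\<And>x. \<bar>g x\<bar> \<le> B" by (rule UCb_bound[OF g]) blast
  have "continuous_on UNIV g" using g by (simp add: UCb_def uniformly_continuous_imp_continuous)
  then have "continuous_on UNIV (\<lambda>x. exp (- m * x) * g x)" by (intro continuous_intros)
  then obtain G where G: "\<And>x. (G has_real_derivative exp (- m * x) * g x) (at x)"
    by (rule antiderivative_UNIV) blast
  define E where "E x = B / m * exp (- m * x)" for x
  have dE: "(E has_real_derivative - B * exp (- m * x)) (at x)" for x
    unfolding E_def using m by (auto intro!: derivative_eq_intros)
  have incr: "G x - E x \<le> G y - E y" if "x \<le> y" for x y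
  proof (rule DERIV_nonneg_imp_nondecreasing[OF that])
    fix z
    have "((\<lambda>x. G x - E x) has_real_derivative exp (- m * z) * (g z + B)) (at z)"
      using DERIV_diff[OF G dE, of z] by (simp add: algebra_simps)
    moreover have "0 \<le> exp (- m * z) * (g z + B)" using B(2)[of z] by simp
    ultimately show "\<exists>d. ((\<lambda>x. G x - E x) has_real_derivative d) (at z) \<and> 0 \<le> d" by blast
  qed
  have decr: "G y + E y \<le> G x + E x" if "x \<le> y" for x y
  proof (rule DERIV_nonpos_imp_nonincreasing[OF that])
    fix z
    have "((\<lambda>x. G x + E x) has_real_derivative exp (- m * z) * (g z - B)) (at z)"
      using DERIV_add[OF G dE, of z] by (simp add: algebra_simps)
    moreover have "exp (- m * z) * (g z - B) \<le> 0" using B(2)[of z] by (simp add: mult_le_0_iff)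
    ultimately show "\<exists>d. ((\<lambda>x. G x + E x) has_real_derivative d) (at z) \<and> d \<le> 0" by blast
  qed
  have E0: "E x \<ge> 0" for x using B m by (simp add: E_def)
  have cross: "G y - E y \<le> G x + E x" for x y
    using incr[of y x] decr[of x y] E0[of x] E0[of y] by (cases "y \<le> x") auto
  define I where "I = (SUP y. G y - E y)"
  have I: "G x - E x \<le> I" "I \<le> G x + E x" for x
    unfolding I_def using cross by (auto intro!: cSUP_upper cSUP_least bdd_aboveI2)
  define v where "v x = exp (m * x) * (I - G x)" for x
  have ee: "exp (m * x) * exp (- m * x) = 1" for x by (simp add: exp_add[symmetric])
  have dv: "(v has_real_derivative m * v x - g x) (at x)" for x
  proof -
    have "(v has_real_derivative exp (m * x) * m * (I - G x) - exp (m * x) * (exp (- m * x) * g x)) (at x)"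
      unfolding v_def by (auto intro!: derivative_eq_intros G)
    moreover have "exp (m * x) * (exp (- m * x) * g x) = g x"
      unfolding mult.assoc[symmetric] ee by simp
    moreover have "exp (m * x) * m * (I - G x) = m * v x" by (simp add: v_def)
    ultimately show ?thesis by (simp only:)
  qed
  have bv: "\<bar>v x\<bar> \<le> B / m" for x
  proof -
    have "\<bar>I - G x\<bar> \<le> E x" using I[of x] by linarith
    then have "\<bar>v x\<bar> \<le> exp (m * x) * E x" by (simp add: v_def abs_mult)
    also have "\<dots> = B / m * (exp (m * x) * exp (- m * x))" by (simp add: E_def)
    finally show ?thesis by (simp only: ee)
  qed
  have "\<bar>m * v x - g x\<bar> \<le> m * (B / m) + B" for x
  proof -
    have "\<bar>m * v x\<bar> \<le> m * (B / m)" unfolding abs_mult using bv[of x] m by (intro mult_mono) auto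
    then show ?thesis using B(2)[of x] by linarith
  qed
  then have "v \<in> UCb" by (rule UCb_Lipschitz[OF dv _ bv])
  then show ?thesis using that dv by blast
qed

text \<open>With \<open>m\<^sup>2 = l\<close> the operator factors as \<open>(m - \<partial>) (m + \<partial>)\<close>. The second factor is the reflection of the first.\<close>

lemma resolvent_second_derivative:
  assumes l: "l > 0"
  obtains u :: ucb where "C2 u" "\<And>x. l * u x - deriv (deriv u) x = ucb_apply g x"
proof -
  define m where "m = sqrt l"
  have m: "m > 0" "m * m = l" using l by (auto simp: m_def)
  obtain v where v: "v \<in> UCb" "\<And>x. (v has_real_derivative m * v x - g x) (at x)"
    by (rule bounded_solution_first_order[OF ucb_apply m(1)]) blast
  have "(\<lambda>x. v (- x)) \<in> UCb"
  proof -
    have "bounded (range (\<lambda>x. v (- x)))" using v(1) by (auto simp: UCb_def bounded_iff)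
    moreover have "uniformly_continuous_on UNIV (\<lambda>x. v (- x))"
      unfolding uniformly_continuous_on_def
    proof (intro allI impI)
      fix e :: real assume "e > 0"
      moreover have "uniformly_continuous_on UNIV v" using v(1) by (simp add: UCb_def)
      ultimately obtain d where d: "d > 0" "\<And>x y. dist y x < d \<Longrightarrow> dist (v y) (v x) < e"
        unfolding uniformly_continuous_on_def by (metis UNIV_I)
      then show "\<exists>d>0. \<forall>x\<in>UNIV. \<forall>x'\<in>UNIV. dist x' x < d \<longrightarrow> dist (v (- x')) (v (- x)) < e"
        by (intro exI[of _ d]) (auto simp: dist_real_def abs_minus_commute)
    qed
    ultimately show ?thesis by (simp add: UCb_def)
  qed
  then obtain w where w: "w \<in> UCb" "\<And>x. (w has_real_derivative m * w x - v (- x)) (at x)"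
    by (rule bounded_solution_first_order[OF _ m(1)]) blast
  define u where "u x = w (- x)" for x
  have du: "(u has_real_derivative v x - m * u x) (at x)" for x
  proof -
    have "((\<lambda>x. w (- x)) has_real_derivative (m * w (- x) - v (- (- x))) * (- 1)) (at x)"
      by (rule DERIV_chain2[OF w(2)]) (auto intro!: derivative_eq_intros)
    then show ?thesis by (simp add: u_def[abs_def] algebra_simps)
  qed
  have ddu: "((\<lambda>x. v x - m * u x) has_real_derivative l * u x - g x) (at x)" for x
  proof -
    have "((\<lambda>x. v x - m * u x) has_real_derivative (m * v x - g x) - m * (v x - m * u x)) (at x)"
      by (intro DERIV_diff DERIV_cmult v du)
    moreover have "(m * v x - g x) - m * (v x - m * u x) = l * u x - g x"
      using m(2) by (simp add: algebra_simps)
    ultimately show ?thesis by simp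
  qed
  have bu: "\<bar>u x\<bar> \<le> sup_norm w" for x unfolding u_def by (rule sup_norm_ge[OF w(1)])
  have "\<bar>v x - m * u x\<bar> \<le> sup_norm v + m * sup_norm w" for x
  proof -
    have "\<bar>m * u x\<bar> \<le> m * sup_norm w" unfolding abs_mult using bu[of x] m by (intro mult_mono) auto
    then show ?thesis using sup_norm_ge[OF v(1), of x] by linarith
  qed
  then have u: "u \<in> UCb" by (rule UCb_Lipschitz[OF du _ bu])
  have d1: "(\<lambda>x. v x - m * u x) \<in> UCb"
    by (intro UCb_diff v UCb_mult UCb_const u)
  have d2: "(\<lambda>x. l * u x - g x) \<in> UCb_n 0"
    unfolding UCb_n_0 by (intro UCb_diff ucb_apply UCb_mult UCb_const u)
  have "(\<lambda>x. v x - m * u x) \<in> UCb_n (Suc 0)" "deriv (\<lambda>x. v x - m * u x) = (\<lambda>x. l * u x - g x)"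
    using UCb_n_SucI[OF d1 ddu d2] by auto
  moreover from this(1) have "u \<in> UCb_n (Suc (Suc 0))" "deriv u = (\<lambda>x. v x - m * u x)"
    using UCb_n_SucI[OF u du] by auto
  ultimately have "C2 (Abs_ucb u)" "\<And>x. l * u x - deriv (deriv u) x = g x"
    using u by (simp_all add: Abs_ucb_inverse numeral_2_eq_2)
  then show ?thesis using that[of "Abs_ucb u"] u by (simp add: Abs_ucb_inverse)
qed

definition unit_ucb :: ucb where "unit_ucb = Abs_ucb (\<lambda>x. 1)"

lemma unit_ucb_apply [simp]: "unit_ucb x = 1"
  by (simp add: unit_ucb_def Abs_ucb_inverse UCb_const)

lemma zero_ucb_apply [simp]: "ucb_apply 0 x = 0"
  by (simp add: zero_ucb.rep_eq)

lemma norm_unit_ucb: "norm unit_ucb \<le> 1"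
  by (rule ucb_norm_le) simp

lemma H_op_unit: "C2 u \<Longrightarrow> H_op unit_ucb 0 0 u x = (deriv ^^ 2) u x"
  by (simp add: H_op_apply H_fun_def)

lemma H_op_convex_combination:
  assumes u: "C2 u"
  shows "H_op ((1 - s) *\<^sub>R unit_ucb + s *\<^sub>R a) (s *\<^sub>R b) (s *\<^sub>R c) u
    = H_op unit_ucb 0 0 u + s *\<^sub>R (H_op a b c u - H_op unit_ucb 0 0 u)"
  by (rule ucb_eqI)
    (simp add: plus_ucb.rep_eq minus_ucb.rep_eq scaleR_ucb.rep_eq H_op_apply[OF u] H_fun_def algebra_simps)

lemma C2_dense: "closure {u :: ucb. C2 u} = UNIV"
proof -
  have "f \<in> closure {u :: ucb. C2 u}" for f :: ucb
    unfolding closure_approachable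
  proof (intro allI impI)
    fix e :: real assume e: "e > 0"
    obtain g where g: "g \<in> UCb_n (Suc 0)" "\<And>j x. j \<le> 0 \<Longrightarrow> \<bar>(deriv ^^ j) g x - (deriv ^^ j) f x\<bar> \<le> e / 3"
      using UCb_n_approx[of f 0 "e/3"] ucb_apply e by auto
    obtain h where h: "h \<in> UCb_n (Suc (Suc 0))" "\<And>j x. j \<le> Suc 0 \<Longrightarrow> \<bar>(deriv ^^ j) h x - (deriv ^^ j) g x\<bar> \<le> e / 3"
      using UCb_n_approx[OF g(1), of "e/3"] e by auto
    have hu: "ucb_apply (Abs_ucb h) = h" using UCb_n_UCb[OF h(1)] by (simp add: Abs_ucb_inverse)
    have "norm (Abs_ucb h - f) \<le> 2 * e / 3"
    proof (rule ucb_norm_le)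
      fix x
      have "\<bar>g x - f x\<bar> \<le> e / 3" "\<bar>h x - g x\<bar> \<le> e / 3" using g(2)[of 0 x] h(2)[of 0 x] by auto
      then show "\<bar>(Abs_ucb h - f) x\<bar> \<le> 2 * e / 3" unfolding minus_ucb.rep_eq hu by linarith
    qed
    then have "dist (Abs_ucb h) f < e" using e by (simp add: dist_norm)
    moreover have "C2 (Abs_ucb h)" using h(1) by (simp add: hu numeral_2_eq_2)
    ultimately show "\<exists>y\<in>{u. C2 u}. dist y f < e" by blast
  qed
  then show ?thesis by auto
qed

lemma deriv_diff_C2:
  assumes "C2 u" "C2 v" "j \<le> 2"
  shows "(deriv ^^ j) (ucb_apply (u - v)) x = (deriv ^^ j) u x - (deriv ^^ j) v x"
proof -
  have w: "ucb_apply (u - v) = (\<lambda>x. u x - v x)" by (auto simp: minus_ucb.rep_eq)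
  note u' = assms(1)[unfolded UCb_n_2] and v' = assms(2)[unfolded UCb_n_2]
  have 1: "deriv (\<lambda>x. u x - v x) = (\<lambda>x. deriv u x - deriv v x)"
    using u' v' by (intro ext DERIV_imp_deriv DERIV_diff) auto
  have 2: "deriv (\<lambda>x. deriv u x - deriv v x) = (\<lambda>x. deriv (deriv u) x - deriv (deriv v) x)"
    using u' v' by (intro ext DERIV_imp_deriv DERIV_diff) auto
  have "j = 0 \<or> j = 1 \<or> j = 2" using assms(3) by auto
  then show ?thesis unfolding w by (auto simp: 1 2 funpow_2)
qed

text \<open>One moving average gives a third bounded derivative, which makes the second one Lipschitz.\<close>

lemma HCb_approx_C2:
  assumes u: "C2 u" and e: "e > 0"
  obtains v :: ucb where "ucb_apply v \<in> HCb 2" "C2 v" "cn 2 (ucb_apply (v - u)) \<le> e"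
proof -
  obtain g where g: "g \<in> UCb_n (Suc 2)" "\<And>j x. j \<le> 2 \<Longrightarrow> \<bar>(deriv ^^ j) g x - (deriv ^^ j) u x\<bar> \<le> e / 3"
    using UCb_n_approx[OF u, of "e / 3"] e by auto
  define v where "v = Abs_ucb g"
  have v: "ucb_apply v = g" using UCb_n_UCb[OF g(1)] by (simp add: v_def Abs_ucb_inverse)
  have C2v: "C2 v" unfolding v by (rule UCb_n_subset_Suc[OF g(1)])
  have "cn 2 (ucb_apply (v - u)) \<le> (\<Sum>j\<le>2::nat. e / 3)"
    unfolding cn_def by (intro sum_mono sup_norm_le) (use g(2) in \<open>simp only: deriv_diff_C2[OF C2v u] v atMost_iff\<close>)
  also have "\<dots> = e" by simp
  finally show ?thesis using that[of v] C2v UCb_n_Suc_HCb[OF g(1)] by (simp add: v)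
qed

context elliptic
begin

definition A :: "(ucb \<times> ucb) set" where "A = {(u, H u) | u. C2 u}"

lemma A_iff: "(u, v) \<in> A \<longleftrightarrow> C2 u \<and> v = H u" by (auto simp: A_def)

lemma elliptic_const: "\<exists>K\<ge>0. \<forall>u. C2 u \<longrightarrow> cn 2 u \<le> K * (norm u + norm (H u))"
proof -
  define e K where "e = a0 / (2 * (norm b + 1))"
    and "K = 1 + 2 / e + (1 + e) * (2 / a0 * (1 + 2 * norm b / e + norm c))"
  have e: "e > 0" using a0 unfolding e_def by (intro divide_pos_pos) (auto intro: add_nonneg_pos)
  then have "0 \<le> K" unfolding K_def using a0
    by (intro add_nonneg_nonneg mult_nonneg_nonneg divide_nonneg_pos) auto
  moreover have "cn 2 u \<le> K * (norm u + norm (H u))" if "C2 u" for u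
    unfolding K_def by (rule elliptic_estimate[OF that a_ge a0 order_refl order_refl e_def])
  ultimately show ?thesis by blast
qed

text \<open>Method of continuity from \<open>l u - u''\<close> to \<open>l u - H u\<close>. The intermediate operators
are of the same type, with coefficients \<open>1 - s + s a\<close>, \<open>s b\<close> and \<open>s c\<close>, so dissipativity and the elliptic estimate
hold for them with constants independent of \<open>s\<close>.\<close>

lemma resolvent_exists:
  assumes l: "l \<ge> norm c + 1"
  shows "\<exists>u. C2 u \<and> l *\<^sub>R u - H u = g"
proof -
  let ?H0 = "H_op unit_ucb 0 0"
  \<comment> \<open>A lower bound for \<open>1 - s + s a\<close> that is valid for all \<open>s\<close> in \<open>[0,1]\<close>.\<close>
  define a1 where "a1 = min 1 a0"
  have a1: "a1 > 0" "a1 \<le> 1" "a1 \<le> a0" using a0 by (auto simp: a1_def)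
  define e K where "e = a1 / (2 * (norm b + 1))"
    and "K = 1 + 2 / e + (1 + e) * (2 / a1 * (1 + 2 * norm b / e + norm c))"
  have e: "e > 0" using a1 unfolding e_def by (intro divide_pos_pos) (auto intro: add_nonneg_pos)
  then have K: "0 \<le> K" unfolding K_def using a1
    by (intro add_nonneg_nonneg mult_nonneg_nonneg divide_nonneg_pos) auto
  have l0: "l > 0" "l \<ge> 0" using l norm_ge_zero[of c] by linarith+
  define Q where "Q = 1 + norm a + norm b + norm c"
  have Q: "0 \<le> Q" by (simp add: Q_def)
  have "\<exists>u\<in>{u. C2 u}. l *\<^sub>R u - H u = g"
  proof (rule method_of_continuity[where ?B0.0 = "\<lambda>u. l *\<^sub>R u - ?H0 u" and M = "Q * (K * (l + 2))"])
    fix u v assume "u \<in> {u. C2 u}" "v \<in> {u. C2 u}"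
    then have u: "C2 u" and v: "C2 v" by auto
    show "u - v \<in> {u. C2 u}" using C2_diff(1)[OF u v] by simp
    show "l *\<^sub>R (u - v) - ?H0 (u - v) = (l *\<^sub>R u - ?H0 u) - (l *\<^sub>R v - ?H0 v)"
      by (simp add: C2_diff(2)[OF u v] algebra_simps)
    show "l *\<^sub>R (u - v) - H (u - v) = (l *\<^sub>R u - H u) - (l *\<^sub>R v - H v)"
      by (simp add: C2_diff(2)[OF u v] algebra_simps)
  next
    fix g
    obtain u where u: "C2 u" "\<And>x. l * u x - deriv (deriv u) x = ucb_apply g x"
      by (rule resolvent_second_derivative[OF l0(1), of g]) blast
    have "l *\<^sub>R u - ?H0 u = g"
      by (rule ucb_eqI) (use u in \<open>simp add: minus_ucb.rep_eq scaleR_ucb.rep_eq H_op_unit funpow_2\<close>)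
    then show "\<exists>u\<in>{u. C2 u}. l *\<^sub>R u - ?H0 u = g" using u by blast
  next
    fix s :: real and u assume s: "0 \<le> s" "s \<le> 1" and "u \<in> {u. C2 u}"
    then have u: "C2 u" by simp
    let ?as = "(1 - s) *\<^sub>R unit_ucb + s *\<^sub>R a" and ?bs = "s *\<^sub>R b" and ?cs = "s *\<^sub>R c"
    let ?Hs = "H_op ?as ?bs ?cs"
    have as: "?as x \<ge> a1" for x
    proof -
      have "(1 - s) * a1 \<le> (1 - s) * 1" "s * a1 \<le> s * a x"
        using s a1 a_ge[of x] mult_left_mono[of a1 1 "1 - s"] mult_left_mono[of a1 "a x" s] by auto
      moreover have "?as x = (1 - s) * 1 + s * a x"
        by (simp add: plus_ucb.rep_eq scaleR_ucb.rep_eq)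
      moreover have "(1 - s) * a1 + s * a1 = a1" by (simp add: algebra_simps)
      ultimately show ?thesis by linarith
    qed
    have bs: "norm ?bs \<le> norm b" "norm ?cs \<le> norm c"
      using s by (auto simp: mult_left_le_one_le)
    define W where "W = l *\<^sub>R u - ?Hs u"
    have W: "(l *\<^sub>R u - ?H0 u) + s *\<^sub>R ((l *\<^sub>R u - H u) - (l *\<^sub>R u - ?H0 u)) = W"
      unfolding W_def H_op_convex_combination[OF u] by (simp add: algebra_simps)
    interpret s: elliptic ?as ?bs ?cs a1 by unfold_locales (use as a1 in auto)
    have "(l - norm ?cs) * norm u \<le> norm W" unfolding W_def by (rule s.norm_dissipative[OF u])
    moreover have "1 * norm u \<le> (l - norm ?cs) * norm u"
      using l bs by (intro mult_right_mono) auto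
    ultimately have nu: "norm u \<le> norm W" by linarith
    have "norm (?Hs u) \<le> norm (l *\<^sub>R u) + norm W"
      using norm_triangle_ineq4[of "l *\<^sub>R u" W] by (simp add: W_def)
    also have "\<dots> \<le> l * norm W + norm W" using nu l0 by (simp add: mult_left_mono)
    finally have "norm u + norm (?Hs u) \<le> (l + 2) * norm W" using nu by (simp add: algebra_simps)
    then have cn: "cn 2 u \<le> K * ((l + 2) * norm W)"
      using elliptic_estimate[OF u as a1(1) bs e_def] K unfolding K_def[symmetric]
      by (meson mult_left_mono order_trans)
    have "norm ((l *\<^sub>R u - H u) - (l *\<^sub>R u - ?H0 u)) = norm (?H0 u - H u)"
      by simp
    also have "\<dots> \<le> norm (?H0 u) + norm (H u)" by (rule norm_triangle_ineq4)
    also have "\<dots> \<le> (norm unit_ucb + norm (0::ucb) + norm (0::ucb)) * cn 2 u + (norm a + norm b + norm c) * cn 2 u"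
      by (intro add_mono norm_H_op_le u)
    also have "\<dots> \<le> Q * cn 2 u"
      using mult_right_mono[OF norm_unit_ucb cn_nonneg[OF u]] by (simp add: Q_def distrib_right)
    also have "\<dots> \<le> Q * (K * ((l + 2) * norm W))" using cn Q by (rule mult_left_mono)
    finally show "norm ((l *\<^sub>R u - H u) - (l *\<^sub>R u - ?H0 u))
        \<le> Q * (K * (l + 2)) * norm ((l *\<^sub>R u - ?H0 u) + s *\<^sub>R ((l *\<^sub>R u - H u) - (l *\<^sub>R u - ?H0 u)))"
      unfolding W by (simp add: mult.assoc)
  qed
  then show ?thesis by blast
qed

lemma linear_operator_A: "linear_operator A"
  unfolding linear_operator_def
proof
  show "subspace A"
  proof (rule subspaceI)
    show "0 \<in> A" unfolding zero_prod_def A_iff using C2_zero H_op_zero by simp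
    fix p q assume "p \<in> A" "q \<in> A"
    then obtain u v where "p = (u, H u)" "C2 u" "q = (v, H v)" "C2 v" by (auto simp: A_def)
    then show "p + q \<in> A" using C2_lincomb[of u v, where r = 1 and s = 1] by (simp add: A_iff)
  next
    fix r :: real and p assume "p \<in> A"
    then obtain u where "p = (u, H u)" "C2 u" by (auto simp: A_def)
    then show "r *\<^sub>R p \<in> A" using C2_lincomb[of u u, where r = r and s = 0] by (simp add: A_iff)
  qed
  show "single_valued A" by (auto simp: A_def single_valued_def)
qed

lemma Domain_A: "Domain A = {u. C2 u}" by (auto simp: A_def)

text \<open>\<open>l - H\<close> has a bounded inverse for \<open>l = \<parallel>c\<parallel> + 1\<close>: the limit \<open>u\<close> of the functions \<open>w n\<close> coincides with the
solution \<open>v\<close> of the limiting resolvent equation.\<close>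

lemma closed_A: "closed A"
  unfolding closed_sequential_limits
proof (intro allI impI, elim conjE)
  fix X :: "nat \<Rightarrow> ucb \<times> ucb" and L
  assume X: "\<forall>n. X n \<in> A" and lim: "X \<longlonglongrightarrow> L"
  obtain u f where L: "L = (u, f)" by (cases L)
  define l where "l = norm c + 1"
  obtain v where v: "C2 v" "l *\<^sub>R v - H v = l *\<^sub>R u - f" using resolvent_exists[of l] l_def by blast
  define w where "w n = fst (X n)" for n
  have w: "C2 (w n)" "snd (X n) = H (w n)" for n
    using X[rule_format, of n] A_iff[of "w n" "snd (X n)"] by (simp_all add: w_def)
  have lu: "w \<longlonglongrightarrow> u" "(\<lambda>n. H (w n)) \<longlonglongrightarrow> f"
    using tendsto_fst[OF lim] tendsto_snd[OF lim] unfolding w(2) L by (simp_all add: w_def[abs_def])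
  have "(\<lambda>n. w n - v) \<longlonglongrightarrow> 0"
  proof (rule Lim_null_comparison)
    show "\<forall>\<^sub>F n in sequentially. norm (w n - v) \<le> norm ((l *\<^sub>R w n - H (w n)) - (l *\<^sub>R u - f))"
    proof (rule always_eventually, rule allI)
      fix n
      have "(l - norm c) * norm (w n - v) \<le> norm (l *\<^sub>R (w n - v) - H (w n - v))"
        by (rule norm_dissipative[OF C2_diff(1)[OF w(1) v(1)]])
      also have "l *\<^sub>R (w n - v) - H (w n - v) = (l *\<^sub>R w n - H (w n)) - (l *\<^sub>R v - H v)"
        by (simp add: C2_diff(2)[OF w(1) v(1)] algebra_simps)
      finally show "norm (w n - v) \<le> norm ((l *\<^sub>R w n - H (w n)) - (l *\<^sub>R u - f))"
        unfolding v(2) by (simp add: l_def)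
    qed
    have "(\<lambda>n. norm ((l *\<^sub>R w n - H (w n)) - (l *\<^sub>R u - f))) \<longlonglongrightarrow> norm ((l *\<^sub>R u - f) - (l *\<^sub>R u - f))"
      by (intro tendsto_intros lu)
    then show "(\<lambda>n. norm ((l *\<^sub>R w n - H (w n)) - (l *\<^sub>R u - f))) \<longlonglongrightarrow> 0" by simp
  qed
  then have "w \<longlonglongrightarrow> v" by (rule LIM_zero_cancel)
  then have "u = v" using lu(1) LIMSEQ_unique by blast
  then have "f = H v" using v(2) by simp
  then show "L \<in> A" using v(1) \<open>u = v\<close> by (simp add: L A_iff)
qed

lemma H_graph_subset: "H_graph a b c \<subseteq> A"
  using HCb_UCb_n by (auto simp: H_graph_def A_def)

lemma closure_H_graph: "closure (H_graph a b c) = A"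
proof
  show "closure (H_graph a b c) \<subseteq> A" by (rule closure_minimal[OF H_graph_subset closed_A])
  show "A \<subseteq> closure (H_graph a b c)"
  proof
    fix p assume "p \<in> A"
    then obtain u where p: "p = (u, H u)" and u: "C2 u" by (auto simp: A_def)
    show "p \<in> closure (H_graph a b c)"
      unfolding closure_approachable
    proof (intro allI impI)
      fix e :: real assume e: "e > 0"
      define Q where "Q = 1 + (norm a + norm b + norm c)"
      have Q: "Q > 0" by (simp add: Q_def add_pos_nonneg)
      obtain v where v: "ucb_apply v \<in> HCb 2" "C2 v" "cn 2 (ucb_apply (v - u)) \<le> e / (2 * Q)"
        using HCb_approx_C2[OF u, of "e / (2 * Q)"] e Q by auto
      have vu: "C2 (v - u)" "H (v - u) = H v - H u" using C2_diff[OF v(2) u] by auto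
      have "dist (v, H v) (u, H u) \<le> dist v u + dist (H v) (H u)"
        unfolding dist_Pair_Pair by (rule sqrt_sum_squares_le_sum) auto
      also have "\<dots> = norm (v - u) + norm (H (v - u))" by (simp add: dist_norm vu(2))
      also have "\<dots> \<le> cn 2 (ucb_apply (v - u)) + (norm a + norm b + norm c) * cn 2 (ucb_apply (v - u))"
        by (intro add_mono norm_le_cn norm_H_op_le vu)
      also have "\<dots> = Q * cn 2 (ucb_apply (v - u))" by (simp add: Q_def distrib_right)
      also have "\<dots> \<le> Q * (e / (2 * Q))" using v Q by (intro mult_left_mono) auto
      also have "\<dots> < e" using e Q by simp
      finally show "\<exists>y\<in>H_graph a b c. dist y p < e"
        using v(1) by (intro bexI[of _ "(v, H v)"]) (auto simp: p H_graph_def)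
    qed
  qed
qed

sublocale quasi_m_dissipative A "norm c" "1 / (2 * (norm c + 1))"
proof
  let ?h0 = "1 / (2 * (norm c + 1))"
  have c1: "norm c + 1 > 0" by (rule add_nonneg_pos) auto
  show "linear_operator A" by (rule linear_operator_A)
  show "closure (Domain A) = UNIV" unfolding Domain_A by (rule C2_dense)
  show "0 \<le> norm c" by simp
  show "0 < ?h0" using c1 by simp
  show "norm c * ?h0 \<le> 1 / 2" using c1 by (simp add: field_simps)
  fix h :: real assume h: "0 < h" "h \<le> ?h0"
  show "\<exists>u v. (u, v) \<in> A \<and> u - h *\<^sub>R v = g" for g
  proof -
    have "h * (2 * (norm c + 1)) \<le> 1" using h c1 by (simp add: field_simps)
    then have "norm c + 1 \<le> 1 / h" using h c1 by (simp add: field_simps) 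
    then obtain u where u: "C2 u" "(1 / h) *\<^sub>R u - H u = (1 / h) *\<^sub>R g"
      using resolvent_exists by blast
    from u(2) have "h *\<^sub>R ((1 / h) *\<^sub>R u - H u) = h *\<^sub>R ((1 / h) *\<^sub>R g)" by (rule arg_cong)
    then have "u - h *\<^sub>R H u = g" using h by (simp add: scaleR_diff_right)
    then show ?thesis using u by (auto simp: A_iff)
  qed
  fix u v assume "(u, v) \<in> A"
  then have u: "C2 u" "v = H u" by (auto simp: A_iff)
  have "(1 - norm c * h) * norm u = h * ((1 / h - norm c) * norm u)" using h by (simp add: field_simps)
  also have "\<dots> \<le> h * norm ((1 / h) *\<^sub>R u - H u)"
    using norm_dissipative[OF u(1), of "1 / h"] h by (intro mult_left_mono) auto
  also have "\<dots> = norm (h *\<^sub>R ((1 / h) *\<^sub>R u - H u))" using h by simp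
  also have "h *\<^sub>R ((1 / h) *\<^sub>R u - H u) = u - h *\<^sub>R v" using h by (simp add: scaleR_diff_right u(2))
  finally show "(1 - norm c * h) * norm u \<le> norm (u - h *\<^sub>R v)" .
qed

end

lemma UCb_n_2_Lipschitz:
  assumes f: "f \<in> UCb_n 2"
  shows "\<bar>f x - f y\<bar> \<le> cn 2 f * \<bar>x - y\<bar>" and "\<bar>deriv f x - deriv f y\<bar> \<le> cn 2 f * \<bar>x - y\<bar>"
proof -
  note f' = f[unfolded UCb_n_2]
  have "\<bar>deriv f z\<bar> \<le> cn 2 f" "\<bar>deriv (deriv f) z\<bar> \<le> cn 2 f" for z
    using abs_deriv_le_cn[OF f, of 1 z] abs_deriv_le_cn[OF f, of 2 z] by (auto simp: funpow_2)
  then show "\<bar>f x - f y\<bar> \<le> cn 2 f * \<bar>x - y\<bar>" "\<bar>deriv f x - deriv f y\<bar> \<le> cn 2 f * \<bar>x - y\<bar>"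
    using field_differentiable_bound[of UNIV f "deriv f" "cn 2 f" x y]
      field_differentiable_bound[of UNIV "deriv f" "deriv (deriv f)" "cn 2 f" x y] f' by auto
qed

lemma SUP_ereal_tendsto_zero:
  fixes F :: "nat \<Rightarrow> real \<Rightarrow> real"
  assumes "I \<noteq> {}" "\<And>n t. F n t \<ge> 0"
    and conv: "\<And>e. e > 0 \<Longrightarrow> \<exists>N. \<forall>n\<ge>N. \<forall>t\<in>I. F n t \<le> e"
  shows "(\<lambda>n. SUP t\<in>I. ereal (F n t)) \<longlonglongrightarrow> 0"
proof (rule order_tendstoI)
  fix y :: ereal assume y: "y < 0"
  obtain t where t: "t \<in> I" using assms(1) by blast
  have "y < (SUP t\<in>I. ereal (F n t))" for n
  proof -
    have "0 \<le> ereal (F n t)" using assms(2) by simp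
    also have "\<dots> \<le> (SUP t\<in>I. ereal (F n t))" by (rule SUP_upper[OF t])
    finally show ?thesis using y by (rule less_le_trans[rotated])
  qed
  then show "\<forall>\<^sub>F n in sequentially. y < (SUP t\<in>I. ereal (F n t))" by simp
next
  fix y :: ereal assume "0 < y"
  then obtain e where e: "0 < ereal e" "ereal e < y" using ereal_dense2 by blast
  then obtain N where N: "\<forall>n\<ge>N. \<forall>t\<in>I. F n t \<le> e" using conv[of e] by auto
  have "(SUP t\<in>I. ereal (F n t)) < y" if "n \<ge> N" for n
  proof -
    have "(SUP t\<in>I. ereal (F n t)) \<le> ereal e" by (rule SUP_least) (use N that in auto)
    then show ?thesis using e(2) by (rule le_less_trans)
  qed
  then show "\<forall>\<^sub>F n in sequentially. (SUP t\<in>I. ereal (F n t)) < y"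
    by (auto simp: eventually_sequentially)
qed

context elliptic
begin

section \<open>Convergence of the approximations\<close>

text \<open>Here \<open>\<eta>\<close> stands for a joint modulus of continuity of the coefficients. Differencing \<open>a u'' = H u - b u' - c u\<close> between \<open>x\<close> and \<open>y\<close> leaves differences of \<open>u\<close>, \<open>u'\<close> and
\<open>H u\<close>, which are Lipschitz by the elliptic estimate for \<open>u\<close> and for \<open>H u\<close>, and differences of the coefficients. Hence
bounded subsets of the domain of \<open>H\<^sup>2\<close> have equicontinuous second derivatives, with a modulus inherited from
the coefficients.\<close>

lemma second_derivative_modulus:
  "\<exists>K\<ge>0. \<forall>u \<eta> x y. C2 u \<longrightarrow> C2 (H u) \<longrightarrow> \<bar>x - y\<bar> \<le> \<eta> \<longrightarrow> \<bar>a x - a y\<bar> \<le> \<eta> \<longrightarrow>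
    \<bar>b x - b y\<bar> \<le> \<eta> \<longrightarrow> \<bar>c x - c y\<bar> \<le> \<eta> \<longrightarrow>
    \<bar>(deriv ^^ 2) u x - (deriv ^^ 2) u y\<bar> \<le> K * \<eta> * (norm u + norm (H u) + norm (H (H u)))"
proof -
  obtain K0 where K0: "K0 \<ge> 0" "\<And>u. C2 u \<Longrightarrow> cn 2 u \<le> K0 * (norm u + norm (H u))"
    using elliptic_const by blast
  define K where "K = K0 * (4 + norm b + norm c) / a0"
  have "0 \<le> K" using K0 a0 by (simp add: K_def)
  moreover have "\<bar>(deriv ^^ 2) u x - (deriv ^^ 2) u y\<bar> \<le> K * \<eta> * (norm u + norm (H u) + norm (H (H u)))"
    if u: "C2 u" and v: "C2 (H u)" and xy: "\<bar>x - y\<bar> \<le> \<eta>" and a: "\<bar>a x - a y\<bar> \<le> \<eta>"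
      and b: "\<bar>b x - b y\<bar> \<le> \<eta>" and c: "\<bar>c x - c y\<bar> \<le> \<eta>" for u \<eta> x y
  proof -
    define N where "N = norm u + norm (H u) + norm (H (H u))"
    define Q where "Q = K0 * N"
    have \<eta>: "0 \<le> \<eta>" using xy by linarith
    have Qu: "cn 2 u \<le> Q" and Qv: "cn 2 (H u) \<le> Q"
      using order_trans[OF K0(2)[OF u] mult_left_mono[OF _ K0(1)]]
        order_trans[OF K0(2)[OF v] mult_left_mono[OF _ K0(1)]] by (auto simp: Q_def N_def)
    have Q0: "0 \<le> Q" using K0(1) by (simp add: Q_def N_def)
    have lip: "C * \<bar>x - y\<bar> \<le> Q * \<eta>" if "C \<le> Q" for C using that xy Q0 by (intro mult_mono) auto
    have 1: "\<bar>H u x - H u y\<bar> \<le> Q * \<eta>" "\<bar>u x - u y\<bar> \<le> Q * \<eta>" "\<bar>deriv u x - deriv u y\<bar> \<le> Q * \<eta>"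
      using UCb_n_2_Lipschitz(1)[OF v, of x y] UCb_n_2_Lipschitz[OF u, of x y] lip[OF Qu] lip[OF Qv]
      by linarith+
    have 2: "\<bar>u y\<bar> \<le> Q" "\<bar>deriv u y\<bar> \<le> Q" "\<bar>(deriv ^^ 2) u y\<bar> \<le> Q"
      using abs_deriv_le_cn[OF u, of 0 y] abs_deriv_le_cn[OF u, of 1 y] abs_deriv_le_cn[OF u, of 2 y] Qu by auto
    let ?u2 = "(deriv ^^ 2) u"
    have Hu: "H u z = a z * ?u2 z + b z * deriv u z + c z * u z" for z
      by (simp add: H_op_apply[OF u] H_fun_def)
    have "a x * (?u2 x - ?u2 y) = (H u x - H u y) - b x * (deriv u x - deriv u y) - (b x - b y) * deriv u y
        - c x * (u x - u y) - (c x - c y) * u y - (a x - a y) * ?u2 y"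
      unfolding Hu by (simp add: algebra_simps)
    then have "\<bar>a x * (?u2 x - ?u2 y)\<bar> \<le> \<bar>H u x - H u y\<bar> + \<bar>b x * (deriv u x - deriv u y)\<bar>
        + \<bar>(b x - b y) * deriv u y\<bar> + \<bar>c x * (u x - u y)\<bar> + \<bar>(c x - c y) * u y\<bar> + \<bar>(a x - a y) * ?u2 y\<bar>"
      by (simp only:)
    also have "\<dots> \<le> Q * \<eta> + norm b * (Q * \<eta>) + \<eta> * Q + norm c * (Q * \<eta>) + \<eta> * Q + \<eta> * Q"
      unfolding abs_mult using \<eta> by (intro add_mono mult_mono 1 2 a b c ucb_apply_le_norm) auto
    also have "\<dots> = (4 + norm b + norm c) * (Q * \<eta>)" by (simp add: algebra_simps)
    finally have "\<bar>a x * (?u2 x - ?u2 y)\<bar> \<le> (4 + norm b + norm c) * (Q * \<eta>)" .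
    moreover have "a0 * \<bar>?u2 x - ?u2 y\<bar> \<le> \<bar>a x * (?u2 x - ?u2 y)\<bar>"
      unfolding abs_mult using a_ge[of x] by (intro mult_right_mono) auto
    ultimately have "a0 * \<bar>?u2 x - ?u2 y\<bar> \<le> (4 + norm b + norm c) * (Q * \<eta>)" by linarith
    then have "\<bar>?u2 x - ?u2 y\<bar> \<le> (4 + norm b + norm c) * (Q * \<eta>) / a0"
      using a0 by (simp add: pos_le_divide_eq mult.commute)
    also have "\<dots> = K * \<eta> * N" by (simp add: K_def Q_def)
    finally show ?thesis by (simp add: N_def)
  qed
  ultimately show ?thesis by blast
qed

text \<open>\<open>T\<close> is an arbitrary semigroup with generator \<open>A\<close>, so the results apply to the one that
  \<^const>\<open>semigroup_of\<close> selects. The convergence of the powers of \<open>S\<close> to \<open>T\<close> shows that there is only one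
  such semigroup and supplies its growth bound.\<close>

context
  fixes T :: "real \<Rightarrow> ucb \<Rightarrow>\<^sub>L ucb"
  assumes T: "generates A T"
begin

lemma T_C0: "C0_semigroup T" and T_gen: "generator T = A"
  using T by (auto simp: generates_def)

lemma T_orbit:
  assumes u: "C2 u" and s: "s \<ge> 0" shows "C2 (T s u)" and "H (T s u) = T s (H u)"
proof -
  have "(u, H u) \<in> generator T" using u by (simp add: T_gen A_iff)
  then have "(T s u, T s (H u)) \<in> A" using generator_orbit[OF T_C0 _ s] T_gen by auto
  then show "C2 (T s u)" "H (T s u) = T s (H u)" by (simp_all add: A_iff)
qed

lemma T_tangent_le:
  assumes u: "C2 u" "C2 (H u)" and t: "t \<ge> 0" and M: "\<And>r. 0 \<le> r \<Longrightarrow> r \<le> t \<Longrightarrow> norm (T r) \<le> M"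
  shows "norm (T t u - u - t *\<^sub>R H u) \<le> t\<^sup>2 * M * norm (H (H u))"
  using norm_orbit_tangent_le[OF T_C0 M _ _ t, of u "H u" "H (H u)"] u by (simp add: T_gen A_iff)

lemma S_pow_norm_le:
  assumes "t \<ge> 0" shows "norm ((blinfun_apply (S (t / real n)) ^^ n) f) \<le> exp (norm c * t) * norm f"
proof (cases "n = 0")
  case False
  have "norm ((blinfun_apply (S (t / real n)) ^^ n) f) \<le> exp (norm c * (t / real n)) ^ n * norm f"
    by (rule norm_funpow_le[OF norm_S_exp_le]) (use assms in simp)
  also have "exp (norm c * (t / real n)) ^ n = exp (norm c * t)"
    using False by (simp add: exp_of_nat_mult[symmetric])
  finally show ?thesis .
qed (use assms mult_right_mono[of 1 "exp (norm c * t)" "norm f"] in simp)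

lemma chernoff_step:
  assumes t: "t \<ge> 0" and n: "n > 0"
    and step: "\<And>s. 0 \<le> s \<Longrightarrow> s \<le> t \<Longrightarrow> norm (S (t / real n) (T s f) - T (t / real n) (T s f)) \<le> e"
  shows "norm ((blinfun_apply (S (t / real n)) ^^ n) f - T t f) \<le> real n * exp (norm c * t) * e"
proof -
  define h where "h = t / real n"
  have h: "h \<ge> 0" "real n * h = t" using t n by (auto simp: h_def)
  have "norm ((blinfun_apply (S h) ^^ n) f - (blinfun_apply (T h) ^^ n) f) \<le> real n * exp (norm c * h) ^ n * e"
  proof (rule norm_funpow_diff_funpow_le[OF norm_S_exp_le[OF h(1)]])
    show "1 \<le> exp (norm c * h)" using h by simp
    fix k assume k: "k < n"
    then have "real k * h \<le> real n * h" using h by (intro mult_right_mono) auto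
    then have "real k * h \<le> t" by (simp only: h(2))
    then show "norm (S h ((blinfun_apply (T h) ^^ k) f) - T h ((blinfun_apply (T h) ^^ k) f)) \<le> e"
      unfolding C0_semigroup_funpow[OF T_C0 h(1)] using step[of "real k * h"] mult_nonneg_nonneg[OF of_nat_0_le_iff h(1), of k] by (simp add: h_def)
  qed
  also have "exp (norm c * h) ^ n = exp (norm c * t)"
  proof -
    have "real n * (norm c * h) = norm c * (real n * h)" by simp
    then show ?thesis unfolding exp_of_nat_mult[symmetric] h(2) by simp
  qed
  finally show ?thesis unfolding C0_semigroup_funpow[OF T_C0 h(1)] h(2) by (simp only: h_def)
qed

text \<open>The orbit of \<open>f\<close> stays in the domain of \<open>H\<^sup>2\<close> with bounds that are uniform on \<open>[0, t0]\<close>. So the Taylor estimate for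
\<open>S(h)\<close> and the tangent estimate for \<open>T(h)\<close> bound each of the \<open>n\<close> local errors by \<open>h \<eta> G\<close>, where \<open>\<eta>\<close> is
arbitrarily small once \<open>h\<close> is, and their sum is of the order \<open>t \<eta> G\<close>.\<close>

lemma chernoff_convergence_regular:
  assumes f: "C2 f" "C2 (H f)" and t0: "t0 \<ge> 0" and e: "e > 0"
  shows "\<exists>N. \<forall>n\<ge>N. \<forall>t\<in>{0..t0}. norm ((blinfun_apply (S (t / real n)) ^^ n) f - T t f) \<le> e"
proof -
  obtain M where M: "M \<ge> 1" "\<And>r. 0 \<le> r \<Longrightarrow> r \<le> t0 \<Longrightarrow> norm (T r) \<le> M"
    using C0_semigroup_locally_bounded[OF T_C0, of t0] by blast
  obtain K0 where K0: "K0 \<ge> 0" "\<And>u. C2 u \<Longrightarrow> cn 2 u \<le> K0 * (norm u + norm (H u))"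
    using elliptic_const by blast
  obtain K1 where K1: "K1 \<ge> 0" "\<And>u \<eta> x y. C2 u \<Longrightarrow> C2 (H u) \<Longrightarrow> \<bar>x - y\<bar> \<le> \<eta> \<Longrightarrow> \<bar>a x - a y\<bar> \<le> \<eta> \<Longrightarrow>
    \<bar>b x - b y\<bar> \<le> \<eta> \<Longrightarrow> \<bar>c x - c y\<bar> \<le> \<eta> \<Longrightarrow>
    \<bar>(deriv ^^ 2) u x - (deriv ^^ 2) u y\<bar> \<le> K1 * \<eta> * (norm u + norm (H u) + norm (H (H u)))"
    using second_derivative_modulus by blast
  define N where "N = M * (norm f + norm (H f) + norm (H (H f)))"
  have N: "0 \<le> N" using M(1) by (simp add: N_def)
  define L where "L = taylor2_const"
  have L: "0 \<le> L" by (simp add: L_def taylor2_const_nonneg)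
  define G where "G = L * (K1 + K0) * N + M * N"
  have G: "0 \<le> G" using L K0 K1 N M by (simp add: G_def)
  \<comment> \<open>The accumulated error below is at most \<open>t0 * exp (norm c * t0) * G * \<eta>\<close>.\<close>
  define \<eta> where "\<eta> = e / (t0 * exp (norm c * t0) * G + 1)"
  have den: "t0 * exp (norm c * t0) * G + 1 > 0" using t0 G by (simp add: add_nonneg_pos)
  have \<eta>: "\<eta> > 0" using e den by (simp add: \<eta>_def)
  have \<eta>e: "t0 * exp (norm c * t0) * G * \<eta> \<le> e"
  proof -
    have "(t0 * exp (norm c * t0) * G + 1) * \<eta> = e" unfolding \<eta>_def using den by simp
    then show ?thesis using \<eta> unfolding distrib_right by linarith
  qed
  have "\<exists>d>0. \<forall>g\<in>{ucb_apply a, ucb_apply b, ucb_apply c}. \<forall>x y. \<bar>x - y\<bar> \<le> d \<longrightarrow> \<bar>g x - g y\<bar> \<le> \<eta>"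
    by (rule UCb_oscillation) (use \<eta> ucb_apply in auto)
  then obtain d where d: "d > 0" "\<And>g x y. g \<in> {ucb_apply a, ucb_apply b, ucb_apply c} \<Longrightarrow> \<bar>x - y\<bar> \<le> d \<Longrightarrow> \<bar>g x - g y\<bar> \<le> \<eta>"
    by blast
  have "(\<lambda>n. t0 / real n) \<longlonglongrightarrow> 0" by real_asymp
  then have "\<forall>\<^sub>F n in sequentially. t0 / real n < min 1 \<eta>" using \<eta> by (intro order_tendstoD) auto
  moreover have "(\<lambda>n. step_const * sqrt (t0 / real n)) \<longlonglongrightarrow> step_const * sqrt 0"
    by (intro tendsto_intros)
  then have "\<forall>\<^sub>F n in sequentially. step_const * sqrt (t0 / real n) < min d \<eta>"
    using d \<eta> by (intro order_tendstoD(2)) auto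
  ultimately have "\<forall>\<^sub>F n in sequentially. \<forall>t\<in>{0..t0}.
      norm ((blinfun_apply (S (t / real n)) ^^ n) f - T t f) \<le> e"
    using eventually_gt_at_top[of 0]
  proof eventually_elim
    case (elim n)
    show ?case
    proof
      fix t assume t: "t \<in> {0..t0}"
      define h where "h = t / real n"
      have hle: "h \<le> t0 / real n" using t elim by (simp add: h_def divide_right_mono)
      have h: "0 \<le> h" "h \<le> 1" "h \<le> \<eta>" "real n * h = t" using t elim hle by (auto simp: h_def)
      have "step_const * sqrt h \<le> step_const * sqrt (t0 / real n)"
        using hle by (intro mult_left_mono) (auto simp: step_const_def)
      then have sh: "step_const * sqrt h \<le> d" "step_const * sqrt h \<le> \<eta>" using elim by auto
      have hle_t: "h \<le> t" using elim(3) t unfolding h_def by (auto simp: divide_le_eq mult_le_cancel_left1)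
      have "norm ((blinfun_apply (S (t / real n)) ^^ n) f - T t f)
          \<le> real n * exp (norm c * t) * (h * (\<eta> * G))"
      proof (rule chernoff_step)
        fix s assume s: "0 \<le> s" "s \<le> t"
        define u where "u = T s f"
        have u: "C2 u" "C2 (H u)" "H u = T s (H f)" "H (H u) = T s (H (H f))"
          using T_orbit[OF f(1) s(1)] T_orbit[OF f(2) s(1)] by (auto simp: u_def)
        have Tn: "norm (T s g) \<le> M * norm g" for g
          using M(2)[of s] s t by (intro order_trans[OF norm_blinfun mult_right_mono]) auto
        have uN: "norm u + norm (H u) + norm (H (H u)) \<le> N"
          using Tn[of f, folded u_def] Tn[of "H f", folded u(3)] Tn[of "H (H f)", folded u(4)]
          by (simp add: N_def distrib_left)
        have "norm u + norm (H u) \<le> N" using uN norm_ge_zero[of "H (H u)"] by linarith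
        then have cn: "cn 2 u \<le> K0 * N" using K0(2)[OF u(1)] mult_left_mono[OF _ K0(1)] order_trans by blast
        have "norm (S h u - u - h *\<^sub>R H u) \<le> L * (h * (K1 * \<eta> * N + h * cn 2 u))"
          unfolding L_def
        proof (rule S_taylor2[OF u(1) h(1,2)])
          fix x y :: real assume "\<bar>x - y\<bar> \<le> step_const * sqrt h"
          then have "\<bar>x - y\<bar> \<le> d" "\<bar>x - y\<bar> \<le> \<eta>" using sh by linarith+
          then have "\<bar>(deriv ^^ 2) u x - (deriv ^^ 2) u y\<bar>
              \<le> K1 * \<eta> * (norm u + norm (H u) + norm (H (H u)))"
            using d(2)[of a x y] d(2)[of b x y] d(2)[of c x y] by (intro K1(2) u(1,2)) auto
          also have "\<dots> \<le> K1 * \<eta> * N" using uN K1(1) \<eta> by (intro mult_left_mono) auto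
          finally show "\<bar>(deriv ^^ 2) u x - (deriv ^^ 2) u y\<bar> \<le> K1 * \<eta> * N" .
        qed
        also have "\<dots> \<le> L * (h * (K1 * \<eta> * N + \<eta> * (K0 * N)))"
          using L h \<eta> K0 K1 N cn cn_nonneg[OF u(1)] by (intro mult_left_mono add_left_mono mult_mono) auto
        finally have 1: "norm (S h u - u - h *\<^sub>R H u) \<le> h * \<eta> * (L * (K1 + K0) * N)"
          by (simp add: algebra_simps)
        have "norm (T h u - u - h *\<^sub>R H u) \<le> h\<^sup>2 * M * norm (H (H u))"
          by (rule T_tangent_le[OF u(1,2) h(1) M(2)]) (use hle_t t in auto)
        also have "\<dots> \<le> (h * \<eta>) * M * N"
        proof (intro mult_mono)
          show "h\<^sup>2 \<le> h * \<eta>" unfolding power2_eq_square using h by (intro mult_left_mono) auto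
          show "norm (H (H u)) \<le> N" using uN norm_ge_zero[of u] norm_ge_zero[of "H u"] by linarith
        qed (use h M N \<eta> in auto)
        finally have 2: "norm (T h u - u - h *\<^sub>R H u) \<le> h * \<eta> * (M * N)" by (simp add: mult.assoc)
        have "S h u - T h u = (S h u - u - h *\<^sub>R H u) - (T h u - u - h *\<^sub>R H u)" by simp
        then have "norm (S h u - T h u) \<le> norm (S h u - u - h *\<^sub>R H u) + norm (T h u - u - h *\<^sub>R H u)"
          by (metis norm_triangle_ineq4)
        also have "\<dots> \<le> h * (\<eta> * G)" using 1 2 by (simp add: G_def distrib_left mult.assoc)
        finally show "norm (S (t / real n) (T s f) - T (t / real n) (T s f)) \<le> h * (\<eta> * G)"
          by (simp only: u_def h_def)
      qed (use t elim in auto)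
      also have "\<dots> = t * exp (norm c * t) * G * \<eta>" unfolding h(4)[symmetric] by (simp add: mult_ac)
      also have "\<dots> \<le> t0 * exp (norm c * t0) * G * \<eta>"
        using t G \<eta> by (intro mult_right_mono mult_mono) (auto intro: mult_left_mono)
      finally show "norm ((blinfun_apply (S (t / real n)) ^^ n) f - T t f) \<le> e" using \<eta>e by linarith
    qed
  qed
  then show ?thesis by (simp add: eventually_sequentially)
qed

lemma chernoff_convergence:
  assumes t0: "t0 \<ge> 0" and e: "e > 0"
  shows "\<exists>N. \<forall>n\<ge>N. \<forall>t\<in>{0..t0}. norm ((blinfun_apply (S (t / real n)) ^^ n) g - T t g) \<le> e"
proof -
  obtain M where M: "M \<ge> 1" "\<And>r. 0 \<le> r \<Longrightarrow> r \<le> t0 \<Longrightarrow> norm (T r) \<le> M"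
    using C0_semigroup_locally_bounded[OF T_C0, of t0] by blast
  define K where "K = exp (norm c * t0) + M"
  have K: "K > 0" using M by (simp add: K_def add_pos_pos)
  have "g \<in> closure D2" using D2_dense by simp
  moreover have "e / (2 * K) > 0" using e K by simp
  ultimately obtain f where f: "f \<in> D2" "norm (f - g) < e / (2 * K)"
    by (auto simp: closure_approachable dist_norm)
  have fC: "C2 f" "C2 (H f)" using f(1) by (auto simp: D2_def A_iff)
  obtain N where N: "\<forall>n\<ge>N. \<forall>t\<in>{0..t0}. norm ((blinfun_apply (S (t / real n)) ^^ n) f - T t f) \<le> e / 2"
    using chernoff_convergence_regular[OF fC t0, of "e / 2"] e by auto
  have "norm ((blinfun_apply (S (t / real n)) ^^ n) g - T t g) \<le> e" if n: "n \<ge> N" and t: "t \<in> {0..t0}" for n t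
  proof -
    let ?P = "blinfun_apply (S (t / real n)) ^^ n"
    have l: "linear ?P" by (rule linear_funpow_blinfun)
    have "?P g - T t g = ?P (g - f) + (?P f - T t f) + T t (f - g)"
      by (simp add: linear_diff[OF l] blinfun.diff_right)
    then have "norm (?P g - T t g) \<le> norm (?P (g - f)) + norm (?P f - T t f) + norm (T t (f - g))"
      by (simp only: norm_triangle_add3)
    also have "\<dots> \<le> exp (norm c * t0) * norm (f - g) + e / 2 + M * norm (f - g)"
    proof (intro add_mono)
      have "norm (?P (g - f)) \<le> exp (norm c * t) * norm (g - f)" by (rule S_pow_norm_le) (use t in auto)
      also have "\<dots> \<le> exp (norm c * t0) * norm (g - f)"
        using t by (intro mult_right_mono) (auto intro: mult_left_mono)
      finally show "norm (?P (g - f)) \<le> exp (norm c * t0) * norm (f - g)" by (simp add: norm_minus_commute)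
      show "norm (?P f - T t f) \<le> e / 2" using N n t by blast
      show "norm (T t (f - g)) \<le> M * norm (f - g)"
        using M(2)[of t] t by (intro order_trans[OF norm_blinfun mult_right_mono]) auto
    qed
    also have "\<dots> = K * norm (f - g) + e / 2" by (simp add: K_def algebra_simps)
    also have "\<dots> \<le> K * (e / (2 * K)) + e / 2"
      using f(2) K by (intro add_right_mono mult_left_mono) auto
    also have "\<dots> = e" using K by simp
    finally show ?thesis .
  qed
  then show ?thesis by blast
qed

lemma chernoff_SUP_tendsto:
  assumes "t0 > 0" "I \<noteq> {}" "I \<subseteq> {0..t0}"
  shows "(\<lambda>n. SUP t\<in>I. ereal (norm ((blinfun_apply (S (t / real n)) ^^ n) g - T t g))) \<longlonglongrightarrow> 0"
proof (rule SUP_ereal_tendsto_zero[OF assms(2)])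
  fix e :: real assume "e > 0"
  then show "\<exists>N. \<forall>n\<ge>N. \<forall>t\<in>I. norm ((blinfun_apply (S (t / real n)) ^^ n) g - T t g) \<le> e"
    using chernoff_convergence[of t0 e g] assms by (meson less_imp_le subsetD)
qed simp

text \<open>For large \<open>n\<close> the factor \<open>S(t/n)\<close> has norm at most \<open>1 + \<gamma> t/n \<le> exp (\<gamma> t/n)\<close>, and the bound for its \<open>n\<close>-th power
passes to the limit.\<close>

lemma norm_T_le:
  assumes t: "t \<ge> 0" and g: "\<And>x. c x \<le> \<gamma>" shows "norm (T t) \<le> exp (\<gamma> * t)"
proof (rule norm_blinfun_bound)
  fix f
  have "(\<lambda>n. (blinfun_apply (S (t / real n)) ^^ n) f) \<longlonglongrightarrow> T t f"
  proof (rule LIMSEQ_I)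
    fix e :: real assume "e > 0"
    then obtain N where "\<forall>n\<ge>N. \<forall>s\<in>{0..t}. norm ((blinfun_apply (S (s / real n)) ^^ n) f - T s f) \<le> e / 2"
      using chernoff_convergence[OF t, of "e / 2"] by auto
    then have "\<forall>n\<ge>N. norm ((blinfun_apply (S (t / real n)) ^^ n) f - T t f) \<le> e / 2" using t by simp
    then show "\<exists>N. \<forall>n\<ge>N. norm ((blinfun_apply (S (t / real n)) ^^ n) f - T t f) < e"
      using \<open>e > 0\<close> by (intro exI[of _ N]) (auto intro: le_less_trans)
  qed
  then show "norm (T t f) \<le> exp (\<gamma> * t) * norm f"
  proof (rule tendsto_upperbound[OF tendsto_norm])
    have "(\<lambda>n. norm c * (t / real n)) \<longlonglongrightarrow> 0" by real_asymp
    then have "\<forall>\<^sub>F n in sequentially. norm c * (t / real n) < 1" by (rule order_tendstoD) simp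
    then show "\<forall>\<^sub>F n in sequentially. norm ((blinfun_apply (S (t / real n)) ^^ n) f) \<le> exp (\<gamma> * t) * norm f"
      using eventually_gt_at_top[of 0]
    proof eventually_elim
      case (elim n)
      have "norm (S (t / real n)) \<le> 1 + \<gamma> * (t / real n)"
        by (rule norm_S_small_time) (use t elim g in auto)
      also have "\<dots> \<le> exp (\<gamma> * (t / real n))" by (rule exp_ge_add_one_self)
      finally have "norm ((blinfun_apply (S (t / real n)) ^^ n) f) \<le> exp (\<gamma> * (t / real n)) ^ n * norm f"
        by (rule norm_funpow_le)
      also have "exp (\<gamma> * (t / real n)) ^ n = exp (\<gamma> * t)"
        using elim by (simp add: exp_of_nat_mult[symmetric])
      finally show ?case .
    qed
  qed simp
qed simp

lemma norm_T_exp_le: "t \<ge> 0 \<Longrightarrow> norm (T t) \<le> exp (norm c * t)"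
  by (rule norm_T_le) (use ucb_apply_le_norm[of c] in \<open>auto simp: abs_le_iff\<close>)

end

section \<open>Higher regularity and the rate of convergence\<close>

lemma H_op_UCb_n:
  assumes "ucb_apply a \<in> UCb_n k" "ucb_apply b \<in> UCb_n k" "ucb_apply c \<in> UCb_n k"
  shows "\<exists>K\<ge>0. \<forall>u. ucb_apply u \<in> UCb_n (Suc (Suc k)) \<longrightarrow>
    ucb_apply (H u) \<in> UCb_n k \<and> cn k (H u) \<le> K * cn (Suc (Suc k)) u"
proof -
  define K where "K = 2 ^ k * (cn k a + cn k b + cn k c)"
  have nn: "0 \<le> cn k a" "0 \<le> cn k b" "0 \<le> cn k c" using assms cn_nonneg by auto
  have "ucb_apply (H u) \<in> UCb_n k \<and> cn k (H u) \<le> K * cn (Suc (Suc k)) u"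
    if u: "ucb_apply u \<in> UCb_n (Suc (Suc k))" for u
  proof -
    have C2u: "C2 u" by (rule UCb_n_mono[OF _ u]) simp
    have u1: "deriv u \<in> UCb_n (Suc k)" "deriv (deriv u) \<in> UCb_n k" using u by (auto simp: UCb_n_Suc)
    have u0: "ucb_apply u \<in> UCb_n k" "deriv u \<in> UCb_n k"
      using UCb_n_mono[OF _ u, of k] UCb_n_subset_Suc[OF u1(1)] by auto
    have eq: "ucb_apply (H u) = (\<lambda>x. a x * deriv (deriv u) x + b x * deriv u x + c x * u x)"
      by (simp add: H_op_apply[OF C2u] H_fun_def fun_eq_iff funpow_2)
    note pa = UCb_n_mult[OF assms(1) u1(2)] and pb = UCb_n_mult[OF assms(2) u0(2)]
      and pc = UCb_n_mult[OF assms(3) u0(1)]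
    note pab = UCb_n_add[OF pa[THEN conjunct1] pb[THEN conjunct1]]
    note pabc = UCb_n_add[OF pab[THEN conjunct1] pc[THEN conjunct1]]
    define N where "N = cn (Suc (Suc k)) u"
    have le: "cn k (deriv (deriv u)) \<le> N" "cn k (deriv u) \<le> N" "cn k u \<le> N"
    proof -
      have s: "0 \<le> sup_norm u" "0 \<le> sup_norm (deriv u)"
        using u0 UCb_n_UCb sup_norm_nonneg by blast+
      show "cn k u \<le> N" unfolding N_def by (rule cn_mono[OF u]) simp
      have "cn k (deriv u) \<le> cn (Suc k) (deriv u)" by (rule cn_mono[OF u1(1)]) simp
      then show "cn k (deriv u) \<le> N" using s by (simp add: N_def cn_Suc)
      show "cn k (deriv (deriv u)) \<le> N" using s by (simp add: N_def cn_Suc)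
    qed
    have "cn k (H u) \<le> cn k (\<lambda>x. a x * deriv (deriv u) x) + cn k (\<lambda>x. b x * deriv u x) + cn k (\<lambda>x. c x * u x)"
      unfolding eq using pab pabc by linarith
    also have "\<dots> \<le> 2 ^ k * cn k a * cn k (deriv (deriv u)) + 2 ^ k * cn k b * cn k (deriv u) + 2 ^ k * cn k c * cn k u"
      using pa pb pc by linarith
    also have "\<dots> \<le> 2 ^ k * cn k a * N + 2 ^ k * cn k b * N + 2 ^ k * cn k c * N"
      using nn le by (intro add_mono mult_left_mono) auto
    also have "\<dots> = K * N" by (simp add: K_def algebra_simps)
    finally show ?thesis using pabc by (simp add: N_def eq)
  qed
  moreover have "0 \<le> K" using nn by (simp add: K_def)
  ultimately show ?thesis by blast
qed

text \<open>Bootstrapping: if \<open>H u\<close> and \<open>u'\<close> are in \<open>UCb_n k\<close>, then so is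
\<open>u'' = (1/a) (H u - b u' - c u)\<close>, since \<open>UCb_n k\<close> is an algebra.\<close>

lemma elliptic_regularity:
  assumes "ucb_apply a \<in> UCb_n k" "ucb_apply b \<in> UCb_n k" "ucb_apply c \<in> UCb_n k" and k: "k \<ge> 1"
  shows "\<exists>K\<ge>0. \<forall>u. ucb_apply u \<in> UCb_n (Suc k) \<longrightarrow> ucb_apply (H u) \<in> UCb_n k \<longrightarrow>
    ucb_apply u \<in> UCb_n (Suc (Suc k)) \<and> cn (Suc (Suc k)) u \<le> K * (cn k (H u) + cn (Suc k) u)"
proof -
  define r where "r x = 1 / a x" for x
  have r: "r \<in> UCb_n k" unfolding r_def by (rule UCb_n_inverse[OF assms(1) a0 a_ge])
  define B where "B = 1 + 2 ^ k * (cn k b + cn k c)"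
  define K where "K = 2 + 2 ^ k * cn k r * B"
  have nn: "0 \<le> cn k r" "0 \<le> cn k b" "0 \<le> cn k c" using r assms cn_nonneg by auto
  have B: "1 \<le> B" using nn by (simp add: B_def)
  have K: "0 \<le> K" using nn B by (simp add: K_def)
  have "ucb_apply u \<in> UCb_n (Suc (Suc k)) \<and> cn (Suc (Suc k)) u \<le> K * (cn k (H u) + cn (Suc k) u)"
    if u: "ucb_apply u \<in> UCb_n (Suc k)" and v: "ucb_apply (H u) \<in> UCb_n k" for u
  proof -
    have C2u: "C2 u" by (rule UCb_n_mono[OF _ u]) (use k in simp)
    have u0: "ucb_apply u \<in> UCb_n k" "deriv u \<in> UCb_n k" using UCb_n_subset_Suc[OF u] u by (auto simp: UCb_n_Suc)
    define w where "w x = r x * (H u x - (b x * deriv u x + c x * u x))" for x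
    have dd: "deriv (deriv u) = w"
    proof
      fix x
      have "a x \<noteq> 0" using a_ge[of x] a0 by simp
      then show "deriv (deriv u) x = w x"
        by (simp add: w_def r_def H_op_apply[OF C2u] H_fun_def funpow_2)
    qed
    note pb = UCb_n_mult[OF assms(2) u0(2)] and pc = UCb_n_mult[OF assms(3) u0(1)]
    note pbc = UCb_n_add[OF pb[THEN conjunct1] pc[THEN conjunct1]]
    note pd = UCb_n_diff[OF v pbc[THEN conjunct1]]
    note pw = UCb_n_mult[OF r pd[THEN conjunct1]]
    have w: "w \<in> UCb_n k" using pw by (simp add: w_def[abs_def])
    have mem: "ucb_apply u \<in> UCb_n (Suc (Suc k))"
    proof -
      note u' = C2u[unfolded UCb_n_2]
      have "deriv u \<in> UCb_n (Suc k)" unfolding UCb_n_Suc using u' w dd by simp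
      then show ?thesis unfolding UCb_n_Suc[of _ "Suc k"] using u' by simp
    qed
    define N V where "N = cn (Suc k) u" and "V = cn k (H u)"
    have nn2: "0 \<le> N" "0 \<le> V" using cn_nonneg[OF u] cn_nonneg[OF v] by (auto simp: N_def V_def)
    have s: "0 \<le> sup_norm u" "0 \<le> cn k (deriv u)"
      using u0 UCb_n_UCb sup_norm_nonneg cn_nonneg by blast+
    have le: "cn k (deriv u) \<le> N" "cn k u \<le> N" "sup_norm u \<le> N" "sup_norm (deriv u) \<le> N"
    proof -
      show "cn k u \<le> N" unfolding N_def by (rule cn_mono[OF u]) simp
      show 1: "cn k (deriv u) \<le> N" "sup_norm u \<le> N" using s by (simp_all add: N_def cn_Suc)
      show "sup_norm (deriv u) \<le> N" using cn_ge_sup_norm[OF u0(2), of 0] 1 by simp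
    qed
    have "cn k (\<lambda>x. H u x - (b x * deriv u x + c x * u x)) \<le> V + (2 ^ k * cn k b * cn k (deriv u) + 2 ^ k * cn k c * cn k u)"
      using pd pbc pb pc unfolding V_def by linarith
    also have "\<dots> \<le> V + (2 ^ k * cn k b * N + 2 ^ k * cn k c * N)"
      using nn le by (intro add_left_mono add_mono mult_left_mono) auto
    also have "\<dots> \<le> B * (V + N)"
    proof -
      have "0 \<le> 2 ^ k * (cn k b + cn k c) * V" using nn nn2 by (intro mult_nonneg_nonneg) auto
      then show ?thesis using nn2 by (simp add: B_def algebra_simps)
    qed
    finally have d: "cn k (\<lambda>x. H u x - (b x * deriv u x + c x * u x)) \<le> B * (V + N)" .
    have "cn k w \<le> 2 ^ k * cn k r * cn k (\<lambda>x. H u x - (b x * deriv u x + c x * u x))"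
      using pw by (simp add: w_def[abs_def])
    also have "\<dots> \<le> 2 ^ k * cn k r * (B * (V + N))" using d nn by (intro mult_left_mono) auto
    finally have cw: "cn k w \<le> 2 ^ k * cn k r * (B * (V + N))" .
    have "cn (Suc (Suc k)) u = sup_norm u + (sup_norm (deriv u) + cn k w)" by (simp add: cn_Suc dd)
    also have "\<dots> \<le> 2 * (V + N) + 2 ^ k * cn k r * (B * (V + N))" 
    proof -
      have "sup_norm u + sup_norm (deriv u) \<le> 2 * (V + N)" using add_mono[OF le(3,4)] nn2 by simp
      then show ?thesis using add_mono[OF _ cw] by (simp only: add.assoc[symmetric])
    qed
    also have "\<dots> = K * (V + N)" by (simp add: K_def algebra_simps)
    finally show ?thesis using mem by (simp add: N_def V_def)
  qed
  with K show ?thesis by blast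
qed

text \<open>From \<open>UCb_n 2\<close> to \<open>UCb_n 4\<close> in two bootstrapping steps, with \<open>k = 1\<close> and \<open>k = 2\<close>; the elliptic estimate for \<open>u\<close>
and for \<open>H u\<close> starts the chain of inequalities.\<close>

lemma cn4_equivalent:
  assumes "ucb_apply a \<in> UCb_n 2" "ucb_apply b \<in> UCb_n 2" "ucb_apply c \<in> UCb_n 2"
  shows "\<exists>K\<ge>0. \<forall>u. C2 u \<longrightarrow> C2 (H u) \<longrightarrow>
      ucb_apply u \<in> UCb_n 4 \<and> cn 4 u \<le> K * (norm u + norm (H u) + norm (H (H u)))"
    and "\<exists>K\<ge>0. \<forall>u. ucb_apply u \<in> UCb_n 4 \<longrightarrow>
      C2 u \<and> C2 (H u) \<and> norm u + norm (H u) + norm (H (H u)) \<le> K * cn 4 u"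
proof -
  obtain K0 where K0: "K0 \<ge> 0" "\<And>u. C2 u \<Longrightarrow> cn 2 u \<le> K0 * (norm u + norm (H u))"
    using elliptic_const by blast
  have one: "ucb_apply a \<in> UCb_n 1" "ucb_apply b \<in> UCb_n 1" "ucb_apply c \<in> UCb_n 1"
    using assms UCb_n_mono[of 1 2] by auto
  have num: "Suc 1 = 2" "Suc 2 = 3" "Suc 3 = 4" by simp_all
  obtain K1 where K1: "K1 \<ge> 0" "\<And>u. ucb_apply u \<in> UCb_n 2 \<Longrightarrow> ucb_apply (H u) \<in> UCb_n 1 \<Longrightarrow>
    ucb_apply u \<in> UCb_n 3 \<and> cn 3 u \<le> K1 * (cn 1 (H u) + cn 2 u)"
    using elliptic_regularity[OF one order_refl] unfolding num by blast
  obtain K2 where K2: "K2 \<ge> 0" "\<And>u. ucb_apply u \<in> UCb_n 3 \<Longrightarrow> ucb_apply (H u) \<in> UCb_n 2 \<Longrightarrow>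
    ucb_apply u \<in> UCb_n 4 \<and> cn 4 u \<le> K2 * (cn 2 (H u) + cn 3 u)"
    using elliptic_regularity[OF assms] unfolding num by auto
  show "\<exists>K\<ge>0. \<forall>u. C2 u \<longrightarrow> C2 (H u) \<longrightarrow>
      ucb_apply u \<in> UCb_n 4 \<and> cn 4 u \<le> K * (norm u + norm (H u) + norm (H (H u)))"
  proof (intro exI[of _ "K2 * (K0 + K1 * (2 * K0))"] conjI allI impI)
    show "0 \<le> K2 * (K0 + K1 * (2 * K0))" using K0 K1 K2 by simp
    fix u assume u: "C2 u" and v: "C2 (H u)"
    define N where "N = norm u + norm (H u) + norm (H (H u))"
    have le: "norm u + norm (H u) \<le> N" "norm (H u) + norm (H (H u)) \<le> N" by (simp_all add: N_def)
    have c2: "cn 2 u \<le> K0 * N" "cn 2 (H u) \<le> K0 * N"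
      using order_trans[OF K0(2)[OF u] mult_left_mono[OF le(1) K0(1)]]
        order_trans[OF K0(2)[OF v] mult_left_mono[OF le(2) K0(1)]] .
    have v1: "ucb_apply (H u) \<in> UCb_n 1" by (rule UCb_n_mono[OF _ v]) simp
    have c1: "cn 1 (H u) \<le> K0 * N" using cn_mono[OF v, of 1] c2(2) by simp
    have u3: "ucb_apply u \<in> UCb_n 3" "cn 3 u \<le> K1 * (cn 1 (H u) + cn 2 u)" using K1(2)[OF u v1] by auto
    have "cn 3 u \<le> K1 * (2 * K0) * N"
    proof -
      have "K1 * (cn 1 (H u) + cn 2 u) \<le> K1 * (K0 * N + K0 * N)"
        using c1 c2 K1(1) by (intro mult_left_mono) auto
      then show ?thesis using u3(2) by (simp add: mult.assoc)
    qed
    then have "K2 * (cn 2 (H u) + cn 3 u) \<le> K2 * (K0 * N + K1 * (2 * K0) * N)"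
      using c2 K2(1) by (intro mult_left_mono add_mono)
    then show "ucb_apply u \<in> UCb_n 4" "cn 4 u \<le> K2 * (K0 + K1 * (2 * K0)) * (norm u + norm (H u) + norm (H (H u)))"
      using K2(2)[OF u3(1) v] by (auto simp: N_def[symmetric] distrib_right mult.assoc)
  qed
  obtain K3 where K3: "K3 \<ge> 0" "\<And>u. ucb_apply u \<in> UCb_n 4 \<Longrightarrow>
    ucb_apply (H u) \<in> UCb_n 2 \<and> cn 2 (H u) \<le> K3 * cn 4 u"
    using H_op_UCb_n[OF assms] unfolding num by auto
  define Q where "Q = norm a + norm b + norm c"
  have Q: "0 \<le> Q" by (simp add: Q_def)
  show "\<exists>K\<ge>0. \<forall>u. ucb_apply u \<in> UCb_n 4 \<longrightarrow>
      C2 u \<and> C2 (H u) \<and> norm u + norm (H u) + norm (H (H u)) \<le> K * cn 4 u"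
  proof (intro exI[of _ "1 + K3 + Q * K3"] conjI allI impI)
    show "0 \<le> 1 + K3 + Q * K3" using K3 Q by simp
    fix u assume u: "ucb_apply u \<in> UCb_n 4"
    show "C2 u" by (rule UCb_n_mono[OF _ u]) simp
    show v: "C2 (H u)" using K3(2)[OF u] by simp
    have 1: "norm u \<le> cn 4 u" by (rule norm_le_cn[OF u])
    have 2: "norm (H u) \<le> K3 * cn 4 u" using norm_le_cn[OF v] K3(2)[OF u] by linarith
    have "norm (H (H u)) \<le> Q * cn 2 (H u)" unfolding Q_def by (rule norm_H_op_le[OF v])
    also have "\<dots> \<le> Q * (K3 * cn 4 u)" using K3(2)[OF u] Q by (intro mult_left_mono) auto
    finally show "norm u + norm (H u) + norm (H (H u)) \<le> (1 + K3 + Q * K3) * cn 4 u"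
      using 1 2 by (simp add: distrib_right mult.assoc)
  qed
qed

text \<open>The norm of \<open>UCb_n 4\<close> grows at most like \<open>exp (\<parallel>c\<parallel> t)\<close> along orbits, because it is equivalent to the graph norm
of \<open>H\<^sup>2\<close>, which commutes with \<open>T\<close>. A second factor \<open>exp (\<parallel>c\<parallel> t)\<close> comes from the powers of \<open>S(h)\<close>. The assumption
\<open>n \<ge> t\<close> keeps the step \<open>h = t/n\<close> in the range \<open>h \<le> 1\<close> of the Taylor estimate.\<close>

lemma chernoff_rate:
  fixes T :: "real \<Rightarrow> ucb \<Rightarrow>\<^sub>L ucb"
  assumes T: "generates A T"
    and coeff: "ucb_apply a \<in> UCb_n 2" "ucb_apply b \<in> UCb_n 2" "ucb_apply c \<in> UCb_n 2"
  shows "\<exists>K\<ge>0. \<forall>f t n. ucb_apply f \<in> UCb_n 4 \<longrightarrow> t > 0 \<longrightarrow> n \<ge> 1 \<longrightarrow> real n \<ge> t \<longrightarrow>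
    norm ((blinfun_apply (S (t / real n)) ^^ n) f - T t f)
      \<le> exp (2 * norm c * t) * (t\<^sup>2 / real n) * (K * cn 4 f)"
proof -
  obtain K1 where K1: "K1 \<ge> 0" "\<And>u. C2 u \<Longrightarrow> C2 (H u) \<Longrightarrow>
      ucb_apply u \<in> UCb_n 4 \<and> cn 4 u \<le> K1 * (norm u + norm (H u) + norm (H (H u)))"
    using cn4_equivalent(1)[OF coeff] by blast
  obtain K2 where K2: "K2 \<ge> 0" "\<And>u. ucb_apply u \<in> UCb_n 4 \<Longrightarrow>
      C2 u \<and> C2 (H u) \<and> norm u + norm (H u) + norm (H (H u)) \<le> K2 * cn 4 u"
    using cn4_equivalent(2)[OF coeff] by blast
  define K where "K = (taylor4_const * K1 + exp (norm c)) * K2"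
  have K: "0 \<le> K" using K1 K2 taylor4_const_nonneg by (simp add: K_def)
  have "norm ((blinfun_apply (S (t / real n)) ^^ n) f - T t f)
      \<le> exp (2 * norm c * t) * (t\<^sup>2 / real n) * (K * cn 4 f)"
    if f: "ucb_apply f \<in> UCb_n 4" and t: "t > 0" and n: "n \<ge> 1" "real n \<ge> t" for f t n
  proof -
    define h where "h = t / real n"
    have h: "0 \<le> h" "h \<le> 1" "h \<le> t"
      using t n by (auto simp: h_def divide_le_eq mult_le_cancel_left1)
    have fC: "C2 f" "C2 (H f)" and fN: "norm f + norm (H f) + norm (H (H f)) \<le> K2 * cn 4 f"
      using K2(2)[OF f] by auto
    define X where "X = exp (norm c * t)"
    have "norm ((blinfun_apply (S (t / real n)) ^^ n) f - T t f)
        \<le> real n * X * (h\<^sup>2 * (X * (K * cn 4 f)))"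
      unfolding X_def
    proof (rule chernoff_step[OF T])
      fix s assume s: "0 \<le> s" "s \<le> t"
      define u where "u = T s f"
      have u: "C2 u" "C2 (H u)" "H u = T s (H f)" "H (H u) = T s (H (H f))"
        using T_orbit[OF T fC(1) s(1)] T_orbit[OF T fC(2) s(1)] by (auto simp: u_def)
      have TX: "norm (T s) \<le> X"
      proof -
        have "norm (T s) \<le> exp (norm c * s)" by (rule norm_T_exp_le[OF T s(1)])
        also have "\<dots> \<le> X" using s by (simp add: X_def mult_left_mono)
        finally show ?thesis .
      qed
      have Tn: "norm (T s g) \<le> X * norm g" for g
        by (rule order_trans[OF norm_blinfun mult_right_mono[OF TX norm_ge_zero]])
      have uN: "norm u + norm (H u) + norm (H (H u)) \<le> X * (K2 * cn 4 f)"
      proof -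
        have "norm u + norm (H u) + norm (H (H u)) \<le> X * (norm f + norm (H f) + norm (H (H f)))"
          using Tn[of f, folded u_def] Tn[of "H f", folded u(3)] Tn[of "H (H f)", folded u(4)]
          by (simp add: distrib_left)
        also have "\<dots> \<le> X * (K2 * cn 4 f)" using fN by (intro mult_left_mono) (auto simp: X_def)
        finally show ?thesis .
      qed
      have u4: "ucb_apply u \<in> UCb_n 4" "cn 4 u \<le> K1 * (X * (K2 * cn 4 f))"
        using K1(2)[OF u(1,2)] order_trans[OF _ mult_left_mono[OF uN K1(1)]] by auto
      have "norm (S h u - u - h *\<^sub>R H u) \<le> taylor4_const * h\<^sup>2 * cn 4 u" by (rule S_taylor4[OF u4(1) h(1,2)])
      also have "\<dots> \<le> taylor4_const * h\<^sup>2 * (K1 * (X * (K2 * cn 4 f)))"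
        using u4(2) taylor4_const_nonneg by (intro mult_left_mono) auto
      finally have 1: "norm (S h u - u - h *\<^sub>R H u) \<le> h\<^sup>2 * (X * (taylor4_const * K1 * K2 * cn 4 f))"
        by (simp add: mult_ac)
      have "norm (T h u - u - h *\<^sub>R H u) \<le> h\<^sup>2 * exp (norm c) * norm (H (H u))"
      proof (rule T_tangent_le[OF T u(1,2) h(1)])
        fix r assume r: "0 \<le> r" "r \<le> h"
        have "norm (T r) \<le> exp (norm c * r)" by (rule norm_T_exp_le[OF T r(1)])
        also have "\<dots> \<le> exp (norm c)" using r h by (simp add: mult_left_le)
        finally show "norm (T r) \<le> exp (norm c)" .
      qed
      also have "\<dots> \<le> h\<^sup>2 * exp (norm c) * (X * (K2 * cn 4 f))"
      proof (rule mult_left_mono)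
        show "norm (H (H u)) \<le> X * (K2 * cn 4 f)"
          using uN norm_ge_zero[of u] norm_ge_zero[of "H u"] by linarith
      qed simp
      finally have 2: "norm (T h u - u - h *\<^sub>R H u) \<le> h\<^sup>2 * (X * (exp (norm c) * K2 * cn 4 f))"
        by (simp add: mult_ac)
      have "S h u - T h u = (S h u - u - h *\<^sub>R H u) - (T h u - u - h *\<^sub>R H u)" by simp
      then have "norm (S h u - T h u) \<le> norm (S h u - u - h *\<^sub>R H u) + norm (T h u - u - h *\<^sub>R H u)"
        by (metis norm_triangle_ineq4)
      also have "\<dots> \<le> h\<^sup>2 * (X * (K * cn 4 f))" using 1 2 by (simp add: K_def distrib_left distrib_right)
      finally show "norm (S (t / real n) (T s f) - T (t / real n) (T s f)) \<le> h\<^sup>2 * (exp (norm c * t) * (K * cn 4 f))"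
        by (simp only: u_def h_def X_def)
    qed (use t n in auto)
    also have "\<dots> = (X * X) * (t\<^sup>2 / real n) * (K * cn 4 f)"
      using n by (simp add: h_def field_simps power2_eq_square)
    also have "X * X = exp (2 * norm c * t)" by (simp add: X_def exp_add[symmetric])
    finally show ?thesis .
  qed
  with K show ?thesis by blast
qed

lemma S_tendsto_id: "((\<lambda>t. norm (S t f - S 0 f)) \<longlongrightarrow> 0) (at_right 0)"
proof -
  have "((\<lambda>t. S t f) \<longlongrightarrow> f) (at_right 0)"
  proof (rule tendsto_from_dense[of "\<lambda>t. blinfun_apply (S t)" "\<lambda>x. x"])
    have "\<forall>\<^sub>F t in at_right 0. 0 < t \<and> t \<le> (1::real)"
      by (auto simp: eventually_at_right_field intro!: exI[of _ 1])
    then show "\<forall>\<^sub>F t in at_right 0. \<forall>x. norm (S t x) \<le> exp (norm c) * norm x"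
    proof eventually_elim
      case (elim t)
      have "norm (S t) \<le> exp (norm c * t)" using norm_S_exp_le elim by simp
      also have "\<dots> \<le> exp (norm c)" using elim by (simp add: mult_left_le)
      finally show ?case by (meson mult_right_mono norm_blinfun norm_ge_zero order_trans)
    qed
    show "closure {u. C2 u} = UNIV" by (rule C2_dense)
    fix g assume "g \<in> {u. C2 u}"
    then have "((\<lambda>t. t *\<^sub>R ((S t g - g) /\<^sub>R t)) \<longlongrightarrow> 0 *\<^sub>R H g) (at_right 0)"
      by (intro tendsto_scaleR tendsto_ident_at S_derivative) simp
    then have lim: "((\<lambda>t. t *\<^sub>R ((S t g - g) /\<^sub>R t)) \<longlongrightarrow> 0) (at_right 0)" by simp
    have "\<forall>\<^sub>F t in at_right 0. t *\<^sub>R ((S t g - g) /\<^sub>R t) = S t g - g"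
      using eventually_at_right_less[of "0::real"] by eventually_elim simp
    from Lim_transform_eventually[OF lim this] show "((\<lambda>t. S t g) \<longlongrightarrow> g) (at_right 0)"
      by (rule LIM_zero_cancel)
  qed (auto intro: bounded_linear.linear blinfun.bounded_linear_right bounded_linear_ident)
  then show ?thesis by (simp add: S_zero tendsto_norm_zero LIM_zero)
qed

end

section \<open>Linear combinations in the Hoelder spaces\<close>

text \<open>The exponents of \<open>f\<close> and \<open>g\<close> may differ. For a bounded function the exponent can be lowered: at distances up to
\<open>1\<close> the smaller exponent gives the larger power, and at larger distances \<open>2 B\<close> is a bound.\<close>

lemma Hoelder_lincomb:
  assumes f: "bounded (range f)" "Hoelder_continuous f" and g: "bounded (range g)" "Hoelder_continuous g"
  shows "Hoelder_continuous (\<lambda>x. r * f x + s * g x)"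
proof -
  have lower: "\<exists>L\<ge>0. \<forall>x y. \<bar>f x - f y\<bar> \<le> L * \<bar>x - y\<bar> powr \<theta>"
    if "bounded (range f)" and K: "K \<ge> 0" "\<And>x y. \<bar>f x - f y\<bar> \<le> K * \<bar>x - y\<bar> powr \<theta>1" and \<theta>: "0 < \<theta>" "\<theta> \<le> \<theta>1"
    for f :: "real \<Rightarrow> real" and K \<theta> \<theta>1
  proof -
    obtain B where B: "\<And>x. \<bar>f x\<bar> \<le> B" using \<open>bounded (range f)\<close> by (auto simp: bounded_iff)
    have B0: "0 \<le> B" using B[of 0] by linarith
    have "\<bar>f x - f y\<bar> \<le> (K + 2 * B) * \<bar>x - y\<bar> powr \<theta>" for x y
    proof (cases "\<bar>x - y\<bar> \<le> 1")
      case True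
      have "\<bar>x - y\<bar> powr \<theta>1 \<le> \<bar>x - y\<bar> powr \<theta>"
        using \<theta> True by (cases "x = y") (auto intro!: powr_mono')
      then have "K * \<bar>x - y\<bar> powr \<theta>1 \<le> (K + 2 * B) * \<bar>x - y\<bar> powr \<theta>"
        using K B0 by (intro mult_mono) auto
      then show ?thesis using K(2)[of x y] by linarith
    next
      case False
      then have "1 \<le> \<bar>x - y\<bar> powr \<theta>" using \<theta> by (simp add: ge_one_powr_ge_zero)
      then have "(K + 2 * B) * 1 \<le> (K + 2 * B) * \<bar>x - y\<bar> powr \<theta>" using K B0 by (intro mult_left_mono) auto
      moreover have "\<bar>f x - f y\<bar> \<le> 2 * B" using B[of x] B[of y] by linarith
      moreover have "2 * B \<le> (K + 2 * B) * 1" using K(1) by simp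
      ultimately show ?thesis by (meson order_trans)
    qed
    then show ?thesis using K B0 by (intro exI[of _ "K + 2 * B"]) auto
  qed
  obtain K1 \<theta>1 where K1: "K1 \<ge> 0" "\<theta>1 \<in> {0<..1}" "\<And>x y. \<bar>f x - f y\<bar> \<le> K1 * \<bar>x - y\<bar> powr \<theta>1"
    using f(2) unfolding Hoelder_continuous_def by blast
  obtain K2 \<theta>2 where K2: "K2 \<ge> 0" "\<theta>2 \<in> {0<..1}" "\<And>x y. \<bar>g x - g y\<bar> \<le> K2 * \<bar>x - y\<bar> powr \<theta>2"
    using g(2) unfolding Hoelder_continuous_def by blast
  define \<theta> where "\<theta> = min \<theta>1 \<theta>2"
  have \<theta>: "\<theta> \<in> {0<..1}" "\<theta> \<le> \<theta>1" "\<theta> \<le> \<theta>2" using K1 K2 by (auto simp: \<theta>_def)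
  obtain L1 where L1: "L1 \<ge> 0" "\<And>x y. \<bar>f x - f y\<bar> \<le> L1 * \<bar>x - y\<bar> powr \<theta>"
    using lower[OF f(1) K1(1,3) _ \<theta>(2)] \<theta>(1) by auto
  obtain L2 where L2: "L2 \<ge> 0" "\<And>x y. \<bar>g x - g y\<bar> \<le> L2 * \<bar>x - y\<bar> powr \<theta>"
    using lower[OF g(1) K2(1,3) _ \<theta>(3)] \<theta>(1) by auto
  have "\<bar>(r * f x + s * g x) - (r * f y + s * g y)\<bar> \<le> (\<bar>r\<bar> * L1 + \<bar>s\<bar> * L2) * \<bar>x - y\<bar> powr \<theta>" for x y
  proof -
    have "(r * f x + s * g x) - (r * f y + s * g y) = r * (f x - f y) + s * (g x - g y)"
      by (simp add: algebra_simps)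
    then have "\<bar>(r * f x + s * g x) - (r * f y + s * g y)\<bar> \<le> \<bar>r\<bar> * \<bar>f x - f y\<bar> + \<bar>s\<bar> * \<bar>g x - g y\<bar>"
      unfolding abs_mult[symmetric] by linarith
    also have "\<dots> \<le> \<bar>r\<bar> * (L1 * \<bar>x - y\<bar> powr \<theta>) + \<bar>s\<bar> * (L2 * \<bar>x - y\<bar> powr \<theta>)"
      using L1 L2 by (intro add_mono mult_left_mono) auto
    finally show ?thesis by (simp add: algebra_simps)
  qed
  then show ?thesis unfolding Hoelder_continuous_def
    using L1 L2 \<theta> by (intro exI[of _ "\<bar>r\<bar> * L1 + \<bar>s\<bar> * L2"] conjI bexI[of _ \<theta>]) auto
qed

lemma HCb_lincomb:
  assumes f: "f \<in> HCb k" and g: "g \<in> HCb k"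
  shows "(\<lambda>x. r * f x + s * g x) \<in> HCb k"
proof -
  have df: "((deriv ^^ j) f has_real_derivative (deriv ^^ Suc j) f x) (at x)"
    and dg: "((deriv ^^ j) g has_real_derivative (deriv ^^ Suc j) g x) (at x)" if "j < k" for j x
    using f g that by (auto simp: HCb_def times_differentiable_def DERIV_deriv_iff_field_differentiable)
  have d: "((\<lambda>x. r * (deriv ^^ j) f x + s * (deriv ^^ j) g x) has_real_derivative
      r * (deriv ^^ Suc j) f x + s * (deriv ^^ Suc j) g x) (at x)" if "j < k" for j x
    using df[OF that] dg[OF that] by (intro DERIV_add DERIV_cmult)
  have eq: "(deriv ^^ j) (\<lambda>x. r * f x + s * g x) = (\<lambda>x. r * (deriv ^^ j) f x + s * (deriv ^^ j) g x)"
    if "j \<le> k" for j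
    using that
  proof (induction j)
    case (Suc j)
    have "(deriv ^^ Suc j) (\<lambda>x. r * f x + s * g x) = deriv (\<lambda>x. r * (deriv ^^ j) f x + s * (deriv ^^ j) g x)"
      using Suc by simp
    also have "\<dots> = (\<lambda>x. r * (deriv ^^ Suc j) f x + s * (deriv ^^ Suc j) g x)"
      by (rule ext, rule DERIV_imp_deriv, rule d) (use Suc in simp)
    finally show ?case .
  qed simp
  have "times_differentiable k (\<lambda>x. r * f x + s * g x)"
    unfolding times_differentiable_def
  proof (intro allI impI)
    fix j x assume j: "j < k"
    show "(deriv ^^ j) (\<lambda>x. r * f x + s * g x) field_differentiable at x"
      unfolding eq[OF less_imp_le[OF j]] using d[OF j] by (auto simp: field_differentiable_def)
  qed
  moreover have "bounded (range ((deriv ^^ j) (\<lambda>x. r * f x + s * g x)))"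
      "Hoelder_continuous ((deriv ^^ j) (\<lambda>x. r * f x + s * g x))" if j: "j \<le> k" for j
  proof -
    have b: "bounded (range ((deriv ^^ j) f))" "bounded (range ((deriv ^^ j) g))"
      "Hoelder_continuous ((deriv ^^ j) f)" "Hoelder_continuous ((deriv ^^ j) g)"
      using f g j by (auto simp: HCb_def)
    then show "Hoelder_continuous ((deriv ^^ j) (\<lambda>x. r * f x + s * g x))"
      unfolding eq[OF j] by (intro Hoelder_lincomb)
    have "(\<lambda>x. r * (deriv ^^ j) f x + s * (deriv ^^ j) g x) \<in> UCb"
      using b by (intro UCb_add UCb_mult UCb_const Hoelder_UCb)
    then show "bounded (range ((deriv ^^ j) (\<lambda>x. r * f x + s * g x)))"
      unfolding eq[OF j] by (simp add: UCb_def)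
  qed
  ultimately show ?thesis by (simp add: HCb_def)
qed

lemma subspace_HCb: "subspace {u :: ucb. ucb_apply u \<in> HCb k}"
proof (rule subspaceI)
  have "ucb_apply 0 = (\<lambda>x. 0)" by (simp add: zero_ucb.rep_eq)
  then show "0 \<in> {u. ucb_apply u \<in> HCb k}" using UCb_n_Suc_HCb[OF UCb_n_const] by simp
next
  fix u v :: ucb assume "u \<in> {u. ucb_apply u \<in> HCb k}" "v \<in> {u. ucb_apply u \<in> HCb k}"
  moreover have "ucb_apply (u + v) = (\<lambda>x. 1 * u x + 1 * v x)" by (auto simp: plus_ucb.rep_eq)
  ultimately show "u + v \<in> {u. ucb_apply u \<in> HCb k}" using HCb_lincomb[of u k v 1 1] by simp
next
  fix r :: real and u :: ucb assume "u \<in> {u. ucb_apply u \<in> HCb k}"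
  moreover have "ucb_apply (r *\<^sub>R u) = (\<lambda>x. r * u x + 0 * u x)" by (auto simp: scaleR_ucb.rep_eq)
  ultimately show "r *\<^sub>R u \<in> {u. ucb_apply u \<in> HCb k}" using HCb_lincomb[of u k u r 0] by simp
qed

section \<open>The core of the generator and tangency\<close>

context elliptic
begin

lemma linear_operator_H_graph: "linear_operator (H_graph a b c)"
  unfolding linear_operator_def
proof
  note sub = subspace_HCb[of 2]
  have C2: "C2 u" if "ucb_apply u \<in> HCb 2" for u by (rule HCb_UCb_n[OF that])
  show "subspace (H_graph a b c)"
  proof (rule subspaceI)
    show "0 \<in> H_graph a b c"
      using subspace_0[OF sub] H_op_zero[of a b c] by (auto simp: H_graph_def zero_prod_def)
    fix p q assume "p \<in> H_graph a b c" "q \<in> H_graph a b c"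
    then obtain u v where p: "p = (u, H u)" "ucb_apply u \<in> HCb 2" and q: "q = (v, H v)" "ucb_apply v \<in> HCb 2"
      by (auto simp: H_graph_def)
    have "H (u + v) = H u + H v"
      using C2_lincomb(2)[OF C2[OF p(2)] C2[OF q(2)], where r = 1 and s = 1] by simp
    then show "p + q \<in> H_graph a b c" using subspace_add[OF sub, of u v] p q by (auto simp: H_graph_def)
  next
    fix r :: real and p assume "p \<in> H_graph a b c"
    then obtain u where p: "p = (u, H u)" "ucb_apply u \<in> HCb 2" by (auto simp: H_graph_def)
    have "H (r *\<^sub>R u) = r *\<^sub>R H u"
      using C2_lincomb(2)[OF C2[OF p(2)] C2[OF p(2)], where r = r and s = 0] by simp
    then show "r *\<^sub>R p \<in> H_graph a b c" using subspace_scale[OF sub, of u r] p by (auto simp: H_graph_def)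
  qed
  show "single_valued (H_graph a b c)" by (auto simp: H_graph_def single_valued_def)
qed

lemma closable_H_graph: "closable (H_graph a b c)"
  unfolding closable_def closure_H_graph using linear_operator_H_graph linear_operator_A by blast

lemma HCb_dense: "closure {u :: ucb. ucb_apply u \<in> HCb 2} = UNIV"
proof -
  have "{u. C2 u} \<subseteq> closure {u :: ucb. ucb_apply u \<in> HCb 2}"
  proof
    fix u assume "u \<in> {u. C2 u}"
    then have u: "C2 u" by simp
    show "u \<in> closure {u :: ucb. ucb_apply u \<in> HCb 2}"
      unfolding closure_approachable
    proof (intro allI impI)
      fix e :: real assume e: "e > 0"
      obtain v where v: "ucb_apply v \<in> HCb 2" "C2 v" "cn 2 (ucb_apply (v - u)) \<le> e / 2"
        using HCb_approx_C2[OF u, of "e / 2"] e by auto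
      have "norm (v - u) \<le> cn 2 (ucb_apply (v - u))" by (rule norm_le_cn[OF C2_diff(1)[OF v(2) u]])
      then show "\<exists>y\<in>{u. ucb_apply u \<in> HCb 2}. dist y u < e"
        using v e by (intro bexI[of _ v]) (auto simp: dist_norm)
    qed
  qed
  then have "closure {u. C2 u} \<subseteq> closure {u :: ucb. ucb_apply u \<in> HCb 2}"
    by (intro closure_minimal closed_closure)
  then show ?thesis using C2_dense by auto
qed

lemma deriv_at_0_S: "C2 u \<Longrightarrow> deriv_at_0 S u = H u"
  unfolding deriv_at_0_def by (rule tendsto_Lim[OF trivial_limit_at_right_real S_derivative])

text \<open>The subspace in the definition is taken to be \<open>HCb 2\<close>: there the derivative of \<open>S\<close> at \<open>0\<close> is \<open>H\<close>, so the operator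
to be closed is literally \<open>H_graph a b c\<close>.\<close>

lemma Chernoff_tangent_S: "Chernoff_tangent S A"
  unfolding Chernoff_tangent_def
proof (intro conjI allI exI[of _ "{u :: ucb. ucb_apply u \<in> HCb 2}"] ballI)
  let ?D = "{u :: ucb. ucb_apply u \<in> HCb 2}"
  have "(u, deriv_at_0 S u) = (u, H u)" if "ucb_apply u \<in> HCb 2" for u
    using deriv_at_0_S[OF HCb_UCb_n[OF that]] by simp
  then have eq: "(\<lambda>f. (f, deriv_at_0 S f)) ` ?D = H_graph a b c"
    by (force simp: H_graph_def image_def)
  show "closable ((\<lambda>f. (f, deriv_at_0 S f)) ` ?D)" unfolding eq by (rule closable_H_graph)
  show "closure ((\<lambda>f. (f, deriv_at_0 S f)) ` ?D) = A" unfolding eq by (rule closure_H_graph)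
  show "((\<lambda>t. norm (S t f - S 0 f)) \<longlongrightarrow> 0) (at_right 0)" for f by (rule S_tendsto_id)
  show "S 0 = id_blinfun" by (rule S_zero)
  show "subspace ?D" by (rule subspace_HCb)
  show "closure ?D = UNIV" by (rule HCb_dense)
  show "\<exists>g. ((\<lambda>t. (S t f - f) /\<^sub>R t) \<longlongrightarrow> g) (at_right 0)" if "f \<in> ?D" for f
    using S_derivative[OF HCb_UCb_n] that by blast
qed

lemma S_tangent_Cb_infty:
  assumes "ucb_apply f \<in> Cb_infty"
  shows "((\<lambda>t. 1 / t * norm (S t f - f - t *\<^sub>R H f)) \<longlongrightarrow> 0) (at_right 0)"
proof -
  have f: "C2 f" using assms by (auto simp: Cb_infty_def)
  have "((\<lambda>t. norm ((S t f - f) /\<^sub>R t - H f)) \<longlongrightarrow> 0) (at_right 0)"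
    by (intro tendsto_norm_zero LIM_zero S_derivative f)
  moreover have "\<forall>\<^sub>F t in at_right 0. norm ((S t f - f) /\<^sub>R t - H f) = 1 / t * norm (S t f - f - t *\<^sub>R H f)"
    using eventually_at_right_less[of "0::real"]
  proof eventually_elim
    case (elim t)
    then have "(S t f - f) /\<^sub>R t - H f = (1 / t) *\<^sub>R (S t f - f - t *\<^sub>R H f)"
      by (simp add: scaleR_diff_right inverse_eq_divide)
    then show ?case using elim by (simp only: norm_scaleR) simp
  qed
  ultimately show ?thesis by (rule Lim_transform_eventually)
qed

end

theorem theorem4:
  fixes a b c :: ucb
  assumes "(INF x. a x) > 0"
  shows "let H = H_graph a b c; Hbar = closure H; S = S_op a b c; \<gamma> = (SUP x. c x) in
    (closable H \<and> is_generator Hbar \<and>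
      (\<forall>t\<ge>0. norm (semigroup_of Hbar t) \<le> exp (\<gamma> * t))) \<and>
    (\<forall>t\<ge>0. (\<forall>f::ucb. S_fun a b c t f \<in> UCb) \<and> bounded_linear (S_map a b c t)) \<and>
    (\<forall>f::ucb. ucb_apply f \<in> Cb_infty \<longrightarrow>
      ((\<lambda>t. 1 / t * norm (blinfun_apply (S t) f - f - t *\<^sub>R H_op a b c f)) \<longlongrightarrow> 0) (at_right 0)) \<and>
    (Chernoff_conditions S Hbar \<and> Chernoff_function S Hbar) \<and>
    (ucb_apply a \<in> HCb 2 \<and> ucb_apply b \<in> HCb 2 \<and> ucb_apply c \<in> HCb 2 \<longrightarrow>
      (\<exists>w\<ge>0. \<exists>C::nat \<Rightarrow> real. (\<forall>j\<le>4. C j \<ge> 0) \<and>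
        (\<forall>f::ucb. \<forall>t>0. \<forall>n::nat. ucb_apply f \<in> UCb_n 4 \<and> n \<ge> 1 \<and> real n \<ge> t \<longrightarrow>
          norm ((blinfun_apply (S (t / real n)) ^^ n) f - semigroup_of Hbar t f)
            \<le> exp (w * t) * (t\<^sup>2 / real n) * (\<Sum>j=0..4. C j * sup_norm ((deriv ^^ j) f))))) \<and>
    (\<forall>T>0. \<forall>g::ucb.
      (\<lambda>n. SUP t\<in>{0<..T}.
        ereal (norm ((blinfun_apply (S (t / real n)) ^^ n) g - semigroup_of Hbar t g)))
      \<longlonglongrightarrow> 0)"
proof -
  define a0 where "a0 = (INF x. a x)"
  have a0: "a0 > 0" using assms by (simp add: a0_def)
  have "bdd_below (range (ucb_apply a))"
    using ucb_apply_le_norm[of a] by (intro bdd_belowI2[of _ "- norm a"]) (auto simp: abs_le_iff minus_le_iff)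
  then have a_ge: "a x \<ge> a0" for x unfolding a0_def by (rule cINF_lower) simp
  interpret E: elliptic a b c a0 by unfold_locales (use a0 a_ge in auto)
  define L where "L = closure (H_graph a b c)"
  have L: "L = E.A" unfolding L_def by (rule E.closure_H_graph)
  define T where "T = semigroup_of L"
  have ex: "\<exists>T. generates L T" unfolding L using E.generates_euler_limit by blast
  then have gen: "is_generator L" by (simp add: is_generator_def)
  have "generates L T" unfolding T_def semigroup_of_def by (rule someI_ex[OF ex])
  then have T: "generates E.A T" by (simp only: L)
  have c_le: "c x \<le> (SUP x. c x)" for x
    using ucb_apply_le_norm[of c]
    by (intro cSUP_upper bdd_aboveI2[of _ _ "norm c"]) (auto simp: abs_le_iff)
  have SUP: "(\<lambda>n. SUP t\<in>I. ereal (norm ((blinfun_apply (S_op a b c (t / real n)) ^^ n) g - T t g))) \<longlonglongrightarrow> 0"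
    if "t0 > 0" "I \<noteq> {}" "I \<subseteq> {0..t0}" for t0 I g
    by (rule E.chernoff_SUP_tendsto[OF T that])
  have tangent: "Chernoff_tangent (S_op a b c) L" unfolding L by (rule E.Chernoff_tangent_S)
  have cond: "Chernoff_conditions (S_op a b c) L"
    unfolding Chernoff_conditions_def closed_densely_defined_def
    using gen tangent E.linear_operator_A E.closed_A E.dense E.norm_S_exp_le unfolding L by blast
  have func: "Chernoff_function (S_op a b c) L"
    unfolding Chernoff_function_def T_def[symmetric] using tangent by (auto intro!: SUP)
  have rate: "\<exists>w\<ge>0. \<exists>C::nat \<Rightarrow> real. (\<forall>j\<le>4. C j \<ge> 0) \<and>
      (\<forall>f::ucb. \<forall>t>0. \<forall>n::nat. ucb_apply f \<in> UCb_n 4 \<and> n \<ge> 1 \<and> real n \<ge> t \<longrightarrow>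
        norm ((blinfun_apply (S_op a b c (t / real n)) ^^ n) f - T t f)
          \<le> exp (w * t) * (t\<^sup>2 / real n) * (\<Sum>j=0..4. C j * sup_norm ((deriv ^^ j) f)))"
    if coeff: "ucb_apply a \<in> HCb 2" "ucb_apply b \<in> HCb 2" "ucb_apply c \<in> HCb 2"
  proof -
    obtain K where K: "K \<ge> 0" "\<And>f t n. ucb_apply f \<in> UCb_n 4 \<Longrightarrow> t > 0 \<Longrightarrow> n \<ge> 1 \<Longrightarrow> real n \<ge> t \<Longrightarrow>
        norm ((blinfun_apply (S_op a b c (t / real n)) ^^ n) f - T t f)
          \<le> exp (2 * norm c * t) * (t\<^sup>2 / real n) * (K * cn 4 f)"
      using E.chernoff_rate[OF T HCb_UCb_n HCb_UCb_n HCb_UCb_n, OF coeff] by blast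
    have eq: "(\<Sum>j=0..4. K * sup_norm ((deriv ^^ j) f)) = K * cn 4 f" for f
      by (simp add: cn_def sum_distrib_left atLeast0AtMost)
    show ?thesis
      by (intro exI[of _ "2 * norm c"] conjI exI[of _ "\<lambda>_. K"]) (use K in \<open>auto simp: eq\<close>)
  qed
  show ?thesis
    unfolding Let_def L_def[symmetric] T_def[symmetric]
  proof (intro conjI allI impI)
    show "closable (H_graph a b c)" by (rule E.closable_H_graph)
    show "is_generator L" by (rule gen)
    show "norm (T t) \<le> exp ((SUP x. c x) * t)" if "0 \<le> t" for t
      by (rule E.norm_T_le[OF T that c_le])
    show "S_fun a b c t f \<in> UCb" if "0 \<le> t" for t and f :: ucb by (rule E.S_fun_UCb[OF that ucb_apply])
    show "bounded_linear (S_map a b c t)" if "0 \<le> t" for t by (rule E.bounded_linear_S_map[OF that])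
    show "((\<lambda>t. 1 / t * norm (S_op a b c t f - f - t *\<^sub>R H_op a b c f)) \<longlongrightarrow> 0) (at_right 0)"
      if "ucb_apply f \<in> Cb_infty" for f by (rule E.S_tangent_Cb_infty[OF that])
    show "Chernoff_conditions (S_op a b c) L" by (rule cond)
    show "Chernoff_function (S_op a b c) L" by (rule func)
  next
    assume "ucb_apply a \<in> HCb 2 \<and> ucb_apply b \<in> HCb 2 \<and> ucb_apply c \<in> HCb 2"
    then show "\<exists>w\<ge>0. \<exists>C::nat \<Rightarrow> real. (\<forall>j\<le>4. C j \<ge> 0) \<and>
      (\<forall>f::ucb. \<forall>t>0. \<forall>n::nat. ucb_apply f \<in> UCb_n 4 \<and> n \<ge> 1 \<and> real n \<ge> t \<longrightarrow>
        norm ((blinfun_apply (S_op a b c (t / real n)) ^^ n) f - T t f)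
          \<le> exp (w * t) * (t\<^sup>2 / real n) * (\<Sum>j=0..4. C j * sup_norm ((deriv ^^ j) f)))"
      using rate by blast
  next
    fix t0 :: real and g assume "0 < t0"
    then show "(\<lambda>n. SUP t\<in>{0<..t0}.
        ereal (norm ((blinfun_apply (S_op a b c (t / real n)) ^^ n) g - T t g))) \<longlonglongrightarrow> 0"
      by (intro SUP[of t0]) auto
  qed
qed

end
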